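(* Let $D$ be a smooth ($C^1$) Jordan domain in $\mathbb C$, let $\varphi:\partial D\to\mathbb R$ be a continuous function, and let $0<q<1$. Then there is a weak solution $U$ of the quasilinear Poisson equation $$\triangle U(z)=|U(z)|^{q-1}U(z)$$ in $D$ which is continuous in $\overline D$ with $U|_{\partial D}=\varphi$ and $U\in C^{1,\alpha}_{\rm loc}(D)$ for all $\alpha\in(0,1)$. If in addition $\varphi$ is Hölder continuous with some order $\beta\in(0,1)$, then $U$ is also Hölder continuous in $\overline D$ with the same order.
   Context: A Jordan domain is a bounded domain in $\mathbb C$ whose boundary is a Jordan curve (a continuous one-to-one image of the unit circle); smooth means that this curve is $C^1$. The function $t\mapsto|t|^{q-1}t=|t|^q\,{\rm sign}\,t$ is taken to be $0$ at $t=0$. A weak solution of $\triangle U=f(U)$ in $D$ is a function $U\in C(D)\cap W^{1,2}_{\rm loc}(D)$ such that $\int_D\langle\nabla U,\nabla\eta\rangle\,dm+\int_D f(U)\,\eta\,dm=0$ for all $\eta\in C(D)\cap W^{1,2}(D)$ with compact support in $D$, where $dm$ is Lebesgue measure in the plane. *)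

theory Defs
  imports "HOL-Analysis.Analysis"
begin

text \<open>Continuously differentiable Jordan curves. The parametrisation lives on the unit circle, so
  differentiability of \<open>g \<circ> cis\<close> on all of \<open>\<real>\<close> also forces the tangents to match where the curve
  closes up. The parametrisation is regular (nowhere vanishing derivative): otherwise curves with
  corners and cusps would qualify.\<close>

definition C1_jordan_curve :: "complex set \<Rightarrow> bool" where
  "C1_jordan_curve J \<longleftrightarrow>
     (\<exists>g g'. continuous_on (sphere 0 1) g \<and> inj_on g (sphere 0 1) \<and> J = g ` sphere 0 1 \<and>
        (\<forall>t::real. ((\<lambda>s. g (cis s)) has_vector_derivative g' t) (at t)) \<and>
        continuous_on UNIV g' \<and> (\<forall>t. g' t \<noteq> 0))"

definition smooth_jordan_domain :: "complex set \<Rightarrow> bool" where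
  "smooth_jordan_domain D \<longleftrightarrow>
     open D \<and> connected D \<and> D \<noteq> {} \<and> bounded D \<and> C1_jordan_curve (frontier D)"

definition holder_on :: "real \<Rightarrow> 'a::metric_space set \<Rightarrow> ('a \<Rightarrow> 'b::metric_space) \<Rightarrow> bool" where
  "holder_on \<alpha> S f \<longleftrightarrow> (\<exists>C. \<forall>x\<in>S. \<forall>y\<in>S. dist (f x) (f y) \<le> C * dist x y powr \<alpha>)"

definition C1_holder_loc :: "real \<Rightarrow> 'a::euclidean_space set \<Rightarrow> ('a \<Rightarrow> real) \<Rightarrow> bool" where
  "C1_holder_loc \<alpha> D u \<longleftrightarrow>
     (\<exists>G. (\<forall>z\<in>D. GDERIV u z :> G z) \<and> (\<forall>K. compact K \<and> K \<subseteq> D \<longrightarrow> holder_on \<alpha> K G))"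

primrec C_k :: "nat \<Rightarrow> ('a::euclidean_space \<Rightarrow> real) \<Rightarrow> bool" where
  "C_k 0 f \<longleftrightarrow> continuous_on UNIV f"
| "C_k (Suc k) f \<longleftrightarrow>
     (\<forall>x. f differentiable (at x)) \<and> (\<forall>b\<in>Basis. C_k k (\<lambda>x. frechet_derivative f (at x) b))"

text \<open>Functions on \<open>D\<close> are represented by total functions whose values outside \<open>D\<close> are ignored,
  except for test functions, which are extended by zero.\<close>

definition compact_support_in :: "'a::euclidean_space set \<Rightarrow> ('a \<Rightarrow> real) \<Rightarrow> bool" where
  "compact_support_in D f \<longleftrightarrow> (\<exists>K. compact K \<and> K \<subseteq> D \<and> (\<forall>z\<in>D - K. f z = 0))"

definition test_function :: "'a::euclidean_space set \<Rightarrow> ('a \<Rightarrow> real) \<Rightarrow> bool" where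
  "test_function D \<psi> \<longleftrightarrow> (\<forall>k. C_k k \<psi>) \<and> compact_support_in D \<psi> \<and> (\<forall>z. z \<notin> D \<longrightarrow> \<psi> z = 0)"

definition L1_loc :: "'a::euclidean_space set \<Rightarrow> ('a \<Rightarrow> 'b::euclidean_space) \<Rightarrow> bool" where
  "L1_loc D f \<longleftrightarrow> (\<forall>K. compact K \<and> K \<subseteq> D \<longrightarrow> set_integrable lebesgue K f)"

definition L2_on :: "'a::euclidean_space set \<Rightarrow> ('a \<Rightarrow> 'b::euclidean_space) \<Rightarrow> bool" where
  "L2_on S f \<longleftrightarrow>
     set_borel_measurable lebesgue S f \<and> set_integrable lebesgue S (\<lambda>z. (norm (f z))\<^sup>2)"

definition L2_loc :: "'a::euclidean_space set \<Rightarrow> ('a \<Rightarrow> 'b::euclidean_space) \<Rightarrow> bool" where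
  "L2_loc D f \<longleftrightarrow> (\<forall>K. compact K \<and> K \<subseteq> D \<longrightarrow> L2_on K f)"

definition weak_gradient ::
    "'a::euclidean_space set \<Rightarrow> ('a \<Rightarrow> real) \<Rightarrow> ('a \<Rightarrow> 'a) \<Rightarrow> bool" where
  "weak_gradient D u G \<longleftrightarrow> L1_loc D u \<and> L1_loc D G \<and>
     (\<forall>\<psi>. test_function D \<psi> \<longrightarrow> (\<forall>b\<in>Basis.
        (LINT z:D|lebesgue. u z * frechet_derivative \<psi> (at z) b)
          = - (LINT z:D|lebesgue. (G z \<bullet> b) * \<psi> z)))"

text \<open>Membership in the Sobolev spaces \<open>W\<^sup>1\<^sup>,\<^sup>2(D)\<close> and \<open>W\<^sup>1\<^sup>,\<^sup>2\<^sub>l\<^sub>o\<^sub>c(D)\<close>, with the weak gradient (which is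
  unique up to null sets) as an explicit argument.\<close>

definition W12 :: "'a::euclidean_space set \<Rightarrow> ('a \<Rightarrow> real) \<Rightarrow> ('a \<Rightarrow> 'a) \<Rightarrow> bool" where
  "W12 D u G \<longleftrightarrow> weak_gradient D u G \<and> L2_on D u \<and> L2_on D G"

definition W12_loc :: "'a::euclidean_space set \<Rightarrow> ('a \<Rightarrow> real) \<Rightarrow> ('a \<Rightarrow> 'a) \<Rightarrow> bool" where
  "W12_loc D u G \<longleftrightarrow> weak_gradient D u G \<and> L2_loc D u \<and> L2_loc D G"

definition weak_solution :: "complex set \<Rightarrow> (real \<Rightarrow> real) \<Rightarrow> (complex \<Rightarrow> real) \<Rightarrow> bool" where
  "weak_solution D f U \<longleftrightarrow> continuous_on D U \<and>
     (\<exists>G. W12_loc D U G \<and>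
        (\<forall>\<eta> H. continuous_on D \<eta> \<and> W12 D \<eta> H \<and> compact_support_in D \<eta> \<longrightarrow>
           (LINT z:D|lebesgue. G z \<bullet> H z) + (LINT z:D|lebesgue. f (U z) * \<eta> z) = 0))"

end

theory Submission
  imports Defs "HOL-Complex_Analysis.Complex_Analysis" "HOL-Real_Asymp.Real_Asymp"
begin

text \<open>Write \<open>f t = \<bar>t\<bar> powr (q - 1) * t\<close>. A solution is sought in the form \<open>U = N (f \<circ> U) + Re H\<close>, where
  \<open>N\<close> is the logarithmic potential over \<open>D\<close> and \<open>H\<close> is holomorphic in \<open>D\<close>; the harmonic part is
  determined by the boundary values. As \<open>q < 1\<close>, the resulting map sends a large ball of bounded
  densities into itself, and it is compact, so a Schauder type argument (finitely many sample
  values, Kuhn's lemma, Arzela-Ascoli) gives a fixed point.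

  The Dirichlet problem is solved on the preimages of smaller discs under a Riemann map, where the
  boundary data are approximated by real parts of polynomials in that map. A \<open>C\<^sup>1\<close> domain has at each
  boundary point an exterior sector of opening arbitrarily close to \<open>\<pi>\<close>, of uniform size, so
  \<open>Re (((z - p) * cnj \<nu>) powr \<beta>)\<close> is a barrier comparable to \<open>\<bar>z - p\<bar> powr \<beta>\<close> for each \<open>\<beta> < 1\<close>. This gives
  both continuity and Hoelder continuity with the same exponent at the boundary.

  Potentials of bounded densities are \<open>C\<^sup>1\<^sup>,\<^sup>\<alpha>\<close> for all \<open>\<alpha> < 1\<close>. Replacing \<open>ln \<bar>v\<bar>\<^sup>2\<close> by \<open>ln (\<bar>v\<bar>\<^sup>2 + e\<^sup>2)\<close> turns \<open>U\<close>
  into smooth functions whose gradients and Laplacians converge, and their cut-off gradients are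
  admissible in the definition of the weak gradient of a Sobolev test function.\<close>

section \<open>Harmonic functions as real parts of holomorphic functions\<close>

text \<open>Working with real parts of holomorphic functions lets complex analysis carry the whole
  Dirichlet theory: exponentials turn real parts into moduli, to which the maximum modulus
  principle, Cauchy's inequality and Montel's theorem apply. Simple connectedness then returns from
  the exponential to its logarithm. Keeping the Hoelder exponent is what shapes the geometry. A
  barrier of degree \<open>\<beta>\<close> is positive only on sectors of opening below
  \<open>pi / \<beta>\<close>, so for \<open>\<beta>\<close> near 1 the domain has to lie, near each
  boundary point, in a sector barely larger than a half-plane. A reentrant corner forbids this; a
  \<open>C^1\<close> tangent provides it. Compactness is taken from the potential alone, which is
  Lipschitz with a constant linear in the bound of the density; the harmonic part follows by the
  maximum principle. Potentials of continuous densities may fail to have second derivatives. The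
  equation is therefore integrated by parts for the smoothed potentials, and only then is the
  smoothing parameter sent to 0.\<close>

lemma Re_holomorphic_max_principle:
  fixes u :: "complex \<Rightarrow> real"
  assumes "open \<Omega>" "bounded \<Omega>" and hol: "H holomorphic_on \<Omega>"
    and u: "\<And>z. z \<in> \<Omega> \<Longrightarrow> u z = Re (H z)" and cont: "continuous_on (closure \<Omega>) u"
    and le: "\<And>z. z \<in> frontier \<Omega> \<Longrightarrow> u z \<le> c" and z: "z \<in> closure \<Omega>"
  shows "u z \<le> c"
proof (rule ccontr)
  assume "\<not> u z \<le> c"
  have comp: "compact (closure \<Omega>)" using \<open>bounded \<Omega>\<close> by simp
  obtain \<xi> where \<xi>: "\<xi> \<in> closure \<Omega>" "\<And>y. y \<in> closure \<Omega> \<Longrightarrow> u y \<le> u \<xi>"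
    using continuous_attains_sup[OF comp _ cont] z by (metis empty_iff)
  have gt: "u \<xi> > c" using \<xi>(2)[OF z] \<open>\<not> u z \<le> c\<close> by simp
  then have "\<xi> \<in> \<Omega>"
    using le[of \<xi>] \<xi>(1) \<open>open \<Omega>\<close> by (force simp: frontier_def interior_open)
  \<comment> \<open>In later uses \<open>\<Omega>\<close> is an intersection such as
    \<open>D \<inter> ball p t\<close>, possibly disconnected, so the maximum is propagated only
    through the component of the maximum point.\<close>
  define C where "C = connected_component_set \<Omega> \<xi>"
  have C: "open C" "connected C" "C \<subseteq> \<Omega>" "\<xi> \<in> C"
    using \<open>open \<Omega>\<close> \<open>\<xi> \<in> \<Omega>\<close>
    by (auto simp: C_def open_connected_component connected_component_subset connected_component_refl)
  \<comment> \<open>The modulus of \<open>exp (H w)\<close> is \<open>exp (u w)\<close>, so a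
    maximum of the real part is a maximum of a modulus.\<close>
  have "(\<lambda>w. exp (H w)) constant_on C"
  proof (rule maximum_modulus_principle[where U = C and \<xi> = \<xi>])
    show "(\<lambda>w. exp (H w)) holomorphic_on C"
      by (intro holomorphic_on_exp' holomorphic_on_subset[OF hol] C)
    show "norm (exp (H w)) \<le> norm (exp (H \<xi>))" if "w \<in> C" for w
      using that C u \<xi>(2)[of w] closure_subset[of \<Omega>] by (simp add: subset_iff)
  qed (use C in auto)
  then have const: "u w = u \<xi>" if "w \<in> C" for w
    using that C u unfolding constant_on_def by (metis exp_inj_iff norm_exp_eq_Re subset_iff)
  have "bounded C" using C(3) \<open>bounded \<Omega>\<close> bounded_subset by blast
  then have "frontier C \<noteq> {}"
    using C(4) frontier_eq_empty[of C] not_bounded_UNIV by (metis empty_iff)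
  then obtain w where w: "w \<in> closure C" "w \<notin> C"
    using C(1) by (auto simp: frontier_def interior_open)
  have "closure C \<subseteq> closure \<Omega>" using C(3) by (rule closure_mono)
  then have "u w = u \<xi>"
    by (intro continuous_constant_on_closure[of C u "u \<xi>" w] continuous_on_subset[OF cont] const w) auto
  \<comment> \<open>A point of \<open>\<Omega>\<close> in the closure of a component belongs to that
    component, since its own component is an open neighbourhood. Hence \<open>w\<close> is a
    frontier point of \<open>\<Omega>\<close> with \<open>u w > c\<close>.\<close>
  moreover have "w \<notin> \<Omega>"
  proof
    assume "w \<in> \<Omega>"
    then have "open (connected_component_set \<Omega> w)" "w \<in> connected_component_set \<Omega> w"
      using \<open>open \<Omega>\<close> by (auto simp: open_connected_component connected_component_refl)
    then obtain y where "y \<in> C" "y \<in> connected_component_set \<Omega> w"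
      using w(1) by (meson closure_iff_nhds_not_empty disjoint_iff order_refl)
    then have "w \<in> C"
      unfolding C_def using connected_component_sym connected_component_trans by fastforce
    with w show False by simp
  qed
  ultimately show False
    using le[of w] gt w \<open>closure C \<subseteq> closure \<Omega>\<close> \<open>open \<Omega>\<close> by (auto simp: frontier_def interior_open)
qed

lemma Re_holomorphic_max_principle_abs:
  fixes u :: "complex \<Rightarrow> real"
  assumes "open \<Omega>" "bounded \<Omega>" and hol: "H holomorphic_on \<Omega>"
    and u: "\<And>z. z \<in> \<Omega> \<Longrightarrow> u z = Re (H z)" and cont: "continuous_on (closure \<Omega>) u"
    and le: "\<And>z. z \<in> frontier \<Omega> \<Longrightarrow> \<bar>u z\<bar> \<le> c" and z: "z \<in> closure \<Omega>"
  shows "\<bar>u z\<bar> \<le> c"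
proof -
  have "u z \<le> c"
    using le by (intro Re_holomorphic_max_principle[OF assms(1-3) u cont _ z]) fastforce+
  moreover have "- u z \<le> c"
  proof (rule Re_holomorphic_max_principle[OF assms(1,2), where H = "\<lambda>z. - H z" and u = "\<lambda>z. - u z"])
    show "(\<lambda>z. - H z) holomorphic_on \<Omega>" by (intro holomorphic_intros hol)
    show "continuous_on (closure \<Omega>) (\<lambda>z. - u z)" by (intro continuous_intros cont)
    show "- u z \<le> c" if "z \<in> frontier \<Omega>" for z using le[OF that] by linarith
  qed (use u z in auto)
  ultimately show ?thesis by simp
qed

text \<open>The exponential turns a bound on the real part into a bound on the modulus, to which Cauchy's
  inequality applies.\<close>

lemma deriv_bound_of_Re_bound:
  assumes hol: "H holomorphic_on ball z r" and "0 < r" "0 < m"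
    and bd: "\<And>w. w \<in> ball z r \<Longrightarrow> \<bar>Re (H w) - a\<bar> \<le> m"
  shows "norm (deriv H z) \<le> 18 * m / r"
proof -
  \<comment> \<open>Scaled so that the modulus stays between \<open>exp (-1)\<close> and
    \<open>exp 1\<close>. Cauchy's inequality at radius \<open>r / 2\<close> bounds
    \<open>deriv F z\<close> by \<open>2 * exp 1 / r\<close>, dividing by the modulus of
    \<open>F z\<close> costs another factor \<open>exp 1\<close>, and \<open>exp 1 \<le> 3\<close>
    turns the product into 18.\<close>
  define F where "F w = exp ((H w - of_real a) / of_real m)" for w
  have holF: "F holomorphic_on ball z r"
    unfolding F_def using \<open>0 < m\<close> by (intro holomorphic_intros hol) auto
  have nF: "norm (F w) = exp ((Re (H w) - a) / m)" for w
    by (simp add: F_def)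
  have up: "norm (F w) \<le> exp 1" if "w \<in> ball z r" for w
    unfolding nF using bd[OF that] \<open>0 < m\<close> by (simp add: field_simps)
  have lo: "exp (-1) \<le> norm (F z)"
    unfolding nF using bd[of z] \<open>0 < m\<close> \<open>0 < r\<close> by (simp add: field_simps)
  have "norm ((deriv ^^ 1) F z) \<le> fact 1 * exp 1 / (r/2) ^ 1"
  proof (rule Cauchy_inequality)
    show "F holomorphic_on ball z (r/2)"
      by (rule holomorphic_on_subset[OF holF]) (use \<open>0 < r\<close> in auto)
    show "continuous_on (cball z (r/2)) F"
      by (rule holomorphic_on_imp_continuous_on, rule holomorphic_on_subset[OF holF])
        (use \<open>0 < r\<close> in auto)
    show "norm (F x) \<le> exp 1" if "norm (z - x) = r / 2" for x
      using that \<open>0 < r\<close> by (intro up) (auto simp: dist_norm)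
  qed (use \<open>0 < r\<close> in auto)
  then have dF: "norm (deriv F z) \<le> 2 * exp 1 / r" by (simp add: mult.commute)
  have dH: "(H has_field_derivative deriv H z) (at z)"
    using hol \<open>0 < r\<close> by (meson centre_in_ball holomorphic_derivI open_ball)
  have "(F has_field_derivative F z * (deriv H z / of_real m)) (at z)"
    unfolding F_def using \<open>0 < m\<close> by (auto intro!: derivative_eq_intros dH)
  then have "deriv F z = F z * (deriv H z / of_real m)"
    by (rule DERIV_imp_deriv)
  then have "norm (deriv F z) = norm (F z) * (norm (deriv H z) / m)"
    using \<open>0 < m\<close> by (simp add: norm_mult norm_divide)
  then have "exp (-1) * (norm (deriv H z) / m) \<le> 2 * exp 1 / r"
    using dF lo \<open>0 < m\<close> by (smt (verit, best) divide_nonneg_pos mult_right_mono norm_ge_zero)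
  then have "norm (deriv H z) \<le> 2 * (exp 1 * exp 1) * m / r"
    using \<open>0 < m\<close> \<open>0 < r\<close> by (simp add: exp_minus field_simps)
  also have "\<dots> \<le> 2 * (3 * 3) * m / r"
    using mult_mono[OF exp_le exp_le] \<open>0 < m\<close> \<open>0 < r\<close>
    by (intro divide_right_mono mult_right_mono mult_left_mono) auto
  finally show ?thesis by simp
qed

section \<open>Approximation of continuous functions on circles by real parts of polynomials\<close>

text \<open>On the unit circle \<open>cnj z\<close> is \<open>1 / z\<close>, so a polynomial in the
  real and imaginary parts is a Laurent polynomial in \<open>z\<close>; the factor
  \<open>z ^ n\<close> clears its poles.\<close>

lemma real_polynomial_function_on_unit_circle:
  fixes p :: "complex \<Rightarrow> real"
  assumes "real_polynomial_function p"
  shows "\<exists>(Q :: complex poly) n. \<forall>z. norm z = 1 \<longrightarrow> of_real (p z) * z ^ n = poly Q z"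
  using assms
proof (induction p)
  case (linear f)
  then interpret bounded_linear f .
  \<comment> \<open>Obtained by multiplying \<open>Re z = (z + 1/z) / 2\<close> and
    \<open>Im z = (z - 1/z) / (2 * \<i>)\<close> by \<open>z\<close>.\<close>
  define Q where "Q = [:of_real (f 1) / 2 + \<i> * of_real (f \<i>) / 2, 0,
    of_real (f 1) / 2 - \<i> * of_real (f \<i>) / 2 :: complex:]"
  have "of_real (f z) * z ^ 1 = poly Q z" if "norm z = 1" for z
  proof -
    have "z = Re z *\<^sub>R 1 + Im z *\<^sub>R \<i>" by (simp add: complex_eq_iff)
    then have "f z = Re z * f 1 + Im z * f \<i>"
      using add scaleR by (metis real_scaleR_def)
    then have "of_real (f z) = (z + cnj z) / 2 * of_real (f 1) - \<i> * (z - cnj z) / 2 * of_real (f \<i>)"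
      by (simp add: complex_eq_iff)
    moreover have "cnj z * z = 1"
      using that by (metis complex_norm_square mult.commute of_real_1 power_one)
    ultimately show ?thesis
      unfolding Q_def by (simp add: field_simps) algebra
  qed
  then show ?case by blast
next
  case (const c)
  have "of_real c * z ^ 0 = poly [:of_real c:] z" for z :: complex by simp
  then show ?case by blast
next
  case (add f g)
  then obtain P Q :: "complex poly" and m n
    where P: "\<And>z. norm z = 1 \<Longrightarrow> of_real (f z) * z ^ m = poly P z"
      and Q: "\<And>z. norm z = 1 \<Longrightarrow> of_real (g z) * z ^ n = poly Q z" by blast
  have "of_real (f z + g z) * z ^ (m + n) = poly (P * monom 1 n + Q * monom 1 m) z"
    if "norm z = 1" for z
    using that by (simp add: poly_monom power_add algebra_simps flip: P Q)
  then show ?case by blast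
next
  case (mult f g)
  then obtain P Q :: "complex poly" and m n
    where P: "\<And>z. norm z = 1 \<Longrightarrow> of_real (f z) * z ^ m = poly P z"
      and Q: "\<And>z. norm z = 1 \<Longrightarrow> of_real (g z) * z ^ n = poly Q z" by blast
  have "of_real (f z * g z) * z ^ (m + n) = poly (P * Q) z" if "norm z = 1" for z
    using that by (simp add: power_add algebra_simps flip: P Q)
  then show ?case by blast
qed

text \<open>On the circle \<open>a / z ^ n = a * cnj (z ^ n)\<close> has the same real part as
  \<open>cnj a * z ^ n\<close>. Each induction step folds one negative power into a positive one in
  this way.\<close>

lemma Re_laurent_on_unit_circle:
  fixes Q :: "complex poly"
  shows "\<exists>R :: complex poly. \<forall>z. norm z = 1 \<longrightarrow> Re (poly Q z / z ^ n) = Re (poly R z)"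
proof (induction n arbitrary: Q)
  case 0
  show ?case by (rule exI[of _ Q]) simp
next
  case (Suc n)
  obtain a Q1 where Q: "Q = pCons a Q1" by (cases Q)
  obtain R1 where R1: "\<And>z. norm z = 1 \<Longrightarrow> Re (poly Q1 z / z ^ n) = Re (poly R1 z)"
    using Suc by blast
  have "Re (poly Q z / z ^ Suc n) = Re (poly (R1 + monom (cnj a) (Suc n)) z)" if z: "norm z = 1" for z
  proof -
    have nz: "z \<noteq> 0" using z by auto
    have "z ^ Suc n * cnj (z ^ Suc n) = 1"
      using z by (simp add: complex_norm_square[symmetric] norm_power del: power_Suc complex_cnj_power)
    then have "a / z ^ Suc n = a * cnj (z ^ Suc n)"
      using nz by (metis divide_eq_eq mult.assoc mult.commute mult.right_neutral power_not_zero)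
    moreover have "Re (a * cnj w) = Re (cnj a * w)" for w by simp
    ultimately have "Re (a / z ^ Suc n) = Re (cnj a * z ^ Suc n)" by metis
    moreover have "poly Q z / z ^ Suc n = a / z ^ Suc n + poly Q1 z / z ^ n"
      using nz by (simp add: Q field_simps)
    ultimately show ?thesis using R1[OF z] by (simp add: poly_monom del: power_Suc)
  qed
  then show ?case by blast
qed

text \<open>Does the work of the Poisson integral: real parts of polynomials are harmonic in the
  whole disc, and Stone-Weierstrass together with the two preceding lemmas makes them dense on the
  circle.\<close>

lemma continuous_on_circle_approx_Re_poly:
  fixes f :: "complex \<Rightarrow> real"
  assumes cont: "continuous_on (sphere 0 r) f" and "0 < r" "0 < e"
  obtains R :: "complex poly" where "\<And>z. z \<in> sphere 0 r \<Longrightarrow> \<bar>f z - Re (poly R (z / of_real r))\<bar> < e"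
proof -
  have "continuous_on (sphere 0 1) (\<lambda>z. f (of_real r * z))"
    using \<open>0 < r\<close>
    by (intro continuous_on_compose2[OF cont]) (auto intro!: continuous_intros simp: norm_mult)
  then obtain g where g: "real_polynomial_function g"
      "\<And>z. z \<in> sphere 0 1 \<Longrightarrow> \<bar>f (of_real r * z) - g z\<bar> < e"
    using Stone_Weierstrass_real_polynomial_function[OF compact_sphere _ \<open>0 < e\<close>] by blast
  obtain Q :: "complex poly" and n where Q: "\<And>z. norm z = 1 \<Longrightarrow> of_real (g z) * z ^ n = poly Q z"
    using real_polynomial_function_on_unit_circle[OF g(1)] by blast
  obtain R where R: "\<And>z. norm z = 1 \<Longrightarrow> Re (poly Q z / z ^ n) = Re (poly R z)"
    using Re_laurent_on_unit_circle[of Q n] by blast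
  have eq: "g z = Re (poly R z)" if "norm z = 1" for z
  proof -
    have "poly Q z / z ^ n = of_real (g z)"
      using Q[OF that] that by (metis nonzero_mult_div_cancel_right norm_zero power_not_zero zero_neq_one)
    then show ?thesis using R[OF that] by simp
  qed
  show thesis
  proof
    fix z :: complex assume "z \<in> sphere 0 r"
    then have "norm (z / of_real r) = 1" using \<open>0 < r\<close> by (simp add: norm_divide)
    then show "\<bar>f z - Re (poly R (z / of_real r))\<bar> < e"
      using g(2)[of "z / of_real r"] eq[of "z / of_real r"] \<open>0 < r\<close> by simp
  qed
qed

text \<open>The harmonic function \<open>Re (w powr \<beta>)\<close> is comparable to \<open>\<bar>w\<bar> powr \<beta>\<close> on every sector of
  opening less than \<open>\<pi> / \<beta>\<close>; for \<open>\<beta> < 1\<close> such a sector may be larger than a half-plane.\<close>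

lemma Re_powr_sector_lower_bound:
  assumes "0 < \<beta>" "\<beta> < 1"
  obtains s \<kappa> where "0 < s" "s < 1" "0 < \<kappa>"
    "\<And>w. - s * norm w \<le> Re w \<Longrightarrow> \<kappa> * norm w powr \<beta> \<le> Re (w powr of_real \<beta>)"
proof -
  \<comment> \<open>The sector has half-angle \<open>A = pi / 2 + \<epsilon>\<close>. With
    \<open>2 * \<epsilon> = pi / 2 * (1 - \<beta>)\<close> and
    \<open>\<beta> * \<epsilon> < 2 * \<epsilon>\<close> one gets
    \<open>\<beta> * A < pi / 2\<close>, so \<open>\<kappa> = cos (\<beta> * A)\<close> is positive,
    and \<open>cos A = - sin \<epsilon>\<close> explains the choice
    \<open>s = sin \<epsilon>\<close>.\<close>
  define \<epsilon> where "\<epsilon> = pi / 4 * (1 - \<beta>)"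
  define A where "A = pi / 2 + \<epsilon>"
  have \<epsilon>: "0 < \<epsilon>" "\<epsilon> < pi / 2"
    using assms pi_gt_zero mult_strict_left_mono[of "1 - \<beta>" 2 pi] by (auto simp: \<epsilon>_def field_simps)
  have "\<beta> * \<epsilon> < 2 * \<epsilon>" using assms \<epsilon> by simp
  then have A: "0 < A" "A < pi" "\<beta> * A < pi / 2"
  proof -
    show "0 < A" "A < pi" using \<epsilon> by (auto simp: A_def)
    have "\<beta> * A = \<beta> * (pi / 2) + \<beta> * \<epsilon>" by (simp add: A_def distrib_left)
    also have "\<dots> < \<beta> * (pi / 2) + 2 * \<epsilon>" using \<open>\<beta> * \<epsilon> < 2 * \<epsilon>\<close> by simp
    also have "\<dots> = pi / 2" by (simp add: \<epsilon>_def field_simps)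
    finally show "\<beta> * A < pi / 2" .
  qed
  show thesis
  proof
    show "0 < sin \<epsilon>" "sin \<epsilon> < 1"
      using \<epsilon> by (auto intro: sin_gt_zero2) (metis \<epsilon>(2) less_eq_real_def minus_pi_half_less_zero order.strict_trans sin_monotone_2pi sin_pi_half)
    show "0 < cos (\<beta> * A)"
      using A assms by (intro cos_gt_zero) auto
    fix w :: complex assume w: "- sin \<epsilon> * norm w \<le> Re w"
    show "cos (\<beta> * A) * norm w powr \<beta> \<le> Re (w powr of_real \<beta>)"
    proof (cases "w = 0")
      case False
      have "Re w = norm w * cos (Arg w)"
        by (simp add: cos_Arg False)
      moreover have "cos A = - sin \<epsilon>" by (simp add: A_def cos_add)
      ultimately have "norm w * cos A \<le> norm w * cos (Arg w)"
        using w by (simp add: mult.commute)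
      then have "cos A \<le> cos \<bar>Arg w\<bar>"
        using False by simp
      then have "\<bar>Arg w\<bar> \<le> A"
        using A mpi_less_Arg[of w] Arg_le_pi[of w] cos_mono_le_eq[of A "\<bar>Arg w\<bar>"] by auto
      then have "cos (\<beta> * A) \<le> cos (\<beta> * \<bar>Arg w\<bar>)"
        using A assms by (intro cos_monotone_0_pi_le) (auto intro: mult_left_mono)
      also have "\<dots> = cos (\<beta> * Arg w)"
        by (metis abs_mult abs_of_pos assms(1) cos_abs_real)
      finally have "cos (\<beta> * A) * norm w powr \<beta> \<le> norm w powr \<beta> * cos (\<beta> * Arg w)"
        by (subst mult.commute) (intro mult_left_mono, auto)
      also have "\<dots> = Re (w powr of_real \<beta>)"
        using False by (simp add: powr_def Re_exp Arg_eq_Im_Ln[symmetric])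
      finally show ?thesis .
    qed simp
  qed
qed

text \<open>As \<open>s < 1\<close>, the sector meets the branch cut of \<open>powr\<close> only at
  the vertex, where \<open>norm w powr \<beta>\<close> squeezes the function to 0.\<close>

lemma continuous_on_Re_powr_sector:
  assumes "0 < \<beta>" "s < 1"
  shows "continuous_on {w. - s * norm w \<le> Re w} (\<lambda>w. Re (w powr of_real \<beta>))"
proof (clarsimp simp: continuous_on_eq_continuous_within)
  fix w assume w: "- (s * norm w) \<le> Re w"
  show "continuous (at w within {w. - (s * norm w) \<le> Re w}) (\<lambda>w. Re (w powr of_real \<beta>))"
  proof (cases "w = 0")
    case True
    have "((\<lambda>w. norm w powr \<beta>) \<longlongrightarrow> 0) (at (0 :: complex))"
      using assms by (auto intro!: tendsto_eq_intros)
    then have "((\<lambda>w. Re (w powr of_real \<beta>)) \<longlongrightarrow> 0) (at 0)"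
    proof (rule Lim_null_comparison[rotated], intro always_eventually allI)
      show "norm (Re (w powr of_real \<beta>)) \<le> norm w powr \<beta>" for w
        using abs_Re_le_cmod[of "w powr of_real \<beta>"] by (simp add: norm_powr_real_powr')
    qed
    then show ?thesis
      unfolding True continuous_within by (auto intro: tendsto_within_subset)
  next
    case False
    have "w \<notin> \<real>\<^sub>\<le>\<^sub>0"
    proof
      assume "w \<in> \<real>\<^sub>\<le>\<^sub>0"
      then have "Re w \<le> 0" "Im w = 0" by (auto simp: complex_nonpos_Reals_iff)
      then have "norm w = - Re w" by (simp add: cmod_def)
      then have "(1 - s) * norm w \<le> 0" using w by (simp add: algebra_simps)
      then show False using assms False by (simp add: mult_le_0_iff)
    qed
    then show ?thesis
      by (rule continuous_Re[OF continuous_at_imp_continuous_within[OF DERIV_isCont[OF has_field_derivative_powr]]])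
  qed
qed

section \<open>Barrier estimates at a boundary point\<close>

text \<open>Subtracting \<open>C / \<kappa>\<close> times the barrier absorbs the growth allowed on
  the frontier, because the barrier is at least \<open>\<kappa> * norm (z - p) powr \<beta>\<close>
  there. The maximum principle applies to the difference, and the barrier is at most
  \<open>norm (z - p) powr \<beta>\<close> everywhere.\<close>

lemma boundary_growth_upper:
  assumes "open \<Omega>" "bounded \<Omega>" and hol: "H holomorphic_on \<Omega>"
    and u: "\<And>z. z \<in> \<Omega> \<Longrightarrow> u z = Re (H z)" and cont: "continuous_on (closure \<Omega>) u"
    and "p \<notin> \<Omega>" "0 < \<beta>" "s < 1" "0 < \<kappa>" "0 \<le> C" and \<nu>: "norm \<nu> = 1"
    and \<kappa>: "\<And>w. - s * norm w \<le> Re w \<Longrightarrow> \<kappa> * norm w powr \<beta> \<le> Re (w powr of_real \<beta>)"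
    and cone: "\<And>z. z \<in> closure \<Omega> \<Longrightarrow> - s * norm (z - p) \<le> Re ((z - p) * cnj \<nu>)"
    and le: "\<And>z. z \<in> frontier \<Omega> \<Longrightarrow> u z \<le> c + C * norm (z - p) powr \<beta>"
    and z: "z \<in> closure \<Omega>"
  shows "u z \<le> c + C / \<kappa> * norm (z - p) powr \<beta>"
proof -
  define w where "w z = (z - p) * cnj \<nu>" for z
  have nw: "norm (w z) = norm (z - p)" for z using \<nu> by (simp add: w_def norm_mult)
  define b where "b z = Re (w z powr of_real \<beta>)" for z
  have wcone: "w z \<in> {w. - s * norm w \<le> Re w}" if "z \<in> closure \<Omega>" for z
    using cone[OF that] nw[of z] by (simp add: w_def)
  have "u z - C / \<kappa> * b z \<le> c"
  proof (rule Re_holomorphic_max_principle[OF assms(1,2), where u = "\<lambda>z. u z - C / \<kappa> * b z"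
        and H = "\<lambda>z. H z - of_real (C / \<kappa>) * w z powr of_real \<beta>"])
    have "w z \<notin> \<real>\<^sub>\<le>\<^sub>0" if "z \<in> \<Omega>" for z
    proof
      assume "w z \<in> \<real>\<^sub>\<le>\<^sub>0"
      then have "Re (w z) \<le> 0" "Im (w z) = 0" by (auto simp: complex_nonpos_Reals_iff)
      then have "norm (w z) = - Re (w z)" by (simp add: cmod_def)
      moreover have "norm (w z) \<noteq> 0" using that \<open>p \<notin> \<Omega>\<close> by (auto simp: nw)
      ultimately have "(1 - s) * norm (w z) \<le> 0"
        using wcone[of z] that closure_subset[of \<Omega>] by (auto simp: algebra_simps)
      then show False using \<open>s < 1\<close> \<open>norm (w z) \<noteq> 0\<close> by (simp add: mult_le_0_iff)
    qed
    then show "(\<lambda>z. H z - of_real (C / \<kappa>) * w z powr of_real \<beta>) holomorphic_on \<Omega>"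
      unfolding w_def by (intro holomorphic_intros hol) auto
    show "continuous_on (closure \<Omega>) (\<lambda>z. u z - C / \<kappa> * b z)"
      unfolding b_def
      by (intro continuous_intros cont continuous_on_compose2[OF continuous_on_Re_powr_sector[OF \<open>0 < \<beta>\<close> \<open>s < 1\<close>]])
        (auto simp: w_def intro!: continuous_intros dest!: wcone)
    show "u z - C / \<kappa> * b z \<le> c" if "z \<in> frontier \<Omega>" for z
    proof -
      have "\<kappa> * norm (z - p) powr \<beta> \<le> b z"
        using \<kappa>[of "w z"] wcone[of z] that by (simp add: b_def nw frontier_def)
      then have "C / \<kappa> * (\<kappa> * norm (z - p) powr \<beta>) \<le> C / \<kappa> * b z"
        using \<open>0 \<le> C\<close> \<open>0 < \<kappa>\<close> by (intro mult_left_mono) auto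
      then show ?thesis using le[OF that] \<open>0 < \<kappa>\<close> by simp
    qed
  qed (use u z in \<open>auto simp: b_def\<close>)
  moreover have "b z \<le> norm (z - p) powr \<beta>"
    using complex_Re_le_cmod[of "w z powr of_real \<beta>"] by (simp add: b_def norm_powr_real_powr' nw)
  then have "C / \<kappa> * b z \<le> C / \<kappa> * norm (z - p) powr \<beta>"
    using \<open>0 \<le> C\<close> \<open>0 < \<kappa>\<close> by (intro mult_left_mono) auto
  ultimately show ?thesis by linarith
qed

lemma boundary_growth:
  assumes "open \<Omega>" "bounded \<Omega>" and hol: "H holomorphic_on \<Omega>"
    and u: "\<And>z. z \<in> \<Omega> \<Longrightarrow> u z = Re (H z)" and cont: "continuous_on (closure \<Omega>) u"
    and *: "p \<notin> \<Omega>" "0 < \<beta>" "s < 1" "0 < \<kappa>" "0 \<le> C" "norm \<nu> = 1"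
      "\<And>w. - s * norm w \<le> Re w \<Longrightarrow> \<kappa> * norm w powr \<beta> \<le> Re (w powr of_real \<beta>)"
      "\<And>z. z \<in> closure \<Omega> \<Longrightarrow> - s * norm (z - p) \<le> Re ((z - p) * cnj \<nu>)"
    and le: "\<And>z. z \<in> frontier \<Omega> \<Longrightarrow> \<bar>u z - a\<bar> \<le> c + C * norm (z - p) powr \<beta>"
    and z: "z \<in> closure \<Omega>"
  shows "\<bar>u z - a\<bar> \<le> c + C / \<kappa> * norm (z - p) powr \<beta>"
proof -
  have "u z - a \<le> c + C / \<kappa> * norm (z - p) powr \<beta>"
  proof (rule boundary_growth_upper[OF assms(1,2) _ _ _ *, where u = "\<lambda>z. u z - a"
        and H = "\<lambda>z. H z - of_real a"])
    show "u z - a \<le> c + C * norm (z - p) powr \<beta>" if "z \<in> frontier \<Omega>" for z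
      using le[OF that] by linarith
  qed (use u z in \<open>auto intro!: holomorphic_intros hol continuous_intros cont\<close>)
  moreover have "a - u z \<le> c + C / \<kappa> * norm (z - p) powr \<beta>"
  proof (rule boundary_growth_upper[OF assms(1,2) _ _ _ *, where u = "\<lambda>z. a - u z"
        and H = "\<lambda>z. of_real a - H z"])
    show "a - u z \<le> c + C * norm (z - p) powr \<beta>" if "z \<in> frontier \<Omega>" for z
      using le[OF that] by linarith
  qed (use u z in \<open>auto intro!: holomorphic_intros hol continuous_intros cont\<close>)
  ultimately show ?thesis by linarith
qed

section \<open>The Dirichlet problem\<close>

text \<open>The excluded directions are those around \<open>- \<nu>\<close>; they fill a sector of
  opening \<open>2 * arccos s\<close>, close to \<open>pi\<close> for small \<open>s\<close>. The
  radius \<open>r\<close> is common to all boundary points.\<close>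

definition exterior_sector :: "real \<Rightarrow> real \<Rightarrow> complex set \<Rightarrow> bool" where
  "exterior_sector s r D \<longleftrightarrow> (\<forall>p\<in>frontier D. \<exists>\<nu>. norm \<nu> = 1 \<and>
     (\<forall>z\<in>closure D \<inter> ball p r. - s * norm (z - p) \<le> Re ((z - p) * cnj \<nu>)))"

text \<open>Boundary values are attained approximately on the preimages of the discs of radius \<open>\<rho> < 1\<close>
  under a Riemann map; the harmonic functions obtained there converge as \<open>\<rho> \<rightarrow> 1\<close>, and the
  exterior sectors control the limit at the boundary.\<close>

lemma dirichlet_solution:
  fixes \<Psi> :: "complex \<Rightarrow> real"
  assumes D: "open D" "simply_connected D" "bounded D" "D \<noteq> {}"
    and sector: "\<And>s. 0 < s \<Longrightarrow> s < 1 \<Longrightarrow> \<exists>r>0. exterior_sector s r D"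
    and \<Psi>: "continuous_on (closure D) \<Psi>"
  obtains H where "H holomorphic_on D" "continuous_on (closure D) (\<lambda>z. if z \<in> D then Re (H z) else \<Psi> z)"
proof -
  have "compact (closure D)" using D by simp
  then obtain M where M: "\<And>z. z \<in> closure D \<Longrightarrow> \<bar>\<Psi> z\<bar> \<le> M"
    using compact_imp_bounded[OF compact_continuous_image[OF \<Psi>]] by (force simp: bounded_iff)
  then have "0 \<le> M" using D closure_subset by (metis abs_ge_zero all_not_in_conv order_trans subsetD)
  have "D \<noteq> UNIV" using D not_bounded_UNIV by metis
  then obtain g k where g: "g holomorphic_on D" and k: "k holomorphic_on ball 0 1"
    and gk: "\<And>z. z \<in> D \<Longrightarrow> g z \<in> ball 0 1 \<and> k (g z) = z"
    and kg: "\<And>z. z \<in> ball 0 1 \<Longrightarrow> k z \<in> D \<and> g (k z) = z"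
    using Riemann_mapping_theorem[of D] D by metis
  have contg: "continuous_on D g" and contk: "continuous_on (ball 0 1) k"
    using g k by (auto intro: holomorphic_on_imp_continuous_on)
  define r where "r n = 1 - 1 / (real n + 2)" for n
  have r: "0 < r n" "r n < 1" for n by (auto simp: r_def)
  define E where "E n = {z \<in> D. norm (g z) < r n}" for n
  \<comment> \<open>As images of closed discs under the inverse map these sets are compact in
    \<open>D\<close>. So each \<open>closure (E n)\<close> stays inside \<open>D\<close>, and
    functions of the Riemann map are holomorphic across the frontier of \<open>E n\<close>.\<close>
  define K where "K n = k ` cball 0 (r n)" for n
  have K_eq: "K n = {z \<in> D. norm (g z) \<le> r n}" for n
  proof -
    have "z \<in> ball 0 1" if "z \<in> cball 0 (r n)" for z :: complex using that r[of n] by auto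
    then show ?thesis unfolding K_def using gk kg by (force simp: image_iff)
  qed
  have "compact (K n)" for n
    unfolding K_def using r[of n]
    by (intro compact_continuous_image continuous_on_subset[OF contk]) auto
  then have clE: "closure (E n) \<subseteq> K n" for n
    by (intro closure_minimal compact_imp_closed) (auto simp: E_def K_eq)
  have KD: "K n \<subseteq> D" for n by (auto simp: K_eq)
  have openE: "open (E n)" for n
  proof -
    have "E n = D \<inter> g -` ball 0 (r n)" by (auto simp: E_def)
    then show ?thesis using continuous_open_preimage[OF contg D(1) open_ball] by simp
  qed
  have ED: "E n \<subseteq> D" for n by (auto simp: E_def)
  have frE: "z \<in> D \<and> norm (g z) = r n" if "z \<in> frontier (E n)" for z n
    using that clE[of n] openE[of n] by (force simp: frontier_def interior_open K_eq E_def)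
  have bdE: "bounded (E n)" for n using D(3) ED bounded_subset by blast
  have exhaust: "\<exists>N. \<forall>n\<ge>N. L \<subseteq> E n" if L: "compact L" "L \<subseteq> D" for L
  proof (cases "L = {}")
    case False
    have "continuous_on L (\<lambda>z. norm (g z))"
      by (intro continuous_intros continuous_on_subset[OF contg L(2)])
    then obtain z where z: "z \<in> L" "\<And>y. y \<in> L \<Longrightarrow> norm (g y) \<le> norm (g z)"
      using continuous_attains_sup[OF L(1) False] by blast
    have "norm (g z) < 1" using gk[of z] z(1) L(2) by auto
    moreover have "r \<longlonglongrightarrow> 1" unfolding r_def by real_asymp
    ultimately have "\<forall>\<^sub>F n in sequentially. norm (g z) < r n" by (rule order_tendstoD(1)[rotated])
    then obtain N where "\<And>n. n \<ge> N \<Longrightarrow> norm (g z) < r n" by (auto simp: eventually_sequentially)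
    then have "L \<subseteq> E n" if "n \<ge> N" for n using that z(2) L(2) by (force simp: E_def)
    then show ?thesis by blast
  qed auto
  have "\<exists>R :: complex poly. \<forall>z \<in> sphere 0 (r n). \<bar>\<Psi> (k z) - Re (poly R (z / of_real (r n)))\<bar> < 1 / (real n + 1)" for n
  proof -
    have "continuous_on (sphere 0 (r n)) (\<lambda>z. \<Psi> (k z))"
    proof (intro continuous_on_compose2[OF \<Psi>] continuous_on_subset[OF contk])
      show "k ` sphere 0 (r n) \<subseteq> closure D"
        using kg r[of n] closure_subset[of D] by force
    qed (use r[of n] in auto)
    from continuous_on_circle_approx_Re_poly[OF this r(1), of "1 / (real n + 1)"] show ?thesis
      by (metis divide_pos_pos of_nat_0_le_iff add_nonneg_pos zero_less_one)
  qed
  then obtain R :: "nat \<Rightarrow> complex poly" where R: "\<And>n z. z \<in> sphere 0 (r n) \<Longrightarrow>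
      \<bar>\<Psi> (k z) - Re (poly (R n) (z / of_real (r n)))\<bar> < 1 / (real n + 1)"
    by metis
  define h where "h n z = poly (R n) (g z / of_real (r n))" for n z
  have hol: "h n holomorphic_on D" for n
    unfolding h_def using r[of n] by (intro holomorphic_intros g) auto
  have appr: "\<bar>Re (h n z) - \<Psi> z\<bar> < 1 / (real n + 1)" if "z \<in> frontier (E n)" for n z
    using R[of "g z" n] frE[OF that] gk[of z] by (auto simp: h_def abs_minus_commute)
  have conth: "continuous_on (closure (E n)) (\<lambda>z. Re (h n z))" for n
    using clE[of n] KD[of n]
    by (intro continuous_intros continuous_on_subset[OF holomorphic_on_imp_continuous_on[OF hol]]) auto
  have bdh: "\<bar>Re (h n z)\<bar> \<le> M + 1" if "z \<in> closure (E n)" for n z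
  proof (rule Re_holomorphic_max_principle_abs[OF openE bdE holomorphic_on_subset[OF hol ED] refl conth _ that])
    fix z assume z: "z \<in> frontier (E n)"
    have "1 / (real n + 1) \<le> 1" by simp
    moreover have "\<bar>\<Psi> z\<bar> \<le> M" using frE[OF z] closure_subset[of D] by (intro M) auto
    ultimately show "\<bar>Re (h n z)\<bar> \<le> M + 1" using appr[OF z] by linarith
  qed
  \<comment> \<open>Only the real parts of \<open>h n\<close> are under control, hence Montel's
    theorem is applied to the exponentials.\<close>
  obtain G \<rho> where G: "G holomorphic_on D" and \<rho>: "strict_mono (\<rho> :: nat \<Rightarrow> nat)"
    and lim: "\<And>z. z \<in> D \<Longrightarrow> (\<lambda>n. exp (h (\<rho> n) z)) \<longlonglongrightarrow> G z"
  proof (rule Montel[OF D(1), of "range (\<lambda>n z. exp (h n z))" "\<lambda>n z. exp (h n z)"])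
    show "f holomorphic_on D" if "f \<in> range (\<lambda>n z. exp (h n z))" for f
      using that by (auto intro!: holomorphic_intros hol)
    show "\<exists>B. \<forall>f\<in>range (\<lambda>n z. exp (h n z)). \<forall>z\<in>L. norm (f z) \<le> B" if L: "compact L" "L \<subseteq> D" for L
    proof -
      obtain N where N: "\<And>n. n \<ge> N \<Longrightarrow> L \<subseteq> E n" using exhaust[OF L] by blast
      have "\<exists>b. \<forall>z\<in>L. norm (exp (h n z)) \<le> b" for n
      proof -
        have "continuous_on L (\<lambda>z. exp (h n z))"
          by (intro continuous_intros continuous_on_subset[OF holomorphic_on_imp_continuous_on[OF hol] L(2)])
        from compact_imp_bounded[OF compact_continuous_image[OF this L(1)]] show ?thesis
          by (force simp: bounded_iff)
      qed
      then obtain b where b: "\<And>n z. z \<in> L \<Longrightarrow> norm (exp (h n z)) \<le> b n" by metis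
      \<comment> \<open>The bound \<open>M + 1\<close> holds on \<open>L\<close> once
        \<open>L \<subseteq> E n\<close>; the finitely many earlier functions are bounded on
        \<open>L\<close> one by one, and their bounds are summed.\<close>
      have "norm (exp (h n z)) \<le> exp (M + 1) + (\<Sum>m<N. \<bar>b m\<bar>)" if "z \<in> L" for n z
      proof (cases "n < N")
        case True
        then have "\<bar>b n\<bar> \<le> (\<Sum>m<N. \<bar>b m\<bar>)" by (intro member_le_sum) auto
        then show ?thesis using b[OF that, of n] exp_gt_zero[of "M + 1"] by linarith
      next
        case False
        then have "Re (h n z) \<le> M + 1" using N[of n] that bdh[of z n] closure_subset[of "E n"] by force
        moreover have "0 \<le> (\<Sum>m<N. \<bar>b m\<bar>)" by (simp add: sum_nonneg)
        ultimately show ?thesis by (simp add: add_increasing2)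
      qed
      then show ?thesis by blast
    qed
  qed auto
  have ev: "\<forall>\<^sub>F n in sequentially. z \<in> E (\<rho> n)" if "z \<in> D" for z
  proof -
    obtain N where "\<And>n. n \<ge> N \<Longrightarrow> {z} \<subseteq> E n" using exhaust[of "{z}"] \<open>z \<in> D\<close> by auto
    moreover have "n \<le> \<rho> n" for n using \<rho> by (rule seq_suble)
    ultimately show ?thesis
      unfolding eventually_sequentially by (meson insert_subset order_trans)
  qed
  \<comment> \<open>The two-sided bound on the real parts keeps the exponentials away from 0, so the
    limit has a holomorphic logarithm on the simply connected \<open>D\<close>.\<close>
  have Gnz: "G z \<noteq> 0" if "z \<in> D" for z
  proof -
    have "\<forall>\<^sub>F n in sequentially. exp (- (M + 1)) \<le> norm (exp (h (\<rho> n) z))"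
      using ev[OF that]
    proof eventually_elim
      case (elim n)
      then show ?case using bdh[of z "\<rho> n"] closure_subset[of "E (\<rho> n)"] by (auto simp: abs_le_iff)
    qed
    then have "exp (- (M + 1)) \<le> norm (G z)"
      by (rule tendsto_lowerbound[OF tendsto_norm[OF lim[OF that]]]) simp
    then show ?thesis using exp_gt_zero[of "- (M + 1)"] by auto
  qed
  obtain H where H: "H holomorphic_on D" "\<And>z. z \<in> D \<Longrightarrow> G z = exp (H z)"
    using simply_connected_eq_holomorphic_log[OF D(1)] D(2) G Gnz by metis
  have limH: "(\<lambda>n. Re (h (\<rho> n) z)) \<longlonglongrightarrow> Re (H z)" if "z \<in> D" for z
  proof -
    have "(\<lambda>n. ln (norm (exp (h (\<rho> n) z)))) \<longlonglongrightarrow> ln (norm (G z))"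
      using Gnz[OF that] by (intro tendsto_intros lim that) auto
    then show ?thesis by (simp add: H(2)[OF that])
  qed
  \<comment> \<open>For continuity any exponent below 1 serves; the Hoelder estimate later repeats
    the argument with the exponent of the data.\<close>
  obtain s \<kappa> where s: "0 < s" "s < 1" and \<kappa>: "0 < \<kappa>"
    "\<And>w. - s * norm w \<le> Re w \<Longrightarrow> \<kappa> * norm w powr (1/2) \<le> Re (w powr of_real (1/2))"
    using Re_powr_sector_lower_bound[of "1/2"] by auto
  obtain \<delta> where \<delta>: "0 < \<delta>" "exterior_sector s \<delta> D" using sector[OF s] by blast
  define U where "U z = (if z \<in> D then Re (H z) else \<Psi> z)" for z
  have "continuous (at p within closure D) U" if p: "p \<in> closure D" for p
  proof (cases "p \<in> D")
    case True
    have "continuous_on D U"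
      unfolding U_def
      by (intro continuous_on_eq[OF continuous_on_Re[OF holomorphic_on_imp_continuous_on[OF H(1)]]]) auto
    then have "isCont U p" using True D(1) by (simp add: continuous_on_eq_continuous_at)
    then show ?thesis by (rule continuous_at_imp_continuous_within)
  next
    case False
    then have pf: "p \<in> frontier D" using p D(1) by (simp add: frontier_def interior_open)
    show ?thesis
      unfolding continuous_within tendsto_iff
    proof (intro allI impI)
      fix e :: real assume "0 < e"
      have "\<forall>\<^sub>F z in at p within closure D. dist (\<Psi> z) (\<Psi> p) < e / 2"
        using \<Psi> p \<open>0 < e\<close> by (intro tendstoD) (auto simp: continuous_on_def)
      then obtain d where d: "0 < d"
        "\<And>z. z \<in> closure D \<Longrightarrow> z \<noteq> p \<Longrightarrow> dist z p < d \<Longrightarrow> dist (\<Psi> z) (\<Psi> p) < e / 2"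
        by (auto simp: eventually_at)
      obtain \<nu> where \<nu>: "norm \<nu> = 1"
        "\<And>z. z \<in> closure D \<inter> ball p \<delta> \<Longrightarrow> - s * norm (z - p) \<le> Re ((z - p) * cnj \<nu>)"
        using \<delta>(2) pf by (auto simp: exterior_sector_def)
      define t where "t = min d \<delta> / 2"
      have t: "0 < t" "t < d" "t < \<delta>" using d(1) \<delta>(1) by (auto simp: t_def)
      \<comment> \<open>At distance \<open>t\<close> from \<open>p\<close> the barrier has to
        dominate \<open>2 * M + 1\<close>, the sum of the bound \<open>M + 1\<close> for
        \<open>Re (h n z)\<close> and the bound \<open>M\<close> for
        \<open>\<Psi> p\<close>.\<close>
      define C where "C = (2 * M + 1) / t powr (1/2)"
      have C: "0 \<le> C" "C * t powr (1/2) = 2 * M + 1" using t \<open>0 \<le> M\<close> by (auto simp: C_def)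
      \<comment> \<open>The constants do not depend on \<open>n\<close>: \<open>E n\<close> inherits
        the sector condition at \<open>p\<close> from \<open>D\<close>, and the barrier estimate
        asks only that \<open>p\<close> lie outside the open set, not on its frontier.\<close>
      have est: "\<bar>Re (h n z) - \<Psi> p\<bar> \<le> (e / 2 + 1 / (real n + 1)) + C / \<kappa> * norm (z - p) powr (1/2)"
        if z: "z \<in> E n" "dist z p < t" for n z
      proof -
        define \<Omega> where "\<Omega> = E n \<inter> ball p t"
        have cl\<Omega>: "closure \<Omega> \<subseteq> closure (E n) \<inter> cball p t"
          using closure_mono[of \<Omega> "E n"] closure_mono[of \<Omega> "ball p t"] t by (auto simp: \<Omega>_def)
        have clE': "closure (E n) \<subseteq> closure D" using clE[of n] KD[of n] closure_subset[of D] by blast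
        show ?thesis
        proof (rule boundary_growth[where \<Omega> = \<Omega> and s = s and \<nu> = \<nu> and H = "h n"])
          show "open \<Omega>" unfolding \<Omega>_def using openE by auto
          show "bounded \<Omega>" unfolding \<Omega>_def using bdE by auto
          show "h n holomorphic_on \<Omega>" by (rule holomorphic_on_subset[OF hol]) (use ED in \<open>auto simp: \<Omega>_def\<close>)
          show "continuous_on (closure \<Omega>) (\<lambda>z. Re (h n z))" by (rule continuous_on_subset[OF conth]) (use cl\<Omega> in auto)
          show "p \<notin> \<Omega>" using False ED by (auto simp: \<Omega>_def)
          show "- s * norm (z - p) \<le> Re ((z - p) * cnj \<nu>)" if "z \<in> closure \<Omega>" for z
            using that cl\<Omega> clE' t by (intro \<nu>) auto
          show "z \<in> closure \<Omega>" using z closure_subset[of \<Omega>] by (auto simp: \<Omega>_def dist_commute)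
          show "\<bar>Re (h n z) - \<Psi> p\<bar> \<le> e / 2 + 1 / (real n + 1) + C * norm (z - p) powr (1/2)"
            if zf: "z \<in> frontier \<Omega>" for z
          proof -
            have zcl: "z \<in> closure (E n)" "dist p z \<le> t" "z \<notin> \<Omega>"
              using zf cl\<Omega> \<open>open \<Omega>\<close> by (auto simp: frontier_def interior_open)
            have pos: "0 \<le> C * norm (z - p) powr (1/2)" "0 \<le> 1 / (real n + 1)" using C by auto
            show ?thesis
            proof (cases "z \<in> E n")
              case True
              then have "dist p z = t" using zcl by (auto simp: \<Omega>_def)
              then have "C * norm (z - p) powr (1/2) = 2 * M + 1" using C by (simp add: dist_norm norm_minus_commute)
              moreover have "\<bar>\<Psi> p\<bar> \<le> M" using M[OF p] .
              ultimately show ?thesis using bdh[OF zcl(1)] pos \<open>0 < e\<close> by linarith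
            next
              case False
              then have "z \<in> frontier (E n)" using zcl(1) openE[of n] by (simp add: frontier_def interior_open)
              then have "\<bar>Re (h n z) - \<Psi> z\<bar> < 1 / (real n + 1)" "z \<in> D" using appr frE by auto
              moreover from this have "dist (\<Psi> z) (\<Psi> p) < e / 2"
                using zcl t \<open>p \<notin> D\<close> clE' by (intro d) (auto simp: dist_commute)
              ultimately show ?thesis using pos unfolding dist_real_def by linarith
            qed
          qed
        qed (use s \<kappa> C \<nu> in auto)
      qed
      have estH: "\<bar>Re (H z) - \<Psi> p\<bar> \<le> e / 2 + C / \<kappa> * norm (z - p) powr (1/2)"
        if z: "z \<in> D" "dist z p < t" for z
      proof (rule tendsto_le[OF sequentially_bot])
        show "(\<lambda>n. \<bar>Re (h (\<rho> n) z) - \<Psi> p\<bar>) \<longlonglongrightarrow> \<bar>Re (H z) - \<Psi> p\<bar>"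
          by (intro tendsto_intros limH z)
        have "(\<lambda>n. 1 / (real n + 1)) \<longlonglongrightarrow> 0" by real_asymp
        from LIMSEQ_subseq_LIMSEQ[OF this \<rho>]
        have "(\<lambda>n. e / 2 + 1 / (real (\<rho> n) + 1) + C / \<kappa> * norm (z - p) powr (1/2))
            \<longlonglongrightarrow> e / 2 + 0 + C / \<kappa> * norm (z - p) powr (1/2)"
          by (intro tendsto_intros) (simp add: o_def)
        then show "(\<lambda>n. e / 2 + 1 / (real (\<rho> n) + 1) + C / \<kappa> * norm (z - p) powr (1/2))
            \<longlonglongrightarrow> e / 2 + C / \<kappa> * norm (z - p) powr (1/2)" by simp
        show "\<forall>\<^sub>F n in sequentially. \<bar>Re (h (\<rho> n) z) - \<Psi> p\<bar>
            \<le> e / 2 + 1 / (real (\<rho> n) + 1) + C / \<kappa> * norm (z - p) powr (1/2)"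
          using ev[OF z(1)] by eventually_elim (use est z in auto)
      qed
      have "((\<lambda>z. e / 2 + C / \<kappa> * norm (z - p) powr (1/2)) \<longlongrightarrow> e / 2 + C / \<kappa> * norm (p - p) powr (1/2)) (at p within closure D)"
        by (intro tendsto_intros tendsto_powr') auto
      then have "\<forall>\<^sub>F z in at p within closure D. e / 2 + C / \<kappa> * norm (z - p) powr (1/2) < e"
        by (rule order_tendstoD(2)) (use \<open>0 < e\<close> in simp)
      moreover have "\<forall>\<^sub>F z in at p within closure D. z \<in> closure D \<and> z \<noteq> p \<and> dist z p < t"
        using t(1) by (auto simp: eventually_at)
      ultimately show "\<forall>\<^sub>F z in at p within closure D. dist (U z) (U p) < e"
      proof eventually_elim
        case (elim z)
        have Up: "U p = \<Psi> p" using False by (simp add: U_def)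
        show ?case
        proof (cases "z \<in> D")
          case True
          then show ?thesis using estH[of z] elim unfolding Up by (auto simp: U_def dist_real_def)
        next
          case z: False
          have "dist (\<Psi> z) (\<Psi> p) < e / 2" using elim t by (intro d) auto
          then show ?thesis unfolding Up using z \<open>0 < e\<close> by (auto simp: U_def)
        qed
      qed
    qed
  qed
  then have "continuous_on (closure D) U" by (simp add: continuous_on_eq_continuous_within)
  then show thesis using that H(1) unfolding U_def by blast
qed

section \<open>Exterior sectors of a smooth Jordan domain\<close>

text \<open>Rotating to \<open>cis (s - t)\<close> reduces the claim to continuity of
  \<open>Arg\<close> at 1; the integer \<open>k\<close> is the ambiguity of the argument.\<close>

lemma cis_close_imp_arg_close:
  assumes "0 < \<delta>"
  shows "\<exists>\<eta>>0. \<forall>s t. norm (cis s - cis t) < \<eta> \<longrightarrow> (\<exists>k::int. \<bar>s - t - 2 * pi * of_int k\<bar> < \<delta>)"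
proof -
  have "(Arg \<longlongrightarrow> Arg 1) (at 1)"
    using continuous_at_Arg[of 1] by (simp add: isCont_def complex_nonpos_Reals_iff)
  then have "\<forall>\<^sub>F z in at 1. dist (Arg z) (Arg 1) < \<delta>" using assms by (rule tendstoD)
  then obtain \<eta> where \<eta>: "0 < \<eta>" "\<And>z. z \<noteq> 1 \<Longrightarrow> dist z 1 < \<eta> \<Longrightarrow> \<bar>Arg z\<bar> < \<delta>"
    by (auto simp: eventually_at dist_real_def)
  have "\<exists>k::int. \<bar>s - t - 2 * pi * of_int k\<bar> < \<delta>" if "norm (cis s - cis t) < \<eta>" for s t
  proof -
    have "cis s - cis t = cis t * (cis (s - t) - 1)" by (simp add: algebra_simps cis_mult)
    then have "norm (cis (s - t) - 1) < \<eta>" using that by (simp add: norm_mult)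
    then have "\<bar>Arg (cis (s - t))\<bar> < \<delta>"
      using \<eta>(2)[of "cis (s - t)"] assms by (cases "cis (s - t) = 1") (auto simp: dist_norm)
    moreover obtain k :: int where "s - t = Arg (cis (s - t)) + 2 * pi * of_int k"
    proof -
      have "cis (Arg (cis (s - t))) = cis (s - t)" by (simp add: cis_Arg sgn_eq)
      then have "cis (s - t - Arg (cis (s - t))) = 1" by (simp add: cis_divide[symmetric])
      then have "cos (s - t - Arg (cis (s - t))) = 1" by (simp add: complex_eq_iff)
      then obtain n :: int where "s - t - Arg (cis (s - t)) = real_of_int n * 2 * pi"
        using cos_one_2pi_int by auto
      then show thesis by (intro that[of n]) (simp add: algebra_simps)
    qed
    ultimately show ?thesis by (intro exI[of _ k]) (metis add_diff_cancel_right')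
  qed
  then show ?thesis using \<eta>(1) by blast
qed

text \<open>Near each point, all chords of a regular \<open>C\<^sup>1\<close> Jordan curve are almost parallel to the tangent
  there, uniformly along the curve. Injectivity enters in that points close in the plane are close
  in the parameter.\<close>

lemma C1_jordan_curve_chords:
  assumes J: "C1_jordan_curve J" and "0 < s"
  shows "\<exists>r>0. \<forall>p\<in>J. \<exists>\<nu>. norm \<nu> = 1 \<and>
    (\<forall>a\<in>J \<inter> ball p r. \<forall>b\<in>J \<inter> ball p r. \<bar>Re ((b - a) * cnj \<nu>)\<bar> \<le> s * norm (b - a))"
proof -
  obtain g g' where contg: "continuous_on (sphere 0 1) g" and inj: "inj_on g (sphere 0 1)"
    and J_eq: "J = g ` sphere 0 1"
    and der: "\<And>t::real. ((\<lambda>s. g (cis s)) has_vector_derivative g' t) (at t)"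
    and contg': "continuous_on UNIV g'" and nz: "\<And>t. g' t \<noteq> 0"
    using J by (auto simp: C1_jordan_curve_def)
  define c where "c t = g (cis t)" for t
  have der: "(c has_vector_derivative g' t) (at t)" for t using der[of t] by (simp add: c_def[abs_def])
  have c_shift: "c (t + 2 * pi * of_int k) = c t" for t and k :: int
    unfolding c_def by (metis Ints_of_int cis_mult cis_multiple_2pi mult.right_neutral)
  \<comment> \<open>One period enlarged by 1 on both sides, so that it contains all parameters
    within \<open>\<delta> \<le> 1\<close> of a point of \<open>{0..2*pi}\<close>.\<close>
  define I where "I = {-1..2*pi+1::real}"
  have "compact I" "{0..2*pi} \<subseteq> I" by (auto simp: I_def)
  have contg'I: "continuous_on I g'" using contg' continuous_on_subset by blast
  obtain m where m: "0 < m" "\<And>t. t \<in> I \<Longrightarrow> m \<le> norm (g' t)"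
  proof -
    have "I \<noteq> {}" using pi_ge_zero by (auto simp: I_def)
    then obtain t where "t \<in> I" "\<And>y. y \<in> I \<Longrightarrow> norm (g' t) \<le> norm (g' y)"
      using continuous_attains_inf[OF \<open>compact I\<close> _ continuous_on_norm[OF contg'I]] by blast
    then show thesis using nz[of t] by (intro that[of "norm (g' t)"]) auto
  qed
  \<comment> \<open>Solves \<open>\<epsilon> = s * (m - \<epsilon>)\<close>: for parameters
    \<open>x\<close> and \<open>y\<close> the normal component of the chord is at most
    \<open>\<epsilon> * \<bar>y - x\<bar>\<close>, while its length is at least
    \<open>(m - \<epsilon>) * \<bar>y - x\<bar>\<close>.\<close>
  define \<epsilon> where "\<epsilon> = m * s / (1 + s)"
  have \<epsilon>: "0 < \<epsilon>" "\<epsilon> = s * (m - \<epsilon>)" using m \<open>0 < s\<close> by (auto simp: \<epsilon>_def field_simps)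
  obtain \<delta>0 where \<delta>0: "0 < \<delta>0" "\<And>x y. x \<in> I \<Longrightarrow> y \<in> I \<Longrightarrow> dist y x < \<delta>0 \<Longrightarrow> dist (g' y) (g' x) < \<epsilon>"
    using compact_uniformly_continuous[OF contg'I \<open>compact I\<close>] \<epsilon>(1)
    unfolding uniformly_continuous_on_def by metis
  define \<delta> where "\<delta> = min \<delta>0 1"
  have \<delta>: "0 < \<delta>" "\<delta> \<le> 1" "\<delta> \<le> \<delta>0" using \<delta>0 by (auto simp: \<delta>_def)
  obtain \<eta> where \<eta>: "0 < \<eta>"
    "\<And>s t. norm (cis s - cis t) < \<eta> \<Longrightarrow> \<exists>k::int. \<bar>s - t - 2 * pi * of_int k\<bar> < \<delta>"
    using cis_close_imp_arg_close[OF \<delta>(1)] by metis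
  \<comment> \<open>The inverse of an injective continuous map on a compact set is uniformly
    continuous on the image. This gives one radius \<open>r\<close> for the whole curve.\<close>
  define f where "f = the_inv_into (sphere 0 1) g"
  have f: "continuous_on J f" "\<And>z. z \<in> sphere 0 1 \<Longrightarrow> f (g z) = z"
    unfolding J_eq f_def
    using continuous_on_inv_into[OF contg compact_sphere inj] the_inv_into_f_f[OF inj] by simp_all
  have "compact J" unfolding J_eq by (rule compact_continuous_image[OF contg compact_sphere])
  then obtain r where r: "0 < r" "\<And>x y. x \<in> J \<Longrightarrow> y \<in> J \<Longrightarrow> dist y x < r \<Longrightarrow> dist (f y) (f x) < \<eta>"
    using compact_uniformly_continuous[OF f(1)] \<eta>(1) unfolding uniformly_continuous_on_def by metis
  have param: "\<exists>s. \<bar>s - t\<bar> < \<delta> \<and> c s = a" if "a \<in> J" "dist a (c t) < r" for a t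
  proof -
    obtain z where z: "z \<in> sphere 0 1" "a = g z" using \<open>a \<in> J\<close> J_eq by auto
    then obtain s0 where s0: "z = cis s0"
      by (metis cis_Arg dist_0_norm mem_sphere norm_zero sgn_eq of_real_1 div_by_1 zero_neq_one)
    have "c t \<in> J" by (auto simp: J_eq c_def)
    then have "dist (f a) (f (c t)) < \<eta>" using that by (intro r) auto
    then have "norm (cis s0 - cis t) < \<eta>" using f(2) z s0 by (simp add: c_def dist_norm)
    then obtain k :: int where k: "\<bar>s0 - t - 2 * pi * of_int k\<bar> < \<delta>" using \<eta>(2) by blast
    have "c (s0 + 2 * pi * of_int (- k)) = a" unfolding c_shift by (simp add: c_def z s0)
    then show ?thesis using k by (intro exI[of _ "s0 + 2 * pi * of_int (- k)"]) (auto simp: algebra_simps)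
  qed
  have "\<exists>\<nu>. norm \<nu> = 1 \<and>
    (\<forall>a\<in>J \<inter> ball p r. \<forall>b\<in>J \<inter> ball p r. \<bar>Re ((b - a) * cnj \<nu>)\<bar> \<le> s * norm (b - a))" if "p \<in> J" for p
  proof -
    obtain z where z: "z \<in> sphere 0 1" "p = g z" using \<open>p \<in> J\<close> J_eq by auto
    have "z = cis (Arg2pi z)" using Arg2pi[of z] z by (simp add: is_Arg_def cis_conv_exp)
    then have "p = c (Arg2pi z)" using z by (simp add: c_def)
    then obtain t0 where t0: "t0 \<in> {0..2*pi}" "p = c t0"
      using Arg2pi[of z] that by (metis atLeastAtMost_iff less_imp_le)
    define v where "v = g' t0"
    have v: "m \<le> norm v" "v \<noteq> 0" using m(2)[of t0] t0 \<open>{0..2*pi} \<subseteq> I\<close> nz by (auto simp: v_def)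
    \<comment> \<open>The unit normal: the tangent \<open>v\<close> turned by a right angle and
      normalised.\<close>
    define \<nu> where "\<nu> = \<i> * v / of_real (norm v)"
    have "norm \<nu> = 1" using v by (simp add: \<nu>_def norm_mult norm_divide)
    have Rev: "Re (v * cnj \<nu>) = 0"
      by (simp add: \<nu>_def Re_divide_of_real)
    have "\<bar>Re ((b - a) * cnj \<nu>)\<bar> \<le> s * norm (b - a)"
      if a: "a \<in> J \<inter> ball p r" and b: "b \<in> J \<inter> ball p r" for a b
    proof -
      obtain x y where x: "\<bar>x - t0\<bar> < \<delta>" "c x = a" and y: "\<bar>y - t0\<bar> < \<delta>" "c y = b"
        using param[of a t0] param[of b t0] a b t0 by (auto simp: dist_commute)
      have sub: "u \<in> I \<and> dist u t0 < \<delta>0" if "u \<in> {t0 - \<delta><..<t0 + \<delta>}" for u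
      proof -
        have "t0 - \<delta> < u" "u < t0 + \<delta>" "0 \<le> t0" "t0 \<le> 2 * pi" using that t0(1) by simp_all
        then have "-1 \<le> u" "u \<le> 2 * pi + 1" "\<bar>u - t0\<bar> < \<delta>0" using \<delta> by linarith+
        then show ?thesis by (simp only: I_def dist_real_def atLeastAtMost_iff)
      qed
      \<comment> \<open>Mean value estimate for \<open>c u - u *\<^sub>R v\<close>, whose derivative
        \<open>g' u - v\<close> is smaller than \<open>\<epsilon>\<close> near
        \<open>t0\<close>.\<close>
      have "norm (b - a - (y - x) *\<^sub>R v) \<le> \<epsilon> * \<bar>y - x\<bar>"
      proof -
        have "norm ((c y - y *\<^sub>R v) - (c x - x *\<^sub>R v)) \<le> \<epsilon> * norm (y - x)"
        proof (rule differentiable_bound[where S = "{t0 - \<delta><..<t0 + \<delta>}" and f' = "\<lambda>u h. h *\<^sub>R (g' u - v)"])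
          show "((\<lambda>u. c u - u *\<^sub>R v) has_derivative (\<lambda>h. h *\<^sub>R (g' u - v))) (at u within {t0 - \<delta><..<t0 + \<delta>})" for u
          proof (rule has_derivative_at_withinI)
            have "((\<lambda>u. u *\<^sub>R v) has_derivative (\<lambda>h. h *\<^sub>R v)) (at u)"
              by (rule bounded_linear_imp_has_derivative[OF bounded_linear_scaleR_left])
            from has_derivative_diff[OF der[of u, unfolded has_vector_derivative_def] this]
            show "((\<lambda>u. c u - u *\<^sub>R v) has_derivative (\<lambda>h. h *\<^sub>R (g' u - v))) (at u)"
              by (simp add: scaleR_diff_right)
          qed
          show "onorm (\<lambda>h. h *\<^sub>R (g' u - v)) \<le> \<epsilon>" if "u \<in> {t0 - \<delta><..<t0 + \<delta>}" for u
          proof (rule onorm_le)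
            have "dist (g' u) (g' t0) < \<epsilon>" using sub[OF that] t0 \<open>{0..2*pi} \<subseteq> I\<close> by (intro \<delta>0) auto
            then show "norm (h *\<^sub>R (g' u - v)) \<le> \<epsilon> * norm h" for h
              by (simp add: v_def dist_norm) (metis abs_ge_zero less_eq_real_def mult.commute mult_left_mono)
          qed
        qed (use x y in auto)
        then show ?thesis using x y by (simp add: algebra_simps)
      qed
      note est = this
      have "Re ((b - a - (y - x) *\<^sub>R v) * cnj \<nu>) = Re ((b - a) * cnj \<nu>) - (y - x) * Re (v * cnj \<nu>)"
        by (simp add: algebra_simps)
      then have "\<bar>Re ((b - a) * cnj \<nu>)\<bar> = \<bar>Re ((b - a - (y - x) *\<^sub>R v) * cnj \<nu>)\<bar>"
        unfolding Rev by simp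
      also have "\<dots> \<le> norm ((b - a - (y - x) *\<^sub>R v) * cnj \<nu>)" by (rule abs_Re_le_cmod)
      also have "\<dots> \<le> \<epsilon> * \<bar>y - x\<bar>" using est \<open>norm \<nu> = 1\<close> by (simp add: norm_mult)
      also have "\<dots> = s * ((m - \<epsilon>) * \<bar>y - x\<bar>)" using \<epsilon>(2) by (metis mult.assoc)
      also have "\<dots> \<le> s * norm (b - a)"
      proof (rule mult_left_mono)
        have "m * \<bar>y - x\<bar> \<le> norm ((y - x) *\<^sub>R v)" using v by (simp add: mult.commute mult_right_mono)
        also have "\<dots> \<le> norm (b - a) + \<epsilon> * \<bar>y - x\<bar>"
          using est norm_triangle_ineq2[of "(y - x) *\<^sub>R v" "b - a"] by (simp add: norm_minus_commute)
        finally show "(m - \<epsilon>) * \<bar>y - x\<bar> \<le> norm (b - a)" by (simp add: algebra_simps)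
      qed (use \<open>0 < s\<close> in simp)
      finally show ?thesis .
    qed
    then show ?thesis using \<open>norm \<nu> = 1\<close> by blast
  qed
  then show ?thesis using r(1) by blast
qed

text \<open>Links the description of \<open>D\<close> by its frontier with the Jordan curve theorem.
  A connected set that avoids \<open>frontier D\<close> and meets \<open>D\<close> lies in
  \<open>D\<close>. The unbounded outside therefore cannot meet the bounded \<open>D\<close>, so
  \<open>D\<close> is contained in the inside and, being nonempty, exhausts it.\<close>

lemma smooth_jordan_domain_inside:
  assumes "smooth_jordan_domain D"
  obtains c where "simple_path c" "pathfinish c = pathstart c" "frontier D = path_image c"
    "D = inside (path_image c)"
proof -
  have D: "open D" "connected D" "D \<noteq> {}" "bounded D" and C1: "C1_jordan_curve (frontier D)"
    using assms by (auto simp: smooth_jordan_domain_def)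
  obtain g g' where contg: "continuous_on (sphere 0 1) g" and inj: "inj_on g (sphere 0 1)"
    and J_eq: "frontier D = g ` sphere 0 1"
    and der: "\<And>t::real. ((\<lambda>s. g (cis s)) has_vector_derivative g' t) (at t)"
    using C1 by (auto simp: C1_jordan_curve_def)
  define c where "c = g \<circ> circlepath 0 1"
  have c: "simple_path c"
    unfolding c_def using inj contg by (intro simple_path_continuous_image) (auto simp: simple_path_circlepath)
  have cl: "pathfinish c = pathstart c" by (simp add: c_def pathfinish_compose pathstart_compose)
  have img: "path_image c = frontier D" by (simp add: c_def path_image_compose J_eq)
  note J = Jordan_inside_outside[OF c cl, unfolded img]
  have disj: "D \<inter> frontier D = {}" using D(1) by (auto simp: frontier_def interior_open)
  have sub: "X \<subseteq> D" if "connected X" "X \<inter> frontier D = {}" "X \<inter> D \<noteq> {}" for X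
    using connected_Int_frontier[of X D] that by blast
  have "outside (frontier D) \<inter> D = {}"
  proof (rule ccontr)
    assume "outside (frontier D) \<inter> D \<noteq> {}"
    then have "outside (frontier D) \<subseteq> D" using J by (intro sub) auto
    then show False using J D(4) bounded_subset by blast
  qed
  then have "D \<subseteq> inside (frontier D)" using J disj by blast
  moreover have "inside (frontier D) \<subseteq> D" using J calculation D(3) by (intro sub) auto
  ultimately have "D = inside (path_image c)" using img by auto
  then show thesis using that c cl img by metis
qed

lemma smooth_jordan_domain_simply_connected:
  assumes "smooth_jordan_domain D"
  shows "simply_connected D"
  using smooth_jordan_domain_inside[OF assms] simply_connected_inside_simple_path by metis

text \<open>Of the two sectors around the normal directions at a boundary point, neither meets the curve. Any
  point near \<open>p\<close> and off the curve can be moved along the normal direction, without meeting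
  the curve, into one of the two; as there are exterior points arbitrarily close to \<open>p\<close>, one of
  the sectors lies outside the domain.\<close>

lemma smooth_jordan_domain_exterior_sector:
  assumes D: "smooth_jordan_domain D" and s: "0 < s" "s < 1"
  shows "\<exists>r>0. exterior_sector s r D"
proof -
  \<comment> \<open>The cap \<open>1/2\<close> makes a move of length \<open>4 * t\<close> along the
    normal win over an initial offset below \<open>t\<close>: its normal part exceeds
    \<open>3 * t\<close>, whereas \<open>\<sigma>\<close> times the distance to \<open>p\<close> is
    at most \<open>5/2 * t\<close>.\<close>
  define \<sigma> where "\<sigma> = min s (1/2)"
  have \<sigma>: "0 < \<sigma>" "\<sigma> \<le> s" "\<sigma> \<le> 1/2" using s by (auto simp: \<sigma>_def)
  have "open D" and C1: "C1_jordan_curve (frontier D)"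
    using D by (auto simp: smooth_jordan_domain_def)
  obtain c where c: "simple_path c" "pathfinish c = pathstart c" and fr: "frontier D = path_image c"
    and ins: "D = inside (path_image c)"
    using smooth_jordan_domain_inside[OF D] by blast
  note J = Jordan_inside_outside[OF c, folded fr ins]
  obtain r where r: "0 < r" "\<And>p. p \<in> frontier D \<Longrightarrow> \<exists>\<nu>. norm \<nu> = 1 \<and>
    (\<forall>a\<in>frontier D \<inter> ball p r. \<forall>b\<in>frontier D \<inter> ball p r. \<bar>Re ((b - a) * cnj \<nu>)\<bar> \<le> \<sigma> * norm (b - a))"
    using C1_jordan_curve_chords[OF C1 \<sigma>(1)] by blast
  have "\<exists>\<nu>. norm \<nu> = 1 \<and> (\<forall>z\<in>closure D \<inter> ball p r. - s * norm (z - p) \<le> Re ((z - p) * cnj \<nu>))"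
    if p: "p \<in> frontier D" for p
  proof -
    obtain \<nu> where \<nu>: "norm \<nu> = 1" and chord: "\<And>a b. a \<in> frontier D \<Longrightarrow> a \<in> ball p r \<Longrightarrow> b \<in> frontier D \<Longrightarrow>
      b \<in> ball p r \<Longrightarrow> \<bar>Re ((b - a) * cnj \<nu>)\<bar> \<le> \<sigma> * norm (b - a)"
      using r(2)[OF p] by blast
    have \<nu>\<nu>: "\<nu> * cnj \<nu> = 1" using \<nu> by (simp add: complex_norm_square[symmetric])
    \<comment> \<open>\<open>\<tau> = 1\<close> and \<open>\<tau> = -1\<close> give the two opposite
      sectors. Each is convex, as the norm is convex and the right-hand side linear, so each lies
      wholly inside or wholly outside the curve.\<close>
    define S where "S \<tau> = {z \<in> ball p r. \<sigma> * norm (z - p) < \<tau> * Re ((z - p) * cnj \<nu>)}" for \<tau> :: real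
    have S_disj: "S \<tau> \<inter> frontier D = {}" if "\<bar>\<tau>\<bar> = 1" for \<tau>
    proof -
      have False if "z \<in> S \<tau>" "z \<in> frontier D" for z
      proof -
        have "\<tau> * Re ((z - p) * cnj \<nu>) \<le> \<bar>Re ((z - p) * cnj \<nu>)\<bar>"
          using \<open>\<bar>\<tau>\<bar> = 1\<close> by (metis abs_ge_self abs_mult mult_1)
        then show False using chord[of p z] p that r(1) by (auto simp: S_def)
      qed
      then show ?thesis by blast
    qed
    have S_conn: "connected (S \<tau>)" for \<tau>
    proof (rule convex_connected)
      show "convex (S \<tau>)"
        unfolding convex_def
      proof (intro ballI allI impI)
        fix x y and u v :: real
        assume x: "x \<in> S \<tau>" and y: "y \<in> S \<tau>" and uv: "0 \<le> u" "0 \<le> v" "u + v = 1"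
        have inb: "u *\<^sub>R x + v *\<^sub>R y \<in> ball p r"
          using x y uv convex_ball[of p r] by (auto simp: S_def convex_def)
        have eq: "u *\<^sub>R x + v *\<^sub>R y - p = u *\<^sub>R (x - p) + v *\<^sub>R (y - p)"
        proof -
          have "u *\<^sub>R x + v *\<^sub>R y - (u + v) *\<^sub>R p = u *\<^sub>R (x - p) + v *\<^sub>R (y - p)"
            by (simp add: algebra_simps)
          then show ?thesis using uv by simp
        qed
        have n: "norm (u *\<^sub>R (x - p) + v *\<^sub>R (y - p)) \<le> u * norm (x - p) + v * norm (y - p)"
          using norm_triangle_ineq[of "u *\<^sub>R (x - p)" "v *\<^sub>R (y - p)"] uv by simp
        have "\<sigma> * norm (u *\<^sub>R (x - p) + v *\<^sub>R (y - p)) \<le> \<sigma> * (u * norm (x - p) + v * norm (y - p))"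
          using n \<sigma>(1) by (intro mult_left_mono) auto
        also have "\<dots> = u * (\<sigma> * norm (x - p)) + v * (\<sigma> * norm (y - p))"
          by (simp add: algebra_simps)
        also have "u * (\<sigma> * norm (x - p)) + v * (\<sigma> * norm (y - p))
            < u * (\<tau> * Re ((x - p) * cnj \<nu>)) + v * (\<tau> * Re ((y - p) * cnj \<nu>))"
        proof (cases "u = 0")
          case True
          then show ?thesis using uv y by (auto simp: S_def)
        next
          case False
          then show ?thesis using uv x y
            by (intro add_less_le_mono mult_strict_left_mono mult_left_mono) (auto simp: S_def)
        qed
        also have "\<dots> = \<tau> * Re ((u *\<^sub>R (x - p) + v *\<^sub>R (y - p)) * cnj \<nu>)"
          by (simp add: algebra_simps)
        finally show "u *\<^sub>R x + v *\<^sub>R y \<in> S \<tau>"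
          using inb by (simp only: S_def mem_Collect_eq eq)
      qed
    qed
    have sub: "X \<subseteq> Y" if "connected X" "X \<inter> frontier D = {}" "X \<inter> Y \<noteq> {}" "frontier Y = frontier D" for X Y
      using connected_Int_frontier[of X Y] that by blast
    have frO: "frontier (outside (frontier D)) = frontier D" using J by blast
    have "\<exists>\<tau>. \<bar>\<tau>\<bar> = 1 \<and> S \<tau> \<inter> outside (frontier D) \<noteq> {}"
    proof -
      \<comment> \<open>A point within \<open>t\<close> of \<open>p\<close>, moved by at most
        \<open>4 * t\<close>, stays within \<open>5 * t < r\<close> of \<open>p\<close>.\<close>
      define t where "t = r / 8"
      have t: "0 < t" "8 * t = r" using r by (auto simp: t_def)
      obtain z where z: "z \<in> outside (frontier D)" "dist z p < t"
        using p t(1) frO frontier_def[of "outside (frontier D)"] closure_approachable[of p "outside (frontier D)"] by auto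
      have zfr: "z \<notin> frontier D" using z(1) J by blast
      define w where "w y = z + of_real y * \<nu>" for y
      have w_ball: "w y \<in> ball p r" if "\<bar>y\<bar> \<le> 4 * t" for y
      proof -
        have "norm (w y - p) \<le> norm (z - p) + \<bar>y\<bar>"
          using norm_triangle_ineq[of "z - p" "of_real y * \<nu>"] \<nu> by (simp add: w_def norm_mult algebra_simps)
        then show ?thesis using z(2) that t by (simp add: dist_norm norm_minus_commute)
      qed
      \<comment> \<open>Two hits would span a chord parallel to \<open>\<nu>\<close>, contradicting
        \<open>\<sigma> < 1\<close>. As \<open>z\<close> itself is off the curve, one of the two
        half-segments starting at \<open>z\<close> misses the curve altogether.\<close>
      have one_hit: "y = y'" if "\<bar>y\<bar> \<le> 4 * t" "\<bar>y'\<bar> \<le> 4 * t" "w y \<in> frontier D" "w y' \<in> frontier D" for y y'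
      proof -
        have eq: "w y' - w y = of_real (y' - y) * \<nu>" by (simp add: w_def algebra_simps)
        have "(w y' - w y) * cnj \<nu> = of_real (y' - y)" unfolding eq using \<nu>\<nu> by (simp add: mult.assoc)
        moreover have "\<bar>Re ((w y' - w y) * cnj \<nu>)\<bar> \<le> \<sigma> * norm (w y' - w y)"
          using that w_ball by (intro chord) auto
        moreover have "norm (w y' - w y) = \<bar>y' - y\<bar>"
          unfolding eq using \<nu> by (simp add: norm_mult del: of_real_diff)
        ultimately have "\<bar>y' - y\<bar> \<le> \<sigma> * \<bar>y' - y\<bar>" by (simp only: Re_complex_of_real)
        then have "(1 - \<sigma>) * \<bar>y' - y\<bar> \<le> 0" by (simp add: algebra_simps)
        then show ?thesis using \<sigma> by (simp add: mult_le_0_iff)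
      qed
      have "\<exists>\<tau>. \<bar>\<tau>\<bar> = 1 \<and> (\<forall>y\<in>{0..4*t}. w (\<tau> * y) \<notin> frontier D)"
      proof (rule ccontr)
        assume no: "\<not> ?thesis"
        obtain y where y: "y \<in> {0..4*t}" "w y \<in> frontier D"
          using no by (metis abs_one mult_1)
        obtain y' where y': "y' \<in> {0..4*t}" "w (- y') \<in> frontier D"
          using no by (metis abs_minus_cancel abs_one mult_minus1)
        have "y = - y'" using y y' by (intro one_hit) auto
        then have "y = 0" using y y' by auto
        then show False using y zfr by (simp add: w_def)
      qed
      then obtain \<tau> where \<tau>: "\<bar>\<tau>\<bar> = 1" "\<And>y. y \<in> {0..4*t} \<Longrightarrow> w (\<tau> * y) \<notin> frontier D" by blast
      have "\<tau> * \<tau> = 1" using \<tau>(1) by (metis abs_mult_self_eq mult_1)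
      have "(\<lambda>y. w (\<tau> * y)) ` {0..4*t} \<subseteq> outside (frontier D)"
      proof (rule sub)
        show "connected ((\<lambda>y. w (\<tau> * y)) ` {0..4*t})"
          unfolding w_def by (intro connected_continuous_image continuous_intros connected_Icc)
        have "w (\<tau> * 0) \<in> outside (frontier D)" using z by (simp add: w_def)
        then show "(\<lambda>y. w (\<tau> * y)) ` {0..4*t} \<inter> outside (frontier D) \<noteq> {}" using t(1) by fastforce
      qed (use \<tau> frO in auto)
      then have "w (\<tau> * (4 * t)) \<in> outside (frontier D)" using t(1) by auto
      moreover have "w (\<tau> * (4 * t)) \<in> S \<tau>"
      proof -
        have eq: "w (\<tau> * (4 * t)) - p = (z - p) + of_real (\<tau> * (4 * t)) * \<nu>" by (simp add: w_def)
        have "\<tau> * Re ((w (\<tau> * (4 * t)) - p) * cnj \<nu>) = \<tau> * Re ((z - p) * cnj \<nu>) + \<tau> * \<tau> * (4 * t)"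
        proof -
          have "(w (\<tau> * (4 * t)) - p) * cnj \<nu> = (z - p) * cnj \<nu> + of_real (\<tau> * (4 * t))"
            unfolding eq using \<nu>\<nu> by (simp add: distrib_right mult.assoc)
          then show ?thesis by (simp only: plus_complex.sel Re_complex_of_real) (simp add: algebra_simps)
        qed
        moreover have "\<bar>\<tau> * Re ((z - p) * cnj \<nu>)\<bar> \<le> norm (z - p)"
          using abs_Re_le_cmod[of "(z - p) * cnj \<nu>"] \<nu> \<tau>(1) by (simp add: abs_mult norm_mult)
        ultimately have lo: "4 * t - t < \<tau> * Re ((w (\<tau> * (4 * t)) - p) * cnj \<nu>)"
          using z(2) \<open>\<tau> * \<tau> = 1\<close> by (simp add: dist_norm)
        have "norm (w (\<tau> * (4 * t)) - p) \<le> norm (z - p) + 4 * t"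
          unfolding eq using norm_triangle_ineq[of "z - p" "of_real (\<tau> * (4 * t)) * \<nu>"] \<nu> \<tau>(1) t(1)
          by (simp add: norm_mult abs_mult)
        then have "norm (w (\<tau> * (4 * t)) - p) \<le> 5 * t" using z(2) by (simp add: dist_norm)
        then have "\<sigma> * norm (w (\<tau> * (4 * t)) - p) \<le> 1/2 * (5 * t)" using \<sigma> by (intro mult_mono) auto
        then have "\<sigma> * norm (w (\<tau> * (4 * t)) - p) < \<tau> * Re ((w (\<tau> * (4 * t)) - p) * cnj \<nu>)"
          using lo t(1) by linarith
        moreover have "w (\<tau> * (4 * t)) \<in> ball p r" using \<tau>(1) t(1) by (intro w_ball) (simp add: abs_mult)
        ultimately show ?thesis by (simp add: S_def)
      qed
      ultimately show ?thesis using \<tau>(1) by blast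
    qed
    then obtain \<tau> where \<tau>: "\<bar>\<tau>\<bar> = 1" "S \<tau> \<inter> outside (frontier D) \<noteq> {}" by blast
    then have "S \<tau> \<subseteq> outside (frontier D)" using S_disj S_conn frO by (intro sub) auto
    then have out: "S \<tau> \<inter> closure D = {}"
      using J S_disj[OF \<tau>(1)] \<open>open D\<close> by (auto simp: frontier_def interior_open)
    show ?thesis
    proof (intro exI[of _ "- of_real \<tau> * \<nu>"] conjI ballI)
      show "norm (- of_real \<tau> * \<nu>) = 1" using \<nu> \<tau> by (simp add: norm_mult)
      fix z assume z: "z \<in> closure D \<inter> ball p r"
      then have "\<not> \<sigma> * norm (z - p) < \<tau> * Re ((z - p) * cnj \<nu>)" using out by (auto simp: S_def)
      moreover have "Re ((z - p) * cnj (- of_real \<tau> * \<nu>)) = - (\<tau> * Re ((z - p) * cnj \<nu>))"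
        by (simp add: algebra_simps)
      moreover have "\<sigma> * norm (z - p) \<le> s * norm (z - p)" using \<sigma> by (intro mult_right_mono) auto
      ultimately show "- s * norm (z - p) \<le> Re ((z - p) * cnj (- of_real \<tau> * \<nu>))"
        by linarith
    qed
  qed
  then show ?thesis using r(1) unfolding exterior_sector_def by blast
qed

section \<open>Hoelder continuity up to the boundary\<close>

text \<open>Away from the boundary the estimate follows from the gradient bound; points closer to the
  boundary than to each other are compared through their nearest boundary points.\<close>

lemma dirichlet_holder:
  fixes u :: "complex \<Rightarrow> real"
  assumes D: "open D" "bounded D" "D \<noteq> {}"
    and sector: "\<And>s. 0 < s \<Longrightarrow> s < 1 \<Longrightarrow> \<exists>r>0. exterior_sector s r D"
    and hol: "H holomorphic_on D" and uH: "\<And>z. z \<in> D \<Longrightarrow> u z = Re (H z)"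
    and cont: "continuous_on (closure D) u"
    and \<beta>: "0 < \<beta>" "\<beta> < 1" and holder: "holder_on \<beta> (frontier D) u"
  shows "holder_on \<beta> (closure D) u"
proof -
  have "compact (closure D)" using D by simp
  then obtain M where M: "\<And>z. z \<in> closure D \<Longrightarrow> \<bar>u z\<bar> \<le> M"
    using compact_imp_bounded[OF compact_continuous_image[OF cont]] by (force simp: bounded_iff)
  then have "0 \<le> M" using D closure_subset by (metis abs_ge_zero all_not_in_conv order_trans subsetD)
  obtain C0 where C0: "\<And>x y. x \<in> frontier D \<Longrightarrow> y \<in> frontier D \<Longrightarrow> \<bar>u x - u y\<bar> \<le> C0 * norm (x - y) powr \<beta>"
    using holder by (auto simp: holder_on_def dist_norm)
  obtain s \<kappa> where s: "0 < s" "s < 1" and \<kappa>: "0 < \<kappa>"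
    "\<And>w. - s * norm w \<le> Re w \<Longrightarrow> \<kappa> * norm w powr \<beta> \<le> Re (w powr of_real \<beta>)"
    using Re_powr_sector_lower_bound[OF \<beta>] by auto
  obtain \<delta> where \<delta>: "0 < \<delta>" "exterior_sector s \<delta> D" using sector[OF s] by blast
  define t where "t = \<delta> / 2"
  have t: "0 < t" "t < \<delta>" using \<delta> by (auto simp: t_def)
  \<comment> \<open>The second summand absorbs the trivial bound \<open>2 * M\<close> at distances
    of at least \<open>t\<close>, so that only a neighbourhood of the boundary point needs the
    barrier.\<close>
  define C1 where "C1 = max C0 0 + 2 * M / t powr \<beta>"
  have C1: "0 \<le> C1" "max C0 0 \<le> C1" "2 * M / t powr \<beta> \<le> C1" using \<open>0 \<le> M\<close> by (auto simp: C1_def)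
  then have tC1: "2 * M \<le> C1 * t powr \<beta>" using t(1) by (simp add: field_simps)
  define C where "C = C1 + C1 / \<kappa>"
  have C: "0 \<le> C" "C1 \<le> C" "C1 / \<kappa> \<le> C" using C1(1) \<kappa>(1) by (auto simp: C_def)
  have far: "\<bar>u z - u p\<bar> \<le> C1 * norm (z - p) powr \<beta>"
    if "z \<in> closure D" "p \<in> closure D" "t \<le> norm (z - p)" for z p
  proof -
    have "\<bar>u z - u p\<bar> \<le> 2 * M" using M[OF that(1)] M[OF that(2)] by linarith
    also have "\<dots> \<le> C1 * t powr \<beta>" by (rule tC1)
    also have "\<dots> \<le> C1 * norm (z - p) powr \<beta>"
      using C1 t \<beta> that by (intro mult_left_mono powr_mono2) auto
    finally show ?thesis .
  qed
  have bdry: "\<bar>u z - u p\<bar> \<le> C * norm (z - p) powr \<beta>" if p: "p \<in> frontier D" and z: "z \<in> closure D" for z p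
  proof (cases "t \<le> norm (z - p)")
    case True
    have "\<bar>u z - u p\<bar> \<le> C1 * norm (z - p) powr \<beta>" using p z True by (intro far) (auto simp: frontier_def)
    also have "\<dots> \<le> C * norm (z - p) powr \<beta>" using C by (intro mult_right_mono) auto
    finally show ?thesis .
  next
    case near: False
    obtain \<nu> where \<nu>: "norm \<nu> = 1"
      "\<And>z. z \<in> closure D \<inter> ball p \<delta> \<Longrightarrow> - s * norm (z - p) \<le> Re ((z - p) * cnj \<nu>)"
      using \<delta>(2) p by (auto simp: exterior_sector_def)
    define \<Omega> where "\<Omega> = D \<inter> ball p t"
    have cl\<Omega>: "closure \<Omega> \<subseteq> closure D \<inter> cball p t"
      using closure_mono[of \<Omega> D] closure_mono[of \<Omega> "ball p t"] t by (auto simp: \<Omega>_def)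
    have "\<bar>u z - u p\<bar> \<le> 0 + C1 / \<kappa> * norm (z - p) powr \<beta>"
    proof (rule boundary_growth[where \<Omega> = \<Omega> and s = s and \<nu> = \<nu> and H = H])
      show "open \<Omega>" "bounded \<Omega>" unfolding \<Omega>_def using D by auto
      show "H holomorphic_on \<Omega>" by (rule holomorphic_on_subset[OF hol]) (auto simp: \<Omega>_def)
      show "continuous_on (closure \<Omega>) u" by (rule continuous_on_subset[OF cont]) (use cl\<Omega> in auto)
      show "p \<notin> \<Omega>" using p D by (auto simp: \<Omega>_def frontier_def interior_open)
      show "- s * norm (z - p) \<le> Re ((z - p) * cnj \<nu>)" if "z \<in> closure \<Omega>" for z
        using that cl\<Omega> t by (intro \<nu>) auto
      show "z \<in> closure \<Omega>"
        using z near open_Int_closure_subset[of "ball p t" D]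
        by (auto simp: \<Omega>_def dist_norm norm_minus_commute Int_commute)
      show "\<bar>u z - u p\<bar> \<le> 0 + C1 * norm (z - p) powr \<beta>" if zf: "z \<in> frontier \<Omega>" for z
      proof -
        have zcl: "z \<in> closure D" "dist p z \<le> t" "z \<notin> \<Omega>"
          using zf cl\<Omega> \<open>open \<Omega>\<close> by (auto simp: frontier_def interior_open)
        show ?thesis
        proof (cases "z \<in> D")
          case True
          then have "norm (z - p) = t" using zcl by (auto simp: \<Omega>_def dist_norm norm_minus_commute)
          then show ?thesis using far[of z p] zcl p by (auto simp: frontier_def)
        next
          case False
          then have "z \<in> frontier D" using zcl(1) D by (simp add: frontier_def interior_open)
          then have "\<bar>u z - u p\<bar> \<le> C0 * norm (z - p) powr \<beta>" using p by (rule C0)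
          also have "\<dots> \<le> C1 * norm (z - p) powr \<beta>" using C1 by (intro mult_right_mono) auto
          finally show ?thesis by simp
        qed
      qed
    qed (use s \<kappa> C1 \<nu> \<beta> uH in \<open>auto simp: \<Omega>_def\<close>)
    also have "\<dots> \<le> C * norm (z - p) powr \<beta>" unfolding add_0 using C by (intro mult_right_mono) auto
    finally show ?thesis .
  qed
  have "D \<noteq> UNIV" using D not_bounded_UNIV by metis
  then have fr: "closed (frontier D)" "frontier D \<noteq> {}"
    using D frontier_eq_empty[of D] by auto
  define d where "d z = infdist z (frontier D)" for z
  have nearest: "\<exists>p\<in>frontier D. d z = norm (z - p)" for z
    using infdist_attains_inf[OF fr] by (auto simp: d_def dist_norm)
  have dball: "ball z (d z) \<subseteq> D" if "z \<in> D" for z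
  proof -
    have "ball z (d z) \<inter> frontier D = {}"
      using infdist_le[of _ "frontier D" z] by (force simp: d_def)
    then have "d z > 0 \<Longrightarrow> ball z (d z) \<subseteq> D"
      using connected_Int_frontier[of "ball z (d z)" D] that by (metis Int_iff centre_in_ball connected_ball disjoint_iff Diff_eq_empty_iff)
    then show ?thesis by (metis ball_empty empty_subsetI not_less)
  qed
  \<comment> \<open>\<open>A\<close> serves pairs that are close compared with their distance to the
    boundary, the rest of \<open>B\<close> all other pairs. In the latter case
    \<open>d w \<le> d z \<le> 2 * norm (z - w)\<close>, so the nearest boundary points of
    \<open>z\<close> and \<open>w\<close> are at most \<open>5 * norm (z - w)\<close> apart.\<close>
  define A where "A = 72 * C * 2 powr \<beta>"
  define B where "B = A + 2 * (C * 2 powr \<beta>) + C * 5 powr \<beta>"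
  have AB: "0 \<le> A" "A \<le> B" "2 * (C * 2 powr \<beta>) + C * 5 powr \<beta> \<le> B" using C by (auto simp: A_def B_def)
  have main: "\<bar>u z - u w\<bar> \<le> B * norm (z - w) powr \<beta>"
    if z: "z \<in> closure D" and w: "w \<in> closure D" and le: "d w \<le> d z" for z w
  proof (cases "norm (z - w) < d z / 2")
    case True
    have "z \<in> D"
    proof (rule ccontr)
      assume "z \<notin> D"
      then have "z \<in> frontier D" using z D by (simp add: frontier_def interior_open)
      then have "d z = 0" by (simp add: d_def)
      then show False using True by (simp add: not_less)
    qed
    have dz: "0 < d z" using True norm_ge_zero[of "z - w"] by linarith
    obtain p where p: "p \<in> frontier D" "d z = norm (z - p)" using nearest by blast
    \<comment> \<open>Points of \<open>ball z (d z)\<close> are within \<open>2 * d z\<close> of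
      \<open>p\<close>, so the boundary estimate bounds the oscillation of \<open>u\<close> around
      \<open>u p\<close> there.\<close>
    define m where "m = C * (2 * d z) powr \<beta>"
    have osc: "\<bar>Re (H y) - u p\<bar> \<le> m" if "y \<in> ball z (d z)" for y
    proof -
      have "y \<in> D" using dball[OF \<open>z \<in> D\<close>] that by blast
      then have "\<bar>Re (H y) - u p\<bar> \<le> C * norm (y - p) powr \<beta>"
        using bdry[OF p(1), of y] uH closure_subset[of D] by auto
      also have "norm (y - p) \<le> 2 * d z"
        using norm_triangle_ineq[of "y - z" "z - p"] that p by (simp add: dist_norm norm_minus_commute)
      then have "C * norm (y - p) powr \<beta> \<le> m"
        unfolding m_def using C \<beta> by (intro mult_left_mono powr_mono2) auto
      finally show ?thesis .
    qed
    have "\<bar>u z - u w\<bar> \<le> (36 * m / d z) * norm (z - w)"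
    proof -
      have "norm (deriv H y) \<le> 36 * m / d z" if y: "y \<in> ball z (d z / 2)" for y
      proof -
        have sub: "ball y (d z / 2) \<subseteq> ball z (d z)"
          using y by (simp add: ball_subset_ball_iff dist_commute)
        \<comment> \<open>The derivative estimate asks for a strictly positive bound, but
          \<open>m\<close> may vanish; hence the arbitrary \<open>\<epsilon>\<close>.\<close>
        have "norm (deriv H y) \<le> 36 * m / d z + \<epsilon>" if "0 < \<epsilon>" for \<epsilon>
        proof -
          have "norm (deriv H y) \<le> 18 * (m + \<epsilon> * d z / 36) / (d z / 2)"
          proof (rule deriv_bound_of_Re_bound)
            show "H holomorphic_on ball y (d z / 2)"
              using sub dball[OF \<open>z \<in> D\<close>] by (intro holomorphic_on_subset[OF hol]) auto
            have "0 \<le> \<epsilon> * d z" using that dz by simp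
            then show "\<bar>Re (H x) - u p\<bar> \<le> m + \<epsilon> * d z / 36" if "x \<in> ball y (d z / 2)" for x
              using osc[of x] sub that by auto
            have "0 \<le> m" using C by (simp add: m_def)
            then show "0 < m + \<epsilon> * d z / 36" using that dz by (simp add: add_nonneg_pos)
          qed (use dz in auto)
          then show ?thesis using dz by (simp add: field_simps)
        qed
        then show ?thesis by (rule field_le_epsilon)
      qed
      moreover have "(H has_field_derivative deriv H y) (at y within ball z (d z / 2))"
        if "y \<in> ball z (d z / 2)" for y
      proof -
        have "y \<in> D" using that dball[OF \<open>z \<in> D\<close>] dz by auto
        then show ?thesis using holomorphic_derivI[OF hol D(1)] by (blast intro: has_field_derivative_at_within)
      qed
      ultimately have "norm (H z - H w) \<le> (36 * m / d z) * norm (z - w)"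
        using True dz by (intro field_differentiable_bound[where S = "ball z (d z / 2)" and f' = "deriv H"])
          (auto simp: dist_norm norm_minus_commute)
      moreover have "w \<in> D" using True dball[OF \<open>z \<in> D\<close>] dz by (auto simp: dist_norm)
      then have "\<bar>u z - u w\<bar> \<le> norm (H z - H w)"
        using uH \<open>z \<in> D\<close> abs_Re_le_cmod[of "H z - H w"] by simp
      ultimately show ?thesis by linarith
    qed
    also have "\<dots> = 36 * C * 2 powr \<beta> * (d z powr (\<beta> - 1) * norm (z - w))"
      using dz by (simp add: m_def powr_mult powr_diff)
    also have "d z powr (\<beta> - 1) * norm (z - w) \<le> norm (z - w) powr \<beta>"
    proof (cases "z = w")
      case False
      have "d z powr (\<beta> - 1) \<le> norm (z - w) powr (\<beta> - 1)"
        using True False \<beta> dz by (intro powr_mono2') auto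
      then have "d z powr (\<beta> - 1) * norm (z - w) \<le> norm (z - w) powr (\<beta> - 1) * norm (z - w)"
        by (rule mult_right_mono) simp
      also have "\<dots> = norm (z - w) powr \<beta>" using False by (simp add: powr_diff)
      finally show ?thesis .
    qed simp
    then have "36 * C * 2 powr \<beta> * (d z powr (\<beta> - 1) * norm (z - w)) \<le> B * norm (z - w) powr \<beta>"
      using C AB by (intro mult_mono) (auto simp: A_def intro!: order.trans[OF _ AB(2)])
    finally show ?thesis .
  next
    case False
    then have dz: "d z \<le> 2 * norm (z - w)" by simp
    obtain p where p: "p \<in> frontier D" "d z = norm (z - p)" using nearest by blast
    obtain p' where p': "p' \<in> frontier D" "d w = norm (w - p')" using nearest by blast
    have one: "\<bar>u z - u p\<bar> \<le> C * (2 * norm (z - w)) powr \<beta>"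
      using bdry[OF p(1) z] p(2) dz C \<beta> by (intro order.trans[OF bdry[OF p(1) z]] mult_left_mono powr_mono2) auto
    have two: "\<bar>u w - u p'\<bar> \<le> C * (2 * norm (z - w)) powr \<beta>"
      using p'(2) le dz C \<beta> by (intro order.trans[OF bdry[OF p'(1) w]] mult_left_mono powr_mono2) auto
    have "norm (p - p') \<le> norm (z - p) + norm (z - w) + norm (w - p')"
      using norm_triangle_ineq4[of "z - p'" "z - p"] norm_triangle_ineq[of "z - w" "w - p'"]
      by (simp add: norm_minus_commute)
    then have "norm (p - p') \<le> 5 * norm (z - w)" using p p' le dz by linarith
    then have three: "\<bar>u p - u p'\<bar> \<le> C * (5 * norm (z - w)) powr \<beta>"
      using p p' C \<beta> by (intro order.trans[OF bdry[OF p'(1), of p]] mult_left_mono powr_mono2) (auto simp: frontier_def)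
    have "\<bar>u z - u w\<bar> \<le> (2 * (C * 2 powr \<beta>) + C * 5 powr \<beta>) * norm (z - w) powr \<beta>"
      using one two three by (simp add: powr_mult algebra_simps)
    also have "\<dots> \<le> B * norm (z - w) powr \<beta>" using AB by (intro mult_right_mono) auto
    finally show ?thesis .
  qed
  have "\<bar>u z - u w\<bar> \<le> B * norm (z - w) powr \<beta>" if "z \<in> closure D" "w \<in> closure D" for z w
    using main[OF that] main[OF that(2,1)] by (cases "d w \<le> d z") (auto simp: abs_minus_commute norm_minus_commute)
  then show ?thesis unfolding holder_on_def by (intro exI[of _ B]) (auto simp: dist_norm)
qed

section \<open>Logarithmic potentials\<close>

lemma emeasure_ball_complex: "0 \<le> r \<Longrightarrow> emeasure lborel (ball (z::complex) r) = ennreal (pi * r\<^sup>2)"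
  using emeasure_ball[of r z] by (simp add: unit_ball_vol_2)

declare borel_open[OF open_ball, measurable]

section \<open>Dyadic estimates of singular and improper integrals\<close>

text \<open>Comparison with step functions on concentric balls stands in for polar coordinates.
  Shrinking balls treat a singularity at \<open>z\<close>, growing ones the decay at
  infinity.\<close>

lemma nn_integral_le_ball_series:
  fixes f :: "complex \<Rightarrow> ennreal"
  assumes le: "\<And>w. f w \<le> (\<Sum>n. ennreal (a n) * indicator (ball z (r n)) w)"
    and nonneg: "\<And>n. 0 \<le> a n" "\<And>n. 0 \<le> r n" and sum: "summable (\<lambda>n::nat. a n * (r n)\<^sup>2)"
  shows "(\<integral>\<^sup>+w. f w \<partial>lborel) \<le> ennreal (pi * (\<Sum>n. a n * (r n)\<^sup>2))"
proof -
  have "(\<integral>\<^sup>+w. f w \<partial>lborel) \<le> (\<integral>\<^sup>+w. (\<Sum>n. ennreal (a n) * indicator (ball z (r n)) w) \<partial>lborel)"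
    by (intro nn_integral_mono le)
  also have "\<dots> = (\<Sum>n. \<integral>\<^sup>+w. ennreal (a n) * indicator (ball z (r n)) w \<partial>lborel)"
    by (rule nn_integral_suminf) measurable
  also have "\<dots> = (\<Sum>n. ennreal (pi * (a n * (r n)\<^sup>2)))"
  proof (rule suminf_cong)
    fix n
    have "(\<integral>\<^sup>+w. ennreal (a n) * indicator (ball z (r n)) w \<partial>lborel) = ennreal (a n) * ennreal (pi * (r n)\<^sup>2)"
      by (subst nn_integral_cmult_indicator) (auto simp: emeasure_ball_complex nonneg)
    also have "\<dots> = ennreal (pi * (a n * (r n)\<^sup>2))"
      using nonneg[of n] by (simp add: ennreal_mult'[symmetric] mult_ac)
    finally show "(\<integral>\<^sup>+w. ennreal (a n) * indicator (ball z (r n)) w \<partial>lborel) = ennreal (pi * (a n * (r n)\<^sup>2))" .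
  qed
  also have "\<dots> = ennreal (\<Sum>n. pi * (a n * (r n)\<^sup>2))"
    by (intro suminf_ennreal2 summable_mult sum) (simp add: nonneg)
  also have "\<dots> = ennreal (pi * (\<Sum>n. a n * (r n)\<^sup>2))"
    using suminf_mult[OF sum, of pi] by simp
  finally show ?thesis .
qed

lemma le_suminf_ennreal: "(f n :: ennreal) \<le> (\<Sum>n. f n)"
  using sum_le_suminf[of f "{n}"] by simp

text \<open>Where \<open>norm (z - w) \<ge> 1\<close> the kernel is at most 1. On the remaining
  dyadic annuli around \<open>z\<close> the series has ratio \<open>2 powr s / 4\<close>, less than
  1 because \<open>s < 2\<close>. Nothing in the bound depends on \<open>z\<close>.\<close>

lemma Riesz_kernel_bound:
  assumes "0 < s" "s < 2"
  shows "\<exists>A. 0 \<le> A \<and> (\<forall>z::complex. (\<integral>\<^sup>+w. ennreal (indicator (ball 0 R) w * norm (z - w) powr (- s)) \<partial>lborel) \<le> ennreal A)"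
proof -
  \<comment> \<open>The largest value of the kernel on the annulus from radius
    \<open>(1/2) ^ (n + 1)\<close> to \<open>(1/2) ^ n\<close>.\<close>
  define a where "a n = 2 powr (s * (real n + 1))" for n
  define r where "r n = (1/2::real) ^ n" for n
  have prod: "a n * (r n)\<^sup>2 = 2 powr s * (2 powr s / 4) ^ n" for n
  proof -
    have "(r n)\<^sup>2 = (1/4) ^ n"
      by (simp add: r_def power2_eq_square flip: power_mult_distrib)
    moreover have "2 powr (s * real n) = (2 powr s) ^ n"
      by (simp add: powr_powr[symmetric] powr_realpow)
    then have "a n = 2 powr s * (2 powr s) ^ n"
      by (simp add: a_def distrib_left powr_add)
    ultimately show ?thesis by (simp add: power_divide)
  qed
  have "2 powr s < 2 powr (2::real)" using assms by (intro powr_less_mono) auto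
  then have sum: "summable (\<lambda>n. a n * (r n)\<^sup>2)"
    unfolding prod by (intro summable_mult summable_geometric) auto
  define A where "A = pi * R\<^sup>2 + pi * (\<Sum>n. a n * (r n)\<^sup>2)"
  have A0: "0 \<le> pi * (\<Sum>n. a n * (r n)\<^sup>2)"
    by (intro mult_nonneg_nonneg suminf_nonneg sum) (auto simp: a_def)
  have "(\<integral>\<^sup>+w. ennreal (indicator (ball 0 R) w * norm (z - w) powr (- s)) \<partial>lborel) \<le> ennreal A" for z :: complex
  proof -
    have pt: "ennreal (indicator (ball 0 R) w * norm (z - w) powr (- s)) \<le> indicator (ball 0 R) w
        + (\<Sum>n. ennreal (a n) * indicator (ball z (r n)) w)" for w
    \<comment> \<open>The singular point falls under the easy case, as
      \<open>0 powr (- s) = 0\<close>.\<close>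
    proof (cases "w = z \<or> 1 \<le> norm (z - w)")
      case True
      then have "norm (z - w) powr (- s) \<le> 1"
        using assms powr_mono_both[of 0 s 1 "norm (z - w)"] by (auto simp: powr_minus inverse_le_1_iff)
      then have "ennreal (indicator (ball 0 R) w * norm (z - w) powr (- s)) \<le> indicator (ball 0 R) w"
        by (auto simp: indicator_def)
      then show ?thesis by (simp add: add_increasing2)
    next
      case False
      define t where "t = norm (z - w)"
      have t: "0 < t" "t < 1" using False by (auto simp: t_def)
      obtain N where "(1/2::real) ^ N < t" using real_arch_pow_inv[of t "1/2"] t by auto
      define n where "n = (LEAST n. (1/2::real) ^ Suc n \<le> t)"
      have ex: "(1/2::real) ^ Suc N \<le> t"
      proof -
        have "(1/2::real) ^ Suc N = (1/2) ^ N / 2" by simp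
        then show ?thesis using \<open>(1/2::real) ^ N < t\<close> t(1) by linarith
      qed
      then have n1: "(1/2::real) ^ Suc n \<le> t" unfolding n_def by (rule LeastI)
      have n2: "t < (1/2) ^ n"
      proof (cases n)
        case 0 then show ?thesis using t by simp
      next
        case (Suc m)
        then have "m < n" by simp
        then have "\<not> (1/2::real) ^ Suc m \<le> t" unfolding n_def by (rule not_less_Least)
        then show ?thesis using Suc by simp
      qed
      have "t powr (- s) \<le> ((1/2) ^ Suc n) powr (- s)"
        using n1 t assms by (intro powr_mono2') auto
      also have "((1/2::real) ^ Suc n) = 2 powr (- (real n + 1))"
        unfolding powr_minus using powr_realpow[of 2 "Suc n"] by (simp add: power_one_over inverse_eq_divide add.commute)
      also have "(2 powr (- (real n + 1))) powr (- s) = a n"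
        by (simp add: a_def powr_powr algebra_simps)
      finally have "ennreal (indicator (ball 0 R) w * norm (z - w) powr (- s)) \<le> ennreal (a n) * indicator (ball z (r n)) w"
        using n2 by (auto simp: t_def r_def indicator_def dist_norm a_def intro!: ennreal_leI)
      also have "\<dots> \<le> (\<Sum>n. ennreal (a n) * indicator (ball z (r n)) w)" by (rule le_suminf_ennreal)
      finally show ?thesis by (simp add: add_increasing)
    qed
    have "(\<integral>\<^sup>+w. ennreal (indicator (ball 0 R) w * norm (z - w) powr (- s)) \<partial>lborel)
        \<le> (\<integral>\<^sup>+w. indicator (ball 0 R) w + (\<Sum>n. ennreal (a n) * indicator (ball z (r n)) w) \<partial>lborel)"
      by (intro nn_integral_mono pt)
    also have "\<dots> = emeasure lborel (ball (0::complex) R) + (\<integral>\<^sup>+w. (\<Sum>n. ennreal (a n) * indicator (ball z (r n)) w) \<partial>lborel)"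
      by (subst nn_integral_add) (auto, measurable)
    also have "\<dots> \<le> ennreal (pi * R\<^sup>2) + ennreal (pi * (\<Sum>n. a n * (r n)\<^sup>2))"
    proof (rule add_mono)
      show "emeasure lborel (ball (0::complex) R) \<le> ennreal (pi * R\<^sup>2)"
        by (cases "0 \<le> R") (auto simp: emeasure_ball_complex ball_empty not_le less_imp_le)
      show "(\<integral>\<^sup>+w. (\<Sum>n. ennreal (a n) * indicator (ball z (r n)) w) \<partial>lborel) \<le> ennreal (pi * (\<Sum>n. a n * (r n)\<^sup>2))"
        by (rule nn_integral_le_ball_series[OF order.refl _ _ sum]) (auto simp: a_def r_def)
    qed
    also have "\<dots> = ennreal A" unfolding A_def using A0 by (subst ennreal_plus) auto
    finally show ?thesis .
  qed
  moreover have "0 \<le> A" using A0 by (simp add: A_def)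
  ultimately show ?thesis by blast
qed

lemma integrable_Poisson_profile: "integrable lborel (\<lambda>v::complex. 1 / (1 + (norm v)\<^sup>2)\<^sup>2)"
proof (rule integrableI_nonneg)
  \<comment> \<open>For \<open>n > 0\<close> the points between radius \<open>2 ^ (n - 1)\<close>
    and \<open>2 ^ n\<close> have profile at most \<open>(2 ^ (n - 1))\<close> to the power -4,
    which is \<open>16 / 16 ^ n\<close>; the value 16 at \<open>n = 0\<close> is generous.\<close>
  define a where "a n = 16 * (1/16::real) ^ n" for n
  define r where "r n = (2::real) ^ n" for n
  have prod: "a n * (r n)\<^sup>2 = 16 * (1/4) ^ n" for n
    by (simp add: a_def r_def power2_eq_square power_mult_distrib[symmetric] mult.assoc)
  have sum: "summable (\<lambda>n. a n * (r n)\<^sup>2)"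
    unfolding prod by (intro summable_mult summable_geometric) auto
  have "(\<integral>\<^sup>+(v::complex). ennreal (1 / (1 + (norm v)\<^sup>2)\<^sup>2) \<partial>lborel) \<le> ennreal (pi * (\<Sum>n. a n * (r n)\<^sup>2))"
  proof (rule nn_integral_le_ball_series[OF _ _ _ sum])
    fix v :: complex
    define t where "t = norm v"
    define n where "n = (LEAST n. t < (2::real) ^ n)"
    obtain N where "t < (2::real) ^ N" using real_arch_pow[of 2 t] by auto
    then have n1: "t < 2 ^ n" unfolding n_def by (rule LeastI)
    have "1 / (1 + t\<^sup>2)\<^sup>2 \<le> a n"
    proof (cases n)
      case 0
      have "1 \<le> (1 + t\<^sup>2)\<^sup>2" by (intro one_le_power) simp
      then have "1 / (1 + t\<^sup>2)\<^sup>2 \<le> 1 / 1" by (intro frac_le) auto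
      then show ?thesis using 0 by (simp add: a_def)
    next
      case (Suc m)
      then have "m < n" by simp
      then have "\<not> t < 2 ^ m" unfolding n_def by (rule not_less_Least)
      then have "((2 ^ m)\<^sup>2)\<^sup>2 \<le> (1 + t\<^sup>2)\<^sup>2" by (intro power_mono) (auto intro!: power_mono add_increasing)
      moreover have "((2 ^ m)\<^sup>2)\<^sup>2 = (16::real) ^ m"
        by (simp add: power_mult[symmetric]) (simp add: power_mult mult.commute[of m])
      ultimately have "1 / (1 + t\<^sup>2)\<^sup>2 \<le> 1 / 16 ^ m" by (intro frac_le) auto
      then show ?thesis using Suc by (simp add: a_def power_one_over)
    qed
    then have "ennreal (1 / (1 + (norm v)\<^sup>2)\<^sup>2) \<le> ennreal (a n) * indicator (ball 0 (r n)) v"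
      using n1 by (auto simp: t_def r_def intro!: ennreal_leI)
    also have "\<dots> \<le> (\<Sum>n. ennreal (a n) * indicator (ball 0 (r n)) v)" by (rule le_suminf_ennreal)
    finally show "ennreal (1 / (1 + (norm v)\<^sup>2)\<^sup>2) \<le> (\<Sum>n. ennreal (a n) * indicator (ball 0 (r n)) v)" .
  qed (auto simp: a_def r_def)
  then show "(\<integral>\<^sup>+(v::complex). ennreal (1 / (1 + (norm v)\<^sup>2)\<^sup>2) \<partial>lborel) < \<infinity>"
    by (rule order.strict_trans1) simp
qed auto

text \<open>The substitution \<open>w = z - e *\<^sub>R v\<close>, with Jacobian
  \<open>e ^ 2\<close> in real dimension two.\<close>

lemma integral_scale_reflect:
  fixes f :: "complex \<Rightarrow> real"
  assumes "f \<in> borel_measurable borel" "0 < e"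
  shows "(LINT w|lborel. f (z - w)) = (LINT v|lborel. e\<^sup>2 * f (e *\<^sub>R v))"
proof -
  have *: "lborel = density (distr lborel borel (\<lambda>v. z + (- e) *\<^sub>R v)) (\<lambda>_. ennreal (e\<^sup>2))"
    using lborel_affine[of "- e" z] assms by (simp add: ennreal_power)
  have "(LINT w|lborel. f (z - w)) = (LINT w|distr lborel borel (\<lambda>v. z + (- e) *\<^sub>R v). e\<^sup>2 * f (z - w))"
    using assms by (subst *) (subst integral_real_density, auto)
  also have "\<dots> = (LINT v|lborel. e\<^sup>2 * f (z - (z + (- e) *\<^sub>R v)))"
    using assms by (subst integral_distr) auto
  finally show ?thesis by simp
qed

section \<open>Bounded densities and convolution\<close>

text \<open>Densities are total Borel functions, so potentials are integrals over the whole plane.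
  \<open>R\<close> and \<open>B\<close> are explicit because the fixed point argument rests on
  estimates uniform over this class and linear in \<open>B\<close>.\<close>

definition bounded_density :: "real \<Rightarrow> real \<Rightarrow> (complex \<Rightarrow> real) \<Rightarrow> bool" where
  "bounded_density R B F \<longleftrightarrow> F \<in> borel_measurable borel \<and> (\<forall>w. \<bar>F w\<bar> \<le> B) \<and> (\<forall>w. w \<notin> ball 0 R \<longrightarrow> F w = 0)"

text \<open>The common dominating function of the kernel estimates: \<open>s = 1\<close> for size,
  \<open>s = 3/2\<close> for the error of smoothing and \<open>s = 1 + \<alpha>\<close> for Hoelder
  continuity, all below the critical value 2.\<close>

definition Riesz_weight :: "real \<Rightarrow> real \<Rightarrow> complex \<Rightarrow> complex \<Rightarrow> real" where
  "Riesz_weight R s z w = indicator (ball 0 R) w * norm (z - w) powr (- s)"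

lemma Riesz_weight_nonneg: "0 \<le> Riesz_weight R s z w"
  by (simp add: Riesz_weight_def)

lemma Riesz_weight_integral:
  assumes "0 < s" "s < 2"
  shows "\<exists>A\<ge>0. \<forall>z. integrable lborel (Riesz_weight R s z) \<and> (LINT w|lborel. Riesz_weight R s z w) \<le> A"
proof -
  obtain A where A: "0 \<le> A" "\<And>z. (\<integral>\<^sup>+w. ennreal (Riesz_weight R s z w) \<partial>lborel) \<le> ennreal A"
    using Riesz_kernel_bound[OF assms, of R] unfolding Riesz_weight_def by blast
  have "integrable lborel (Riesz_weight R s z) \<and> (LINT w|lborel. Riesz_weight R s z w) \<le> A" for z
  proof
    show int: "integrable lborel (Riesz_weight R s z)"
    proof (rule integrableI_nonneg)
      show "(\<integral>\<^sup>+w. ennreal (Riesz_weight R s z w) \<partial>lborel) < \<infinity>"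
        using A(2)[of z] by (rule order.strict_trans1) simp
      show "Riesz_weight R s z \<in> borel_measurable lborel"
        unfolding Riesz_weight_def[abs_def] by measurable
    qed (simp add: Riesz_weight_nonneg)
    have "ennreal (LINT w|lborel. Riesz_weight R s z w) \<le> ennreal A"
      using A(2)[of z] by (subst (asm) nn_integral_eq_integral[OF int]) (auto simp: Riesz_weight_nonneg)
    then show "(LINT w|lborel. Riesz_weight R s z w) \<le> A"
      using A(1) by simp
  qed
  then show ?thesis using A(1) by blast
qed

lemma integral_le_dominating:
  fixes f :: "complex \<Rightarrow> 'b::{banach,second_countable_topology}"
  assumes "f \<in> borel_measurable borel" "integrable lborel W" "AE w in lborel. norm (f w) \<le> W w"
  shows "integrable lborel f" "norm (LINT w|lborel. f w) \<le> (LINT w|lborel. W w)"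
proof -
  show int: "integrable lborel f"
    using assms(3) by (intro Bochner_Integration.integrable_bound[OF assms(2)])
      (use assms(1) in \<open>auto elim!: eventually_mono intro: order.trans[OF _ abs_ge_self]\<close>)
  have "norm (LINT w|lborel. f w) \<le> (LINT w|lborel. norm (f w))" by (rule integral_norm_bound)
  also have "\<dots> \<le> (LINT w|lborel. W w)" using assms int by (intro integral_mono_AE) auto
  finally show "norm (LINT w|lborel. f w) \<le> (LINT w|lborel. W w)" .
qed

lemma bounded_density_diff:
  "bounded_density R B F \<Longrightarrow> bounded_density R B' F' \<Longrightarrow> (\<And>w. \<bar>F w - F' w\<bar> \<le> c) \<Longrightarrow>
    bounded_density R c (\<lambda>w. F w - F' w)"
  by (auto simp: bounded_density_def)

lemma bounded_density_nonneg: "bounded_density R B F \<Longrightarrow> 0 \<le> B"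
  unfolding bounded_density_def by (meson abs_ge_zero order_trans)

lemma integrable_convolution:
  fixes k :: "complex \<Rightarrow> 'b::euclidean_space"
  assumes F: "bounded_density R B F" and k: "continuous_on UNIV k"
  shows "integrable lborel (\<lambda>w. F w *\<^sub>R k (z - w))"
proof -
  have "compact (k ` cball 0 (norm z + \<bar>R\<bar>))"
    by (intro compact_continuous_image continuous_on_subset[OF k]) auto
  then obtain M where M: "\<And>v. v \<in> cball 0 (norm z + \<bar>R\<bar>) \<Longrightarrow> norm (k v) \<le> M"
    using compact_imp_bounded by (force simp: bounded_iff)
  have [measurable]: "k \<in> borel_measurable borel" "F \<in> borel_measurable borel"
    using k F by (auto simp: bounded_density_def intro: borel_measurable_continuous_onI)
  have "norm (F w *\<^sub>R k (z - w)) \<le> B * M * indicator (ball 0 R) w" for w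
  proof (cases "w \<in> ball 0 R")
    case True
    have "norm (z - w) \<le> norm z + \<bar>R\<bar>" using True norm_triangle_ineq4[of z w] by simp
    then have "norm (k (z - w)) \<le> M" by (intro M) simp
    then show ?thesis using True F by (auto simp: bounded_density_def intro!: mult_mono)
  qed (use F in \<open>auto simp: bounded_density_def\<close>)
  note bd = this
  show ?thesis
  proof (rule integral_le_dominating(1))
    show "(\<lambda>w. F w *\<^sub>R k (z - w)) \<in> borel_measurable borel" by measurable
    show "integrable lborel (\<lambda>w. B * M * indicator (ball (0::complex) R) w)"
      using emeasure_lborel_ball_finite[of "0::complex" R] by simp
    show "AE w in lborel. norm (F w *\<^sub>R k (z - w)) \<le> B * M * indicator (ball 0 R) w"
      by (intro AE_I2 bd)
  qed
qed

text \<open>As \<open>F\<close> vanishes off a ball, all arguments of the kernel stay in a compact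
  set. Uniform continuity of \<open>g\<close> there makes the first-order remainder of
  \<open>k\<close> small uniformly in \<open>w\<close>.\<close>

lemma GDERIV_convolution:
  fixes k :: "complex \<Rightarrow> real"
  assumes F: "bounded_density R B F" and k: "\<And>x. GDERIV k x :> g x" and g: "continuous_on UNIV g"
  shows "GDERIV (\<lambda>z. LINT w|lborel. F w * k (z - w)) z :> (LINT w|lborel. F w *\<^sub>R g (z - w))"
proof -
  have contk: "continuous_on UNIV k"
    using k by (auto simp: gderiv_def intro!: continuous_at_imp_continuous_on has_derivative_continuous)
  have ik: "integrable lborel (\<lambda>w. F w * k (y - w))" for y
    using integrable_convolution[OF F contk, of y] by simp
  have ig: "integrable lborel (\<lambda>w. F w *\<^sub>R g (z - w))" by (rule integrable_convolution[OF F g])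
  have B: "0 \<le> B" by (rule bounded_density_nonneg[OF F])
  define G where "G = (LINT w|lborel. F w *\<^sub>R g (z - w))"
  define m where "m = measure lborel (ball (0::complex) R)"
  show ?thesis
    unfolding gderiv_def has_derivative_at_alt
  proof (intro conjI allI impI)
    fix e :: real assume "0 < e"
    \<comment> \<open>The remainder is integrated over a ball of measure \<open>m\<close> with
      weight at most \<open>B\<close>; the \<open>+ 1\<close> provides for
      \<open>B * m = 0\<close>.\<close>
    define e' where "e' = e / (B * m + 1)"
    have "0 \<le> B * m" using B by (simp add: m_def)
    then have e': "0 < e'" "e' * (B * m) \<le> e" using \<open>0 < e\<close> by (auto simp: e'_def field_simps)
    \<comment> \<open>Large enough for all points within distance 1 of \<open>z - w\<close> with
      \<open>w \<in> ball 0 R\<close>.\<close>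
    define T where "T = norm z + \<bar>R\<bar> + 1"
    have "uniformly_continuous_on (cball 0 T) g"
      by (intro compact_uniformly_continuous continuous_on_subset[OF g]) auto
    then obtain d0 where d0: "0 < d0" "\<And>x y. x \<in> cball 0 T \<Longrightarrow> y \<in> cball 0 T \<Longrightarrow> dist y x < d0 \<Longrightarrow> dist (g y) (g x) < e'"
      using e'(1) unfolding uniformly_continuous_on_def by metis
    define d where "d = min d0 1"
    have d: "0 < d" "d \<le> d0" "d \<le> 1" using d0 by (auto simp: d_def)
    show "\<exists>d>0. \<forall>y. norm (y - z) < d \<longrightarrow> norm ((LINT w|lborel. F w * k (y - w)) - (LINT w|lborel. F w * k (z - w))
        - (y - z) \<bullet> (LINT w|lborel. F w *\<^sub>R g (z - w))) \<le> e * norm (y - z)"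
    proof (intro exI[of _ d] conjI allI impI d)
      fix y assume y: "norm (y - z) < d"
      have pt: "\<bar>k (y - w) - k (z - w) - (y - z) \<bullet> g (z - w)\<bar> \<le> norm (y - z) * e'" if w: "w \<in> ball 0 R" for w
      proof -
        have in_T: "x \<in> cball 0 T" if "x \<in> ball (z - w) d" for x
        proof -
          have "norm x \<le> norm (z - w) + norm (x - (z - w))" using norm_triangle_ineq[of "z - w" "x - (z - w)"] by simp
          also have "norm (z - w) \<le> norm z + norm w" by (rule norm_triangle_ineq4)
          finally show ?thesis using that w d by (simp add: T_def dist_norm norm_minus_commute)
        qed
        have "norm (k (y - w) - k (z - w) - ((y - w) - (z - w)) \<bullet> g (z - w)) \<le> norm ((y - w) - (z - w)) * e'"
        proof (rule differentiable_bound_linearization[where S = "ball (z - w) d" and f' = "\<lambda>x h. h \<bullet> g x"])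
          fix t :: real assume t: "t \<in> {0..1}"
          have "norm (t *\<^sub>R (y - z)) \<le> norm (y - z)" using t by (simp add: mult_left_le_one_le)
          then show "z - w + t *\<^sub>R (y - w - (z - w)) \<in> ball (z - w) d"
            using y by (simp add: dist_norm)
        next
          fix x assume x: "x \<in> ball (z - w) d"
          show "(k has_derivative (\<lambda>h. h \<bullet> g x)) (at x within ball (z - w) d)"
            using k[of x] by (auto simp: gderiv_def intro: has_derivative_at_withinI)
          have "dist (g x) (g (z - w)) < e'"
            using x d by (intro d0 in_T) (auto simp: dist_commute)
          then have "norm (g x - g (z - w)) \<le> e'" by (simp add: dist_norm)
          then show "onorm ((\<lambda>h. h \<bullet> g x) - (\<lambda>h. h \<bullet> g (z - w))) \<le> e'"
            unfolding fun_diff_def inner_diff_right[symmetric]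
            by (intro onorm_le) (metis Cauchy_Schwarz_ineq2 mult.commute mult_left_mono norm_ge_zero order_trans real_norm_def)
        qed (use d in auto)
        then show ?thesis by simp
      qed
      have "(LINT w|lborel. F w * k (y - w)) - (LINT w|lborel. F w * k (z - w)) - (y - z) \<bullet> G
          = (LINT w|lborel. F w * (k (y - w) - k (z - w) - (y - z) \<bullet> g (z - w)))"
      proof -
        have "(y - z) \<bullet> G = (LINT w|lborel. F w * ((y - z) \<bullet> g (z - w)))"
          unfolding G_def using ig by (subst integral_inner_right[symmetric]) auto
        moreover have "integrable lborel (\<lambda>w. F w * ((y - z) \<bullet> g (z - w)))"
          using integrable_inner_right[OF ig, of "y - z"] by simp
        ultimately show ?thesis using ik
          by (simp add: right_diff_distrib)
      qed
      also have "norm \<dots> \<le> (LINT w|lborel. B * (norm (y - z) * e') * indicator (ball (0::complex) R) w)"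
      proof (rule integral_le_dominating(2))
        have [measurable]: "k \<in> borel_measurable borel" "g \<in> borel_measurable borel" "F \<in> borel_measurable borel"
          using contk g F by (auto simp: bounded_density_def intro: borel_measurable_continuous_onI)
        show "(\<lambda>w. F w * (k (y - w) - k (z - w) - (y - z) \<bullet> g (z - w))) \<in> borel_measurable borel" by measurable
        show "integrable lborel (\<lambda>w. B * (norm (y - z) * e') * indicator (ball (0::complex) R) w)"
          using emeasure_lborel_ball_finite[of "0::complex" R] by simp
        have "norm (F w * (k (y - w) - k (z - w) - (y - z) \<bullet> g (z - w))) \<le> B * (norm (y - z) * e') * indicator (ball 0 R) w" for w
        proof (cases "w \<in> ball 0 R")
          case True
          then show ?thesis using pt[OF True] F B e'(1)
            unfolding norm_mult by (auto simp: bounded_density_def intro!: mult_mono)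
        qed (use F in \<open>auto simp: bounded_density_def\<close>)
        then show "AE w in lborel. norm (F w * (k (y - w) - k (z - w) - (y - z) \<bullet> g (z - w)))
            \<le> B * (norm (y - z) * e') * indicator (ball 0 R) w" by (rule AE_I2)
      qed
      also have "\<dots> = e' * (B * m) * norm (y - z)"
        using emeasure_lborel_ball_finite[of "0::complex" R] by (simp add: m_def mult_ac)
      also have "\<dots> \<le> e * norm (y - z)" using e'(2) by (intro mult_right_mono) auto
      finally show "norm ((LINT w|lborel. F w * k (y - w)) - (LINT w|lborel. F w * k (z - w))
          - (y - z) \<bullet> (LINT w|lborel. F w *\<^sub>R g (z - w))) \<le> e * norm (y - z)"
        unfolding G_def .
    qed
  qed (rule bounded_linear_inner_left)
qed

text \<open>The kernel is \<open>ln (\<bar>v\<bar>\<^sup>2 + e\<^sup>2)\<close> up to a constant; \<open>e > 0\<close> smooths the logarithmic kernel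
  \<open>e = 0\<close>. Its Laplacian is a multiple of \<open>e\<^sup>2 / (\<bar>v\<bar>\<^sup>2 + e\<^sup>2)\<^sup>2\<close>, an approximate identity, and the constant is
  fixed by the total mass of that profile (which is \<open>\<pi>\<close>, but this is never needed).\<close>

definition newton_const :: real where
  "newton_const = 1 / (4 * (LINT v|lborel. 1 / (1 + (norm (v::complex))\<^sup>2)\<^sup>2))"

definition log_kernel :: "real \<Rightarrow> complex \<Rightarrow> real" where
  "log_kernel e v = newton_const * ln ((norm v)\<^sup>2 + e\<^sup>2)"

definition log_kernel_grad :: "real \<Rightarrow> complex \<Rightarrow> complex" where
  "log_kernel_grad e v = (2 * newton_const / ((norm v)\<^sup>2 + e\<^sup>2)) *\<^sub>R v"

definition newton :: "real \<Rightarrow> (complex \<Rightarrow> real) \<Rightarrow> complex \<Rightarrow> real" where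
  "newton e F z = (LINT w|lborel. F w * log_kernel e (z - w))"

definition newton_grad :: "real \<Rightarrow> (complex \<Rightarrow> real) \<Rightarrow> complex \<Rightarrow> complex" where
  "newton_grad e F z = (LINT w|lborel. F w *\<^sub>R log_kernel_grad e (z - w))"

lemma newton_const_pos: "0 < newton_const"
proof -
  have "(LINT v|lborel. 1/4 * indicator (ball (0::complex) 1) v) \<le> (LINT v|lborel. 1 / (1 + (norm (v::complex))\<^sup>2)\<^sup>2)"
  proof (rule integral_mono)
    show "integrable lborel (\<lambda>v. 1/4 * indicator (ball (0::complex) 1) v :: real)"
      using emeasure_lborel_ball_finite[of "0::complex" 1] by simp
    fix v :: complex
    show "1/4 * indicator (ball (0::complex) 1) v \<le> 1 / (1 + (norm v)\<^sup>2)\<^sup>2"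
    proof (cases "v \<in> ball 0 1")
      case True
      then have "(norm v)\<^sup>2 \<le> 1" by (simp add: power_le_one)
      then have "(1 + (norm v)\<^sup>2)\<^sup>2 \<le> 2\<^sup>2" by (intro power_mono) auto
      then have "1 / 2\<^sup>2 \<le> 1 / (1 + (norm v)\<^sup>2)\<^sup>2" by (intro frac_le zero_less_power add_pos_nonneg) auto
      then show ?thesis using True by simp
    qed simp
  qed (rule integrable_Poisson_profile)
  moreover have "(LINT v|lborel. 1/4 * indicator (ball (0::complex) 1) v) = (pi / 4 :: real)"
    using emeasure_ball_complex[of 1 0] by (simp add: measure_def)
  ultimately have "0 < (LINT v|lborel. 1 / (1 + (norm (v::complex))\<^sup>2)\<^sup>2)"
    using pi_gt_zero by linarith
  then show ?thesis by (simp add: newton_const_def)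
qed

section \<open>Pointwise estimates of the kernels\<close>

text \<open>The logarithm is estimated crudely by \<open>1 / norm v\<close>, so that the same weight
  serves for kernel and gradient. With \<open>t = norm v\<close>, \<open>ln y \<le> y - 1\<close>
  and \<open>e \<le> 1\<close> give the upper bound \<open>t ^ 2 \<le> T ^ 3 / t\<close>, while
  \<open>y \<ge> t ^ 2\<close> gives the lower bound.\<close>

lemma log_kernel_bound:
  assumes e: "0 \<le> e" "e \<le> 1" and v: "v \<noteq> 0" "norm v \<le> T"
  shows "\<bar>log_kernel e v\<bar> \<le> newton_const * (T ^ 3 + 2) * norm v powr (-1)"
proof -
  define t where "t = norm v"
  have t: "0 < t" "t \<le> T" using v by (auto simp: t_def)
  define y where "y = t\<^sup>2 + e\<^sup>2"
  have y: "0 < y" "t\<^sup>2 \<le> y" using t by (auto simp: y_def add_pos_nonneg)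
  have "e\<^sup>2 \<le> 1" using e by (simp add: power_le_one)
  then have "ln y \<le> t\<^sup>2" using ln_le_minus_one[OF y(1)] by (simp add: y_def)
  also have "t\<^sup>2 \<le> T ^ 3 / t"
  proof -
    have "t\<^sup>2 * t = t ^ 3" by (simp add: eval_nat_numeral)
    also have "\<dots> \<le> T ^ 3" using t by (intro power_mono) auto
    finally show ?thesis using t by (simp add: pos_le_divide_eq)
  qed
  finally have up: "ln y \<le> T ^ 3 / t" .
  have "- ln t \<le> 1 / t" using ln_le_minus_one[of "1 / t"] t by (simp add: ln_div)
  moreover have "2 * ln t \<le> ln y"
    using ln_le_cancel_iff[of "t\<^sup>2" y] y t by (simp add: ln_realpow)
  ultimately have lo: "- ln y \<le> 2 / t" by simp
  have "0 \<le> T ^ 3 / t" "0 \<le> 2 / t" using t by auto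
  then have "\<bar>ln y\<bar> \<le> T ^ 3 / t + 2 / t" using up lo by linarith
  also have "\<dots> = (T ^ 3 + 2) * t powr (-1)" using t by (simp add: powr_minus field_simps)
  finally have "newton_const * \<bar>ln y\<bar> \<le> newton_const * ((T ^ 3 + 2) * t powr (-1))"
    using newton_const_pos by (intro mult_left_mono) auto
  then show ?thesis
    using newton_const_pos by (simp add: log_kernel_def abs_mult y_def t_def mult.assoc)
qed

lemma log_kernel_grad_bound: "norm (log_kernel_grad e v) \<le> 2 * newton_const * norm v powr (-1)"
proof (cases "v = 0")
  case False
  have "norm v / ((norm v)\<^sup>2 + e\<^sup>2) \<le> norm v / (norm v)\<^sup>2"
    using False by (intro divide_left_mono) (auto intro!: mult_pos_pos add_pos_nonneg)
  also have "\<dots> = norm v powr (-1)" using False by (simp add: powr_minus power2_eq_square field_simps)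
  finally have "2 * newton_const * (norm v / ((norm v)\<^sup>2 + e\<^sup>2)) \<le> 2 * newton_const * norm v powr (-1)"
    using newton_const_pos by (intro mult_left_mono) auto
  moreover have "norm (log_kernel_grad e v) = 2 * newton_const * (norm v / ((norm v)\<^sup>2 + e\<^sup>2))"
    using newton_const_pos by (simp add: log_kernel_grad_def)
  ultimately show ?thesis by simp
qed (simp add: log_kernel_grad_def)

text \<open>A compromise of exponents: the factor \<open>sqrt e\<close> is bought by raising the
  singularity from order 1 to order \<open>3/2\<close>, which is still integrable in the
  plane.\<close>

lemma log_kernel_grad_diff:
  assumes "0 < e"
  shows "norm (log_kernel_grad e v - log_kernel_grad 0 v) \<le> 2 * newton_const * sqrt e * norm v powr (-(3/2))"
proof (cases "v = 0")
  case False
  define t where "t = norm v"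
  have t: "0 < t" using False by (simp add: t_def)
  have "t / (t\<^sup>2 + e\<^sup>2) * (e\<^sup>2 / t\<^sup>2) \<le> sqrt e * t powr (-(3/2))"
  proof -
    \<comment> \<open>Square roots make all exponents integers, and the claim becomes
      \<open>x * y ^ 3 \<le> x ^ 4 + y ^ 4\<close>.\<close>
    define x where "x = sqrt t"
    define y where "y = sqrt e"
    have xy: "0 < x" "0 < y" "t = x\<^sup>2" "e = y\<^sup>2" using t assms by (auto simp: x_def y_def)
    have "t powr (-(3/2)) = inverse (x ^ 3)"
    proof -
      have "t powr (1/2) = x" using t by (simp add: x_def powr_half_sqrt)
      moreover have "x powr 3 = x ^ 3" using xy(1) by simp
      moreover have "t powr (3/2) = (t powr (1/2)) powr 3" by (simp add: powr_powr)
      ultimately show ?thesis by (simp only: powr_minus)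
    qed
    note tx = this
    have "x * y ^ 3 \<le> x ^ 4 + y ^ 4"
    proof (cases "x \<le> y")
      case True
      then have "x * y ^ 3 \<le> y * y ^ 3" using xy by (intro mult_right_mono) auto
      also have "\<dots> = y ^ 4" by (simp add: eval_nat_numeral)
      finally show ?thesis using xy by (simp add: add_increasing)
    next
      case False
      then have "x * y ^ 3 \<le> x * x ^ 3" using xy by (intro mult_left_mono power_mono) auto
      also have "\<dots> = x ^ 4" by (simp add: eval_nat_numeral)
      finally show ?thesis using xy by (simp add: add_increasing2)
    qed
    then have "x * y ^ 3 / ((x ^ 4 + y ^ 4) * x ^ 3) * y \<le> 1 / x ^ 3 * y"
    proof (intro mult_right_mono)
      have p: "0 < x ^ 4 + y ^ 4" using xy by (simp add: add_pos_pos)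
      assume le: "x * y ^ 3 \<le> x ^ 4 + y ^ 4"
      have "x * y ^ 3 / ((x ^ 4 + y ^ 4) * x ^ 3) \<le> (x ^ 4 + y ^ 4) / ((x ^ 4 + y ^ 4) * x ^ 3)"
        using le p xy by (intro divide_right_mono) auto
      also have "\<dots> = 1 / x ^ 3" using p by simp
      finally show "x * y ^ 3 / ((x ^ 4 + y ^ 4) * x ^ 3) \<le> 1 / x ^ 3" .
    qed (use xy in auto)
    moreover have eq: "t / (t\<^sup>2 + e\<^sup>2) * (e\<^sup>2 / t\<^sup>2) = x * y ^ 3 / ((x ^ 4 + y ^ 4) * x ^ 3) * y"
    proof -
      have "t / (t\<^sup>2 + e\<^sup>2) * (e\<^sup>2 / t\<^sup>2) = x\<^sup>2 * y ^ 4 / ((x ^ 4 + y ^ 4) * x ^ 4)"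
        by (simp add: xy(3,4) power_mult[symmetric])
      also have "\<dots> = (x * (x * y ^ 3 * y)) / (x * ((x ^ 4 + y ^ 4) * x ^ 3))"
        by (intro arg_cong2[where f = "(/)"]) (simp_all add: eval_nat_numeral algebra_simps)
      also have "\<dots> = x * y ^ 3 / ((x ^ 4 + y ^ 4) * x ^ 3) * y" using xy by simp
      finally show ?thesis .
    qed
    ultimately have "t / (t\<^sup>2 + e\<^sup>2) * (e\<^sup>2 / t\<^sup>2) \<le> 1 / x ^ 3 * y" by (simp only: eq)
    also have "\<dots> = sqrt e * t powr (-(3/2))" unfolding tx y_def by (simp add: inverse_eq_divide)
    finally show ?thesis .
  qed
  then have "2 * newton_const * (t / (t\<^sup>2 + e\<^sup>2) * (e\<^sup>2 / t\<^sup>2)) \<le> 2 * newton_const * (sqrt e * t powr (-(3/2)))"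
    using newton_const_pos by (intro mult_left_mono) auto
  moreover have "norm (log_kernel_grad e v - log_kernel_grad 0 v) = 2 * newton_const * (t / (t\<^sup>2 + e\<^sup>2) * (e\<^sup>2 / t\<^sup>2))"
  proof -
    have "1 / (t\<^sup>2 + e\<^sup>2) - 1 / t\<^sup>2 = - (1 / (t\<^sup>2 + e\<^sup>2) * (e\<^sup>2 / t\<^sup>2))"
      using t assms by (simp add: field_simps add_pos_pos)
    moreover have "log_kernel_grad e v - log_kernel_grad 0 v = (2 * newton_const * (1 / (t\<^sup>2 + e\<^sup>2) - 1 / t\<^sup>2)) *\<^sub>R v"
      by (simp add: log_kernel_grad_def t_def scaleR_diff_left[symmetric] right_diff_distrib)
    ultimately show ?thesis
      using newton_const_pos t by (simp add: t_def abs_mult)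
  qed
  ultimately show ?thesis by (simp add: t_def mult.assoc)
qed (simp add: log_kernel_grad_def)

text \<open>The kernel is a multiple of \<open>1 / cnj v\<close>, so the difference has modulus
  \<open>norm (v - v') / (norm v * norm v')\<close> up to a constant. Splitting off
  \<open>norm (v - v') powr \<alpha>\<close> and bounding the remaining power by the larger of the
  two norms leaves a singularity of order \<open>1 + \<alpha>\<close>.\<close>

lemma log_kernel_grad_holder:
  assumes \<alpha>: "0 < \<alpha>" "\<alpha> < 1" and v: "v \<noteq> 0" "v' \<noteq> 0"
  shows "norm (log_kernel_grad 0 v - log_kernel_grad 0 v')
    \<le> 4 * newton_const * norm (v - v') powr \<alpha> * (norm v powr (- (1 + \<alpha>)) + norm v' powr (- (1 + \<alpha>)))"
proof -
  define d where "d = norm (v - v')"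
  have rep: "log_kernel_grad 0 v = of_real (2 * newton_const) * (1 / cnj v)" if "v \<noteq> 0" for v
    using that complex_norm_square[of v] by (simp add: log_kernel_grad_def scaleR_conv_of_real field_simps)
  have "log_kernel_grad 0 v - log_kernel_grad 0 v' = of_real (2 * newton_const) * (cnj (v' - v) / (cnj v * cnj v'))"
    using v by (simp add: rep field_simps)
  then have eq: "norm (log_kernel_grad 0 v - log_kernel_grad 0 v') = 2 * newton_const * (d / (norm v * norm v'))"
    using newton_const_pos by (simp add: norm_mult norm_divide d_def norm_minus_commute flip: complex_cnj_diff)
  \<comment> \<open>Here \<open>a\<close> is the larger and \<open>b\<close> the smaller of the two
    norms, so \<open>d \<le> 2 * a\<close>.\<close>
  have key: "d / (a * b) \<le> d powr \<alpha> * (2 * b powr (- (1 + \<alpha>)))" if ab: "0 < b" "b \<le> a" "d \<le> a + b" for a b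
  proof (cases "d = 0")
    case False
    then have d: "0 < d" by (simp add: d_def)
    have "d powr (1 - \<alpha>) \<le> (2 * a) powr (1 - \<alpha>)" using ab d \<alpha> by (intro powr_mono2) auto
    also have "\<dots> = 2 powr (1 - \<alpha>) * a powr (1 - \<alpha>)" using ab by (simp add: powr_mult)
    also have "2 powr (1 - \<alpha>) \<le> 2 powr (1::real)" using \<alpha> by (intro powr_mono) auto
    finally have 1: "d powr (1 - \<alpha>) \<le> 2 * a powr (1 - \<alpha>)" by (simp add: mult_right_mono)
    have 2: "a powr (- \<alpha>) \<le> b powr (- \<alpha>)" using ab \<alpha> by (intro powr_mono2') auto
    have "d / (a * b) = d powr \<alpha> * (d powr (1 - \<alpha>) / (a * b))"
      using d by (simp add: powr_diff)
    also have "\<dots> \<le> d powr \<alpha> * (2 * a powr (1 - \<alpha>) / (a * b))"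
      using 1 ab by (intro mult_left_mono divide_right_mono) auto
    also have "2 * a powr (1 - \<alpha>) / (a * b) = 2 * a powr (- \<alpha>) / b"
      using ab by (simp add: powr_diff powr_minus field_simps)
    also have "d powr \<alpha> * (2 * a powr (- \<alpha>) / b) \<le> d powr \<alpha> * (2 * b powr (- \<alpha>) / b)"
      using 2 ab by (intro mult_left_mono divide_right_mono) auto
    also have "b powr (- \<alpha>) / b = b powr (- (1 + \<alpha>))"
      using ab by (simp add: powr_diff powr_minus powr_add field_simps)
    then have "2 * b powr (- \<alpha>) / b = 2 * b powr (- (1 + \<alpha>))" by (metis times_divide_eq_right)
    finally show ?thesis .
  qed simp
  have tri: "d \<le> norm v + norm v'" unfolding d_def by (rule norm_triangle_ineq4)
  have "d / (norm v * norm v') \<le> d powr \<alpha> * (2 * (norm v powr (- (1 + \<alpha>)) + norm v' powr (- (1 + \<alpha>))))"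
  proof (cases "norm v' \<le> norm v")
    case True
    have "d / (norm v * norm v') \<le> d powr \<alpha> * (2 * norm v' powr (- (1 + \<alpha>)))"
      using key[of "norm v'" "norm v"] True tri v by simp
    also have "\<dots> \<le> d powr \<alpha> * (2 * (norm v powr (- (1 + \<alpha>)) + norm v' powr (- (1 + \<alpha>))))"
      by (intro mult_left_mono) auto
    finally show ?thesis .
  next
    case False
    have "d / (norm v * norm v') \<le> d powr \<alpha> * (2 * norm v powr (- (1 + \<alpha>)))"
      using key[of "norm v" "norm v'"] False tri v by (simp add: mult.commute add.commute)
    also have "\<dots> \<le> d powr \<alpha> * (2 * (norm v powr (- (1 + \<alpha>)) + norm v' powr (- (1 + \<alpha>))))"
      by (intro mult_left_mono) auto
    finally show ?thesis .
  qed
  then have "2 * newton_const * (d / (norm v * norm v'))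
      \<le> 2 * newton_const * (d powr \<alpha> * (2 * (norm v powr (- (1 + \<alpha>)) + norm v' powr (- (1 + \<alpha>)))))"
    using newton_const_pos by (intro mult_left_mono) auto
  then show ?thesis unfolding eq by (simp add: d_def algebra_simps)
qed

lemma log_kernel_measurable [measurable]: "log_kernel e \<in> borel_measurable borel"
  unfolding log_kernel_def[abs_def] by measurable

lemma log_kernel_grad_measurable [measurable]: "log_kernel_grad e \<in> borel_measurable borel"
  unfolding log_kernel_grad_def[abs_def] by measurable

lemma GDERIV_log_kernel:
  assumes "0 < e"
  shows "GDERIV (log_kernel e) v :> log_kernel_grad e v"
proof -
  have pos: "0 < (norm v)\<^sup>2 + e\<^sup>2" for v :: complex using assms by (simp add: add_nonneg_pos)
  have "((\<lambda>v. newton_const * ln (v \<bullet> v + e\<^sup>2)) has_derivative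
      (\<lambda>h. newton_const * ((h \<bullet> v + v \<bullet> h) * inverse (v \<bullet> v + e\<^sup>2)))) (at v)"
    using pos[of v] by (auto intro!: derivative_eq_intros simp: power2_norm_eq_inner)
  moreover have "(\<lambda>h. newton_const * ((h \<bullet> v + v \<bullet> h) * inverse (v \<bullet> v + e\<^sup>2))) = (\<lambda>h. h \<bullet> log_kernel_grad e v)"
    by (auto simp: log_kernel_grad_def power2_norm_eq_inner inner_commute divide_inverse)
  ultimately show ?thesis
    by (simp add: gderiv_def log_kernel_def[abs_def] power2_norm_eq_inner)
qed

lemma continuous_log_kernel_grad: "0 < e \<Longrightarrow> continuous_on UNIV (log_kernel_grad e)"
  unfolding log_kernel_grad_def by (auto intro!: continuous_intros simp: add_nonneg_eq_0_iff)

section \<open>Smooth functions and cutoffs\<close>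

lemma GDERIV_unique:
  fixes f :: "'a::euclidean_space \<Rightarrow> real"
  assumes "GDERIV f x :> g" "GDERIV f x :> g'"
  shows "g = g'"
  using has_derivative_unique[OF assms[unfolded gderiv_def]]
  by (metis inner_commute vector_eq_ldot)

lemma GDERIV_frechet:
  assumes "GDERIV f x :> g"
  shows "f differentiable (at x)" "frechet_derivative f (at x) b = b \<bullet> g"
  using assms frechet_derivative_at[of f "\<lambda>h. h \<bullet> g" x] unfolding gderiv_def
  by (auto simp: differentiable_def) metis

text \<open>Trades the description operator in \<open>frechet_derivative\<close> for an explicit
  gradient, so that the calculus rules for \<open>GDERIV\<close> drive the inductions below.\<close>

lemma C_k_Suc_GDERIV:
  fixes f :: "'a::euclidean_space \<Rightarrow> real"
  shows "C_k (Suc k) f \<longleftrightarrow> (\<exists>g. (\<forall>x. GDERIV f x :> g x) \<and> (\<forall>b\<in>Basis. C_k k (\<lambda>x. b \<bullet> g x)))"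
proof
  assume C: "C_k (Suc k) f"
  define g where "g x = (\<Sum>b\<in>Basis. frechet_derivative f (at x) b *\<^sub>R b)" for x
  have "GDERIV f x :> g x" for x
  proof -
    have d: "(f has_derivative frechet_derivative f (at x)) (at x)"
      using C by (simp add: frechet_derivative_works)
    then interpret bounded_linear "frechet_derivative f (at x)" by (rule has_derivative_bounded_linear)
    have "frechet_derivative f (at x) h = h \<bullet> g x" for h
    proof -
      have "frechet_derivative f (at x) h = frechet_derivative f (at x) (\<Sum>b\<in>Basis. (h \<bullet> b) *\<^sub>R b)"
        by (simp add: euclidean_representation)
      also have "\<dots> = h \<bullet> g x" unfolding sum by (simp add: g_def scaleR inner_sum_right mult.commute)
      finally show ?thesis .
    qed
    then have "frechet_derivative f (at x) = (\<lambda>h. h \<bullet> g x)" by auto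
    then show ?thesis using d by (simp add: gderiv_def)
  qed
  moreover have "b \<bullet> g x = frechet_derivative f (at x) b" for b x
    using GDERIV_frechet(2)[OF \<open>GDERIV f x :> g x\<close>] by simp
  ultimately show "\<exists>g. (\<forall>x. GDERIV f x :> g x) \<and> (\<forall>b\<in>Basis. C_k k (\<lambda>x. b \<bullet> g x))"
    using C by (intro exI[of _ g]) simp
next
  assume "\<exists>g. (\<forall>x. GDERIV f x :> g x) \<and> (\<forall>b\<in>Basis. C_k k (\<lambda>x. b \<bullet> g x))"
  then obtain g where g: "\<And>x. GDERIV f x :> g x" "\<And>b. b \<in> Basis \<Longrightarrow> C_k k (\<lambda>x. b \<bullet> g x)" by blast
  then show "C_k (Suc k) f" using GDERIV_frechet[OF g(1)] by simp
qed

declare C_k.simps(2) [simp del]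

lemma C_k_SucI:
  fixes f :: "'a::euclidean_space \<Rightarrow> real"
  assumes "\<And>x. GDERIV f x :> g x" "\<And>b. b \<in> Basis \<Longrightarrow> C_k k (\<lambda>x. b \<bullet> g x)"
  shows "C_k (Suc k) f"
  using assms C_k_Suc_GDERIV by blast

lemma C_k_SucE:
  fixes f :: "'a::euclidean_space \<Rightarrow> real"
  assumes "C_k (Suc k) f"
  obtains g where "\<And>x. GDERIV f x :> g x" "\<And>b. b \<in> Basis \<Longrightarrow> C_k k (\<lambda>x. b \<bullet> g x)"
  using assms C_k_Suc_GDERIV by blast

lemma C_k_imp_continuous:
  fixes f :: "'a::euclidean_space \<Rightarrow> real"
  assumes "C_k k f" shows "continuous_on UNIV f"
proof (cases k)
  case (Suc m)
  then obtain g where "\<And>x. GDERIV f x :> g x" using assms C_k_SucE by blast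
  then show ?thesis
    by (auto simp: gderiv_def intro!: continuous_at_imp_continuous_on has_derivative_continuous)
qed (use assms in auto)

lemma C_k_Suc_imp: "C_k (Suc k) f \<Longrightarrow> C_k k (f :: 'a::euclidean_space \<Rightarrow> real)"
proof (induction k arbitrary: f)
  case 0
  then show ?case using C_k_imp_continuous[of "Suc 0"] by auto
next
  case (Suc k)
  then obtain g where "\<And>x. GDERIV f x :> g x" "\<And>b. b \<in> Basis \<Longrightarrow> C_k (Suc k) (\<lambda>x. b \<bullet> g x)"
    using C_k_SucE by blast
  then show ?case using Suc.IH by (intro C_k_SucI) auto
qed

lemma C_k_const [simp]: "C_k k (\<lambda>x::'a::euclidean_space. c)"
proof (induction k arbitrary: c)
  case (Suc k)
  show ?case by (rule C_k_SucI[where g = "\<lambda>x. 0"]) (auto simp: Suc GDERIV_const)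
qed simp

lemma C_k_inner [simp]: "C_k k (\<lambda>x::'a::euclidean_space. x \<bullet> b)"
proof (cases k)
  case (Suc k)
  show ?thesis unfolding Suc
    by (rule C_k_SucI[where g = "\<lambda>x. b"]) (auto simp: gderiv_def intro!: derivative_eq_intros)
qed (auto intro!: continuous_intros)

lemma C_k_add:
  fixes f g :: "'a::euclidean_space \<Rightarrow> real"
  shows "C_k k f \<Longrightarrow> C_k k g \<Longrightarrow> C_k k (\<lambda>x. f x + g x)"
proof (induction k arbitrary: f g)
  case (Suc k)
  obtain f' g' where "\<And>x. GDERIV f x :> f' x" "\<And>b. b \<in> Basis \<Longrightarrow> C_k k (\<lambda>x. b \<bullet> f' x)"
    "\<And>x. GDERIV g x :> g' x" "\<And>b. b \<in> Basis \<Longrightarrow> C_k k (\<lambda>x. b \<bullet> g' x)"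
    using Suc.prems C_k_SucE by metis
  then show ?case
    by (intro C_k_SucI[where g = "\<lambda>x. f' x + g' x"] GDERIV_add) (auto simp: inner_add_right Suc.IH)
qed (auto intro!: continuous_intros)

lemma C_k_sum:
  fixes f :: "'i \<Rightarrow> 'a::euclidean_space \<Rightarrow> real"
  assumes "\<And>i. i \<in> I \<Longrightarrow> C_k k (f i)"
  shows "C_k k (\<lambda>x. \<Sum>i\<in>I. f i x)"
  using assms by (induction I rule: infinite_finite_induct) (auto intro!: C_k_add)

lemma C_k_mult:
  fixes f g :: "'a::euclidean_space \<Rightarrow> real"
  shows "C_k k f \<Longrightarrow> C_k k g \<Longrightarrow> C_k k (\<lambda>x. f x * g x)"
proof (induction k arbitrary: f g)
  case (Suc k)
  obtain f' g' where *: "\<And>x. GDERIV f x :> f' x" "\<And>b. b \<in> Basis \<Longrightarrow> C_k k (\<lambda>x. b \<bullet> f' x)"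
    "\<And>x. GDERIV g x :> g' x" "\<And>b. b \<in> Basis \<Longrightarrow> C_k k (\<lambda>x. b \<bullet> g' x)"
    using Suc.prems C_k_SucE by metis
  have "C_k k f" "C_k k g" using Suc.prems by (auto intro: C_k_Suc_imp)
  then show ?case using *
    by (intro C_k_SucI[where g = "\<lambda>x. f x *\<^sub>R g' x + g x *\<^sub>R f' x"] GDERIV_mult)
      (auto simp: inner_add_right intro!: C_k_add Suc.IH)
qed (auto intro!: continuous_intros)

lemma C_k_cmult: "C_k k f \<Longrightarrow> C_k k (\<lambda>x::'a::euclidean_space. c * f x)"
  by (intro C_k_mult) auto

lemma C_k_inverse:
  fixes f :: "'a::euclidean_space \<Rightarrow> real"
  shows "C_k k f \<Longrightarrow> (\<And>x. f x \<noteq> 0) \<Longrightarrow> C_k k (\<lambda>x. inverse (f x))"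
proof (induction k)
  case (Suc k)
  obtain f' where *: "\<And>x. GDERIV f x :> f' x" "\<And>b. b \<in> Basis \<Longrightarrow> C_k k (\<lambda>x. b \<bullet> f' x)"
    using Suc.prems C_k_SucE by metis
  have inv: "C_k k (\<lambda>x. inverse (f x))" using Suc by (auto intro: C_k_Suc_imp)
  have "GDERIV (\<lambda>x. inverse (f x)) x :> - (inverse (f x) * inverse (f x)) *\<^sub>R f' x" for x
    using GDERIV_inverse[OF *(1) Suc.prems(2), of x] by (simp add: power2_eq_square)
  moreover have "C_k k (\<lambda>x. b \<bullet> (- (inverse (f x) * inverse (f x)) *\<^sub>R f' x))" if "b \<in> Basis" for b
  proof -
    have "C_k k (\<lambda>x. (-1) * (inverse (f x) * inverse (f x) * (b \<bullet> f' x)))"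
      by (intro C_k_mult C_k_const inv * that)
    then show ?thesis by (simp add: algebra_simps)
  qed
  ultimately show ?case by (intro C_k_SucI[where g = "\<lambda>x. - (inverse (f x) * inverse (f x)) *\<^sub>R f' x"]) auto
qed (auto intro!: continuous_intros)

lemma C_k_ln:
  fixes f :: "'a::euclidean_space \<Rightarrow> real"
  assumes f: "C_k k f" and pos: "\<And>x. 0 < f x"
  shows "C_k k (\<lambda>x. ln (f x))"
proof (cases k)
  case 0
  then show ?thesis using f pos less_imp_neq by (force intro!: continuous_intros)
next
  case (Suc m)
  obtain f' where *: "\<And>x. GDERIV f x :> f' x" "\<And>b. b \<in> Basis \<Longrightarrow> C_k m (\<lambda>x. b \<bullet> f' x)"
    using f C_k_SucE unfolding Suc by metis
  have "GDERIV (\<lambda>x. ln (f x)) x :> inverse (f x) *\<^sub>R f' x" for x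
    using GDERIV_DERIV_compose[OF *(1) DERIV_ln[OF pos]] by simp
  moreover have "C_k m (\<lambda>x. b \<bullet> (inverse (f x) *\<^sub>R f' x))" if "b \<in> Basis" for b
    using C_k_mult[OF C_k_inverse[of m f] *(2)[OF that]] f pos
    by (auto simp: Suc less_imp_neq dest!: C_k_Suc_imp) (metis less_irrefl)
  ultimately show ?thesis unfolding Suc by (intro C_k_SucI) auto
qed

text \<open>The linear span of this family is closed under differentiation.\<close>

definition flat_exp :: "nat \<Rightarrow> real \<Rightarrow> real" where
  "flat_exp n x = (if 0 < x then inverse x ^ n * exp (- inverse x) else 0)"

lemma tendsto_flat_exp_0: "(flat_exp n \<longlongrightarrow> 0) (at 0)"
proof -
  have "((\<lambda>x. inverse x ^ n * exp (- inverse x)) \<longlongrightarrow> 0) (at_right (0::real))" by real_asymp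
  then have "(flat_exp n \<longlongrightarrow> 0) (at_right 0)"
    by (rule Lim_transform_eventually) (auto simp: flat_exp_def eventually_at_right_less intro: eventually_mono[OF eventually_at_right_less])
  moreover have "(flat_exp n \<longlongrightarrow> 0) (at_left 0)"
    by (rule Lim_transform_eventually[OF tendsto_const])
      (auto simp: flat_exp_def eventually_at_left_field intro!: exI[of _ "-1"])
  ultimately show ?thesis by (simp add: filterlim_at_split)
qed

lemma DERIV_flat_exp:
  "(flat_exp n has_real_derivative flat_exp (n + 2) x - real n * flat_exp (n + 1) x) (at x)"
proof -
  consider "0 < x" | "x < 0" | "x = 0" by linarith
  then show ?thesis
  proof cases
    case 1
    have "((\<lambda>x. inverse x ^ n * exp (- inverse x)) has_real_derivative
        flat_exp (n + 2) x - real n * flat_exp (n + 1) x) (at x)"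
      using 1 by (auto intro!: derivative_eq_intros simp: flat_exp_def field_simps power2_eq_square)
        (cases n; simp add: field_simps)
    then show ?thesis
      by (rule has_field_derivative_transform_within_open[where S = "{0<..}"]) (use 1 in \<open>auto simp: flat_exp_def\<close>)
  next
    case 2
    have "((\<lambda>x. 0) has_real_derivative flat_exp (n + 2) x - real n * flat_exp (n + 1) x) (at x)"
      using 2 by (simp add: flat_exp_def)
    then show ?thesis
      by (rule has_field_derivative_transform_within_open[where S = "{..<0}"]) (use 2 in \<open>auto simp: flat_exp_def\<close>)
  next
    case 3
    \<comment> \<open>At the origin the difference quotient is the next member of the family, which
      tends to 0; at \<open>y = 0\<close> both sides are 0 by the convention for division.\<close>
    have "(flat_exp n y - flat_exp n 0) / (y - 0) = flat_exp (n + 1) y" for y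
      by (simp add: flat_exp_def divide_inverse mult_ac)
    then have "((\<lambda>y. (flat_exp n y - flat_exp n 0) / (y - 0)) \<longlongrightarrow> 0) (at 0)"
      using tendsto_flat_exp_0[of "n + 1"] by (simp del: diff_0_right)
    then show ?thesis unfolding 3 by (simp add: has_field_derivative_iff flat_exp_def)
  qed
qed

lemma C_k_flat_exp:
  fixes f :: "'a::euclidean_space \<Rightarrow> real"
  shows "C_k k f \<Longrightarrow> C_k k (\<lambda>x. flat_exp n (f x))"
proof (induction k arbitrary: n)
  case 0
  have "continuous_on UNIV (flat_exp n)"
    by (intro continuous_at_imp_continuous_on ballI DERIV_isCont[OF DERIV_flat_exp])
  then show ?case using 0 by (auto intro: continuous_on_compose2)
next
  case (Suc k)
  obtain f' where *: "\<And>x. GDERIV f x :> f' x" "\<And>b. b \<in> Basis \<Longrightarrow> C_k k (\<lambda>x. b \<bullet> f' x)"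
    using Suc.prems C_k_SucE by metis
  have f: "C_k k (\<lambda>x. flat_exp m (f x))" for m using Suc by (auto intro: C_k_Suc_imp)
  have "C_k k (\<lambda>x. b \<bullet> ((flat_exp (n + 2) (f x) - real n * flat_exp (n + 1) (f x)) *\<^sub>R f' x))"
    if "b \<in> Basis" for b
  proof -
    have "C_k k (\<lambda>x. (flat_exp (n + 2) (f x) + (- real n) * flat_exp (n + 1) (f x)) * (b \<bullet> f' x))"
      by (intro C_k_mult C_k_add C_k_const f * that)
    then show ?thesis by simp
  qed
  then show ?case
    by (intro C_k_SucI[OF GDERIV_DERIV_compose[OF *(1) DERIV_flat_exp]]) auto
qed

text \<open>A sum \<open>T\<close> of bumps over a finite cover of \<open>K\<close> is positive on
  \<open>K\<close>; composing it with a smooth step flattens it to 1 where \<open>T\<close> exceeds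
  a level \<open>m\<close>. The value 1 on an open neighbourhood, rather than on \<open>K\<close>
  alone, lets the cutoff disappear from derivatives on \<open>K\<close>.\<close>

lemma smooth_cutoff:
  fixes K :: "'a::euclidean_space set"
  assumes "compact K" "open D" "K \<subseteq> D"
  obtains \<zeta> O' where "test_function D \<zeta>" "open O'" "K \<subseteq> O'" "\<And>z. z \<in> O' \<Longrightarrow> \<zeta> z = 1" "\<And>z. 0 \<le> \<zeta> z \<and> \<zeta> z \<le> 1"
proof -
  have "\<exists>r>0. cball z r \<subseteq> D" if "z \<in> K" for z
    using assms that open_contains_cball by blast
  then obtain r where r: "\<And>z. z \<in> K \<Longrightarrow> 0 < r z \<and> cball z (r z) \<subseteq> D" by metis
  have "K \<subseteq> (\<Union>z\<in>K. ball z (r z))" using r by force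
  then obtain I where I: "I \<subseteq> K" "finite I" "K \<subseteq> (\<Union>z\<in>I. ball z (r z))"
    using compactE_image[OF assms(1), of K "\<lambda>z. ball z (r z)"] by auto
  \<comment> \<open>The squared distance is a polynomial, so smoothness at the centre of the ball is
    no issue.\<close>
  define b where "b c z = flat_exp 0 ((r c)\<^sup>2 - (z - c) \<bullet> (z - c))" for c z
  define T where "T z = (\<Sum>c\<in>I. b c z)" for z
  have bpos: "0 < b c z \<longleftrightarrow> z \<in> ball c (r c)" if "c \<in> I" for c z
  proof -
    have "0 < r c" using r I that by auto
    have "(z - c) \<bullet> (z - c) = (dist c z)\<^sup>2"
      by (subst dist_commute) (simp add: dist_norm power2_norm_eq_inner)
    then have "0 < (r c)\<^sup>2 - (z - c) \<bullet> (z - c) \<longleftrightarrow> dist c z < r c"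
      using \<open>0 < r c\<close> power_strict_mono[of "dist c z" "r c" 2] power2_le_imp_le[of "dist c z" "r c"]
      by (auto simp: not_less[symmetric]) (metis less_eq_real_def not_le power_mono)
    then show ?thesis by (auto simp: b_def flat_exp_def)
  qed
  have bnn: "0 \<le> b c z" for c z by (simp add: b_def flat_exp_def)
  have CT: "C_k k T" for k
  proof -
    have "C_k k (\<lambda>z. \<Sum>e\<in>Basis. (z \<bullet> e + - (c \<bullet> e)) * (z \<bullet> e + - (c \<bullet> e)))" for c :: 'a
      by (intro C_k_sum C_k_mult C_k_add C_k_inner C_k_const)
    then have "C_k k (\<lambda>z. (r c)\<^sup>2 + (-1) * (\<Sum>e\<in>Basis. (z \<bullet> e + - (c \<bullet> e)) * (z \<bullet> e + - (c \<bullet> e))))" for c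
      by (intro C_k_add C_k_mult C_k_const)
    moreover have "(z - c) \<bullet> (z - c) = (\<Sum>e\<in>Basis. (z \<bullet> e + - (c \<bullet> e)) * (z \<bullet> e + - (c \<bullet> e)))" for z c :: 'a
      by (subst euclidean_inner) (simp add: inner_diff_left)
    ultimately have "C_k k (\<lambda>z. (r c)\<^sup>2 - (z - c) \<bullet> (z - c))" for c by simp
    then show ?thesis unfolding T_def b_def by (intro C_k_sum C_k_flat_exp)
  qed
  have contT: "continuous_on UNIV T" using CT[of 0] by simp
  have Tnn: "0 \<le> T z" for z by (auto simp: T_def bnn sum_nonneg)
  have TK: "0 < T z" if z: "z \<in> K" for z
  proof -
    obtain c where "c \<in> I" "z \<in> ball c (r c)" using I z by auto
    then have "0 < b c z" by (simp add: bpos)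
    also have "\<dots> \<le> T z" unfolding T_def using I \<open>c \<in> I\<close> by (intro member_le_sum) (auto simp: bnn)
    finally show ?thesis .
  qed
  \<comment> \<open>Half the minimum of \<open>T\<close> on \<open>K\<close>: a strict inequality
    makes \<open>{z. m < T z}\<close> an open neighbourhood of \<open>K\<close>.\<close>
  obtain m where m: "0 < m" "\<And>z. z \<in> K \<Longrightarrow> m < T z"
  proof (cases "K = {}")
    case False
    then obtain y where "y \<in> K" "\<And>z. z \<in> K \<Longrightarrow> T y \<le> T z"
      using continuous_attains_inf[OF assms(1) _ continuous_on_subset[OF contT]] by blast
    then have "0 < T y / 2" "\<And>z. z \<in> K \<Longrightarrow> T y / 2 < T z" using TK[of y] by (simp, fastforce)
    then show thesis by (rule that)
  qed (use that[of 1] in auto)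
  \<comment> \<open>One of \<open>T z\<close> and \<open>m - T z\<close> is always positive, so the
    denominator never vanishes; the second term is 0 where \<open>T z \<ge> m\<close>.\<close>
  define q where "q z = flat_exp 0 (T z) + flat_exp 0 (m - T z)" for z
  have q: "0 < q z" for z using m(1) by (auto simp: q_def flat_exp_def intro!: add_pos_pos)
  define \<zeta> where "\<zeta> z = flat_exp 0 (T z) * inverse (q z)" for z
  have "C_k k \<zeta>" for k
  proof -
    have "C_k k (\<lambda>z. m + (-1) * T z)" by (intro C_k_add C_k_mult C_k_const CT)
    then have "C_k k q" unfolding q_def by (intro C_k_add C_k_flat_exp CT) simp
    then show ?thesis unfolding \<zeta>_def using q
      by (intro C_k_mult C_k_flat_exp CT C_k_inverse) (auto simp: less_imp_neq[symmetric])
  qed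
  moreover have zero: "\<zeta> z = 0" if "z \<notin> (\<Union>c\<in>I. cball c (r c))" for z
  proof -
    have "b c z = 0" if "c \<in> I" for c
      using bpos[OF that, of z] bnn[of c z] \<open>z \<notin> _\<close> that by (force simp: less_le)
    then have "T z = 0" by (simp add: T_def)
    then show ?thesis by (simp add: \<zeta>_def flat_exp_def)
  qed
  moreover have "compact (\<Union>c\<in>I. cball c (r c))" "(\<Union>c\<in>I. cball c (r c)) \<subseteq> D"
    using I r by (auto intro!: compact_UN)
  ultimately have "test_function D \<zeta>"
    unfolding test_function_def compact_support_in_def by (meson DiffD2 subsetD)
  moreover have "open {z. m < T z}" using contT by (intro open_Collect_less continuous_on_const)
  moreover have "\<zeta> z = 1" if "z \<in> {z. m < T z}" for z
    using that m(1) q[of z] by (simp add: \<zeta>_def q_def flat_exp_def)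
  moreover have "0 \<le> \<zeta> z \<and> \<zeta> z \<le> 1" for z
  proof -
    have "0 \<le> flat_exp 0 (T z)" "flat_exp 0 (T z) \<le> q z" by (auto simp: q_def flat_exp_def)
    then show ?thesis using q[of z] by (simp add: \<zeta>_def field_simps)
  qed
  ultimately show thesis using that[of \<zeta> "{z. m < T z}"] m(2) by blast
qed

section \<open>Uniform estimates for potentials of bounded densities\<close>

text \<open>\<open>A\<close> is fixed before the density, and the bound is linear in
  \<open>B\<close>. The estimate thus applies to differences of densities and yields continuity of
  the potential in the density.\<close>

lemma newton_bound:
  assumes e: "0 \<le> e" "e \<le> 1"
  obtains A where "0 \<le> A" "\<And>F B z. bounded_density R B F \<Longrightarrow> norm z \<le> T \<Longrightarrow>
    integrable lborel (\<lambda>w. F w * log_kernel e (z - w)) \<and> \<bar>newton e F z\<bar> \<le> B * A"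
proof -
  obtain A where A: "0 \<le> A" "\<And>z. integrable lborel (Riesz_weight R 1 z)" "\<And>z. (LINT w|lborel. Riesz_weight R 1 z w) \<le> A"
    using Riesz_weight_integral[of 1 R] by auto
  define c where "c = newton_const * ((\<bar>T\<bar> + \<bar>R\<bar>) ^ 3 + 2)"
  have c: "0 \<le> c" using newton_const_pos by (simp add: c_def)
  have "integrable lborel (\<lambda>w. F w * log_kernel e (z - w)) \<and> \<bar>newton e F z\<bar> \<le> B * (c * A)"
    if F: "bounded_density R B F" and z: "norm z \<le> T" for F B z
  proof -
    have B: "0 \<le> B" by (rule bounded_density_nonneg[OF F])
    have [measurable]: "F \<in> borel_measurable borel" using F by (simp add: bounded_density_def)
    \<comment> \<open>At \<open>w = z\<close> the weight is \<open>0 powr (-1) = 0\<close>, so the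
      estimate is claimed off this null set only.\<close>
    have pt: "norm (F w * log_kernel e (z - w)) \<le> B * c * Riesz_weight R 1 z w" if "w \<noteq> z" for w
    proof (cases "w \<in> ball 0 R")
      case True
      have "norm (z - w) \<le> \<bar>T\<bar> + \<bar>R\<bar>" using True z norm_triangle_ineq4[of z w] by simp
      then have "\<bar>log_kernel e (z - w)\<bar> \<le> c * norm (z - w) powr (-1)"
        unfolding c_def using that by (intro log_kernel_bound e) auto
      then have "\<bar>F w\<bar> * \<bar>log_kernel e (z - w)\<bar> \<le> B * (c * norm (z - w) powr (-1))"
        using F B by (intro mult_mono) (auto simp: bounded_density_def)
      then show ?thesis using True by (simp add: Riesz_weight_def abs_mult mult.assoc)
    qed (use F in \<open>auto simp: bounded_density_def Riesz_weight_def\<close>)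
    have ae: "AE w in lborel. norm (F w * log_kernel e (z - w)) \<le> B * c * Riesz_weight R 1 z w"
      using AE_lborel_singleton[of z] by eventually_elim (rule pt)
    have m: "(\<lambda>w. F w * log_kernel e (z - w)) \<in> borel_measurable borel" by measurable
    have int: "integrable lborel (\<lambda>w. B * c * Riesz_weight R 1 z w)" using A(2)[of z] by simp
    have "\<bar>newton e F z\<bar> \<le> (LINT w|lborel. B * c * Riesz_weight R 1 z w)"
      using integral_le_dominating(2)[OF m int ae] by (simp add: newton_def)
    also have "\<dots> \<le> B * c * A" using A(3)[of z] B c by (simp add: mult_left_mono)
    finally show ?thesis using integral_le_dominating(1)[OF m int ae] by (simp add: mult.assoc)
  qed
  then show thesis using that[of "c * A"] c A(1) by auto
qed

lemma newton_grad_bound: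
  obtains A where "0 \<le> A" "\<And>e F B z. bounded_density R B F \<Longrightarrow>
    integrable lborel (\<lambda>w. F w *\<^sub>R log_kernel_grad e (z - w)) \<and> norm (newton_grad e F z) \<le> B * A"
proof -
  obtain A where A: "0 \<le> A" "\<And>z. integrable lborel (Riesz_weight R 1 z)" "\<And>z. (LINT w|lborel. Riesz_weight R 1 z w) \<le> A"
    using Riesz_weight_integral[of 1 R] by auto
  define c where "c = 2 * newton_const"
  have c: "0 \<le> c" using newton_const_pos by (simp add: c_def)
  have "integrable lborel (\<lambda>w. F w *\<^sub>R log_kernel_grad e (z - w)) \<and> norm (newton_grad e F z) \<le> B * (c * A)"
    if F: "bounded_density R B F" for e F B z
  proof -
    have B: "0 \<le> B" by (rule bounded_density_nonneg[OF F])
    have [measurable]: "F \<in> borel_measurable borel" using F by (simp add: bounded_density_def)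
    have pt: "norm (F w *\<^sub>R log_kernel_grad e (z - w)) \<le> B * c * Riesz_weight R 1 z w" for w
    proof (cases "w \<in> ball 0 R")
      case True
      have "\<bar>F w\<bar> * norm (log_kernel_grad e (z - w)) \<le> B * (c * norm (z - w) powr (-1))"
        using F B log_kernel_grad_bound[of e "z - w"] by (intro mult_mono) (auto simp: bounded_density_def c_def)
      then show ?thesis using True by (simp add: Riesz_weight_def mult.assoc)
    qed (use F in \<open>auto simp: bounded_density_def Riesz_weight_def\<close>)
    have ae: "AE w in lborel. norm (F w *\<^sub>R log_kernel_grad e (z - w)) \<le> B * c * Riesz_weight R 1 z w"
      by (intro AE_I2 pt)
    have m: "(\<lambda>w. F w *\<^sub>R log_kernel_grad e (z - w)) \<in> borel_measurable borel" by measurable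
    have int: "integrable lborel (\<lambda>w. B * c * Riesz_weight R 1 z w)" using A(2)[of z] by simp
    have "norm (newton_grad e F z) \<le> (LINT w|lborel. B * c * Riesz_weight R 1 z w)"
      using integral_le_dominating(2)[OF m int ae] by (simp add: newton_grad_def)
    also have "\<dots> \<le> B * c * A" using A(3)[of z] B c by (simp add: mult_left_mono)
    finally show ?thesis using integral_le_dominating(1)[OF m int ae] by (simp add: mult.assoc)
  qed
  then show thesis using that[of "c * A"] c A(1) by auto
qed

lemma newton_integrable:
  assumes "bounded_density R B F"
  shows "integrable lborel (\<lambda>w. F w * log_kernel 0 (z - w))"
  by (rule newton_bound[of 0 R "norm z"]) (use assms in auto)

lemma newton_grad_integrable:
  assumes "bounded_density R B F"
  shows "integrable lborel (\<lambda>w. F w *\<^sub>R log_kernel_grad e (z - w))"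
  by (rule newton_grad_bound[of R]) (use assms in auto)

text \<open>The error is uniform in \<open>z\<close>. This allows the derivative of the limit
  potential to be identified and the vector fields in the weak formulation to converge.\<close>

lemma newton_grad_smoothing:
  obtains A where "0 \<le> A" "\<And>e F B z. bounded_density R B F \<Longrightarrow> 0 < e \<Longrightarrow>
    norm (newton_grad e F z - newton_grad 0 F z) \<le> B * A * sqrt e"
proof -
  obtain A where A: "0 \<le> A" "\<And>z. integrable lborel (Riesz_weight R (3/2) z)" "\<And>z. (LINT w|lborel. Riesz_weight R (3/2) z w) \<le> A"
    using Riesz_weight_integral[of "3/2" R] by auto
  define c where "c = 2 * newton_const"
  have c: "0 \<le> c" using newton_const_pos by (simp add: c_def)
  have "norm (newton_grad e F z - newton_grad 0 F z) \<le> B * (c * A) * sqrt e"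
    if F: "bounded_density R B F" and "0 < e" for e F B z
  proof -
    have B: "0 \<le> B" by (rule bounded_density_nonneg[OF F])
    have [measurable]: "F \<in> borel_measurable borel" using F by (simp add: bounded_density_def)
    have int: "integrable lborel (\<lambda>w. F w *\<^sub>R log_kernel_grad e (z - w))" for e
      by (rule newton_grad_integrable[OF F])
    have pt: "norm (F w *\<^sub>R (log_kernel_grad e (z - w) - log_kernel_grad 0 (z - w))) \<le> B * c * sqrt e * Riesz_weight R (3/2) z w" for w
    proof (cases "w \<in> ball 0 R")
      case True
      have "\<bar>F w\<bar> * norm (log_kernel_grad e (z - w) - log_kernel_grad 0 (z - w)) \<le> B * (c * sqrt e * norm (z - w) powr (-(3/2)))"
        using F B log_kernel_grad_diff[OF \<open>0 < e\<close>, of "z - w"] by (intro mult_mono) (auto simp: bounded_density_def c_def)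
      then show ?thesis using True by (simp add: Riesz_weight_def mult.assoc)
    qed (use F in \<open>auto simp: bounded_density_def Riesz_weight_def\<close>)
    have "newton_grad e F z - newton_grad 0 F z = (LINT w|lborel. F w *\<^sub>R (log_kernel_grad e (z - w) - log_kernel_grad 0 (z - w)))"
      unfolding newton_grad_def by (subst Bochner_Integration.integral_diff[symmetric, OF int int]) (simp add: scaleR_diff_right)
    also have "norm \<dots> \<le> (LINT w|lborel. B * c * sqrt e * Riesz_weight R (3/2) z w)"
    proof (rule integral_le_dominating(2))
      show "integrable lborel (\<lambda>w. B * c * sqrt e * Riesz_weight R (3/2) z w)" using A(2)[of z] by simp
      show "(\<lambda>w. F w *\<^sub>R (log_kernel_grad e (z - w) - log_kernel_grad 0 (z - w))) \<in> borel_measurable borel" by measurable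
    qed (intro AE_I2 pt)
    also have "\<dots> \<le> B * c * sqrt e * A"
      using A(3)[of z] B c \<open>0 < e\<close> by (simp add: mult_left_mono)
    finally show ?thesis by (simp add: mult_ac)
  qed
  then show thesis using that[of "c * A"] c A(1) by auto
qed

lemma newton_grad_holder:
  assumes \<alpha>: "0 < \<alpha>" "\<alpha> < 1" and F: "bounded_density R B F"
  shows "\<exists>C. \<forall>z z'. norm (newton_grad 0 F z - newton_grad 0 F z') \<le> C * norm (z - z') powr \<alpha>"
proof -
  define s where "s = 1 + \<alpha>"
  obtain A where A: "0 \<le> A" "\<And>z. integrable lborel (Riesz_weight R s z)" "\<And>z. (LINT w|lborel. Riesz_weight R s z w) \<le> A"
    using Riesz_weight_integral[of s R] \<alpha> by (auto simp: s_def)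
  define c where "c = 4 * newton_const"
  have c: "0 \<le> c" using newton_const_pos by (simp add: c_def)
  have B: "0 \<le> B" by (rule bounded_density_nonneg[OF F])
  have [measurable]: "F \<in> borel_measurable borel" using F by (simp add: bounded_density_def)
  have int: "integrable lborel (\<lambda>w. F w *\<^sub>R log_kernel_grad e (z - w))" for e z
    by (rule newton_grad_integrable[OF F])
  have "norm (newton_grad 0 F z - newton_grad 0 F z') \<le> B * c * (2 * A) * norm (z - z') powr \<alpha>" for z z'
  proof -
    define d where "d = B * c * norm (z - z') powr \<alpha>"
    have d: "0 \<le> d" using B c by (simp add: d_def)
    have pt: "norm (F w *\<^sub>R (log_kernel_grad 0 (z - w) - log_kernel_grad 0 (z' - w))) \<le> d * (Riesz_weight R s z w + Riesz_weight R s z' w)"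
      if "w \<noteq> z" "w \<noteq> z'" for w
    proof (cases "w \<in> ball 0 R")
      case True
      have "\<bar>F w\<bar> * norm (log_kernel_grad 0 (z - w) - log_kernel_grad 0 (z' - w))
          \<le> B * (c * norm (z - z') powr \<alpha> * (norm (z - w) powr (- s) + norm (z' - w) powr (- s)))"
        using F B log_kernel_grad_holder[OF \<alpha>, of "z - w" "z' - w"] that
        by (intro mult_mono) (auto simp: bounded_density_def c_def s_def)
      then show ?thesis using True by (simp add: Riesz_weight_def d_def mult.assoc)
    qed (use F in \<open>auto simp: bounded_density_def Riesz_weight_def\<close>)
    have "newton_grad 0 F z - newton_grad 0 F z' = (LINT w|lborel. F w *\<^sub>R (log_kernel_grad 0 (z - w) - log_kernel_grad 0 (z' - w)))"
      unfolding newton_grad_def by (subst Bochner_Integration.integral_diff[symmetric, OF int int]) (simp add: scaleR_diff_right)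
    also have "norm \<dots> \<le> (LINT w|lborel. d * (Riesz_weight R s z w + Riesz_weight R s z' w))"
    proof (rule integral_le_dominating(2))
      show "integrable lborel (\<lambda>w. d * (Riesz_weight R s z w + Riesz_weight R s z' w))"
        using A(2)[of z] A(2)[of z'] by simp
      show "(\<lambda>w. F w *\<^sub>R (log_kernel_grad 0 (z - w) - log_kernel_grad 0 (z' - w))) \<in> borel_measurable borel" by measurable
      show "AE w in lborel. norm (F w *\<^sub>R (log_kernel_grad 0 (z - w) - log_kernel_grad 0 (z' - w)))
          \<le> d * (Riesz_weight R s z w + Riesz_weight R s z' w)"
        using AE_lborel_singleton[of z] AE_lborel_singleton[of z'] by eventually_elim (rule pt)
    qed
    also have "\<dots> = d * ((LINT w|lborel. Riesz_weight R s z w) + (LINT w|lborel. Riesz_weight R s z' w))"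
      using A(2)[of z] A(2)[of z'] by simp
    also have "\<dots> \<le> d * (2 * A)" using A(3)[of z] A(3)[of z'] d by (intro mult_left_mono) auto
    finally show ?thesis by (simp add: d_def mult_ac)
  qed
  then show ?thesis by blast
qed

lemma GDERIV_newton_smoothed:
  assumes "bounded_density R B F" "0 < e"
  shows "GDERIV (newton e F) z :> newton_grad e F z"
  unfolding newton_def[abs_def] newton_grad_def
  by (rule GDERIV_convolution[OF assms(1) GDERIV_log_kernel continuous_log_kernel_grad]) (use assms in auto)

lemma newton_smoothing:
  assumes F: "bounded_density R B F"
  shows "(\<lambda>n. newton (1 / (real n + 1)) F z) \<longlonglongrightarrow> newton 0 F z"
proof -
  obtain A where A: "integrable lborel (Riesz_weight R 1 z)"
    using Riesz_weight_integral[of 1 R] by auto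
  define c where "c = newton_const * ((norm z + \<bar>R\<bar>) ^ 3 + 2)"
  have B: "0 \<le> B" by (rule bounded_density_nonneg[OF F])
  have [measurable]: "F \<in> borel_measurable borel" using F by (simp add: bounded_density_def)
  show ?thesis
    unfolding newton_def
  proof (rule integral_dominated_convergence)
    show "(\<lambda>w. F w * log_kernel 0 (z - w)) \<in> borel_measurable lborel" by measurable
    show "(\<lambda>w. F w * log_kernel (1 / (real n + 1)) (z - w)) \<in> borel_measurable lborel" for n by measurable
    show "integrable lborel (\<lambda>w. B * c * Riesz_weight R 1 z w)" using A by simp
    show "AE w in lborel. (\<lambda>n. F w * log_kernel (1 / (real n + 1)) (z - w)) \<longlonglongrightarrow> F w * log_kernel 0 (z - w)"
      using AE_lborel_singleton[of z]
    proof eventually_elim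
      case (elim w)
      have "(\<lambda>n. 1 / (real n + 1)) \<longlonglongrightarrow> 0" by real_asymp
      then have "(\<lambda>n. (norm (z - w))\<^sup>2 + (1 / (real n + 1))\<^sup>2) \<longlonglongrightarrow> (norm (z - w))\<^sup>2 + 0\<^sup>2"
        by (intro tendsto_intros)
      then show ?case
        unfolding log_kernel_def using elim by (intro tendsto_mult tendsto_const tendsto_ln) auto
    qed
    fix n
    show "AE w in lborel. norm (F w * log_kernel (1 / (real n + 1)) (z - w)) \<le> B * c * Riesz_weight R 1 z w"
      using AE_lborel_singleton[of z]
    proof eventually_elim
      case (elim w)
      show ?case
      proof (cases "w \<in> ball 0 R")
        case True
        have "norm (z - w) \<le> norm z + \<bar>R\<bar>" using True norm_triangle_ineq4[of z w] by simp
        then have "\<bar>log_kernel (1 / (real n + 1)) (z - w)\<bar> \<le> c * norm (z - w) powr (-1)"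
          unfolding c_def using elim by (intro log_kernel_bound) auto
        then have "\<bar>F w\<bar> * \<bar>log_kernel (1 / (real n + 1)) (z - w)\<bar> \<le> B * (c * norm (z - w) powr (-1))"
          using F B by (intro mult_mono) (auto simp: bounded_density_def)
        then show ?thesis using True by (simp add: Riesz_weight_def abs_mult mult.assoc)
      qed (use F in \<open>auto simp: bounded_density_def Riesz_weight_def\<close>)
    qed
  qed
qed

text \<open>\<open>GDERIV_convolution\<close> requires a continuous kernel gradient and so covers
  only \<open>e > 0\<close>. For \<open>e = 0\<close> the smoothed potentials converge pointwise and
  their gradients uniformly, which suffices for differentiating the limit.\<close>

lemma GDERIV_newton:
  assumes F: "bounded_density R B F"
  shows "GDERIV (newton 0 F) z :> newton_grad 0 F z"
proof -
  obtain A where A: "0 \<le> A" "\<And>e z. 0 < e \<Longrightarrow> norm (newton_grad e F z - newton_grad 0 F z) \<le> B * A * sqrt e"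
    by (rule newton_grad_smoothing[of R]) (use F in blast)
  have B: "0 \<le> B" by (rule bounded_density_nonneg[OF F])
  have "\<exists>g. \<forall>x\<in>UNIV. (\<lambda>n. newton (1 / (real n + 1)) F x) \<longlonglongrightarrow> g x \<and>
      (g has_derivative (\<lambda>h. h \<bullet> newton_grad 0 F x)) (at x within UNIV)"
  proof (rule has_derivative_sequence)
    show "(newton (1 / (real n + 1)) F has_derivative (\<lambda>h. h \<bullet> newton_grad (1 / (real n + 1)) F x)) (at x within UNIV)" for n x
      using GDERIV_newton_smoothed[OF F, of "1 / (real n + 1)" x] by (simp add: gderiv_def)
    fix e :: real assume "0 < e"
    have "(\<lambda>n. B * A * sqrt (1 / (real n + 1))) \<longlonglongrightarrow> B * A * sqrt 0"
      by (intro tendsto_intros) real_asymp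
    then have "\<forall>\<^sub>F n in sequentially. B * A * sqrt (1 / (real n + 1)) < e"
      by (rule order_tendstoD(2)) (use \<open>0 < e\<close> in simp)
    then show "\<forall>\<^sub>F n in sequentially. \<forall>x\<in>UNIV. \<forall>h. norm (h \<bullet> newton_grad (1 / (real n + 1)) F x - h \<bullet> newton_grad 0 F x) \<le> e * norm h"
    proof eventually_elim
      case (elim n)
      have "norm (h \<bullet> newton_grad (1 / (real n + 1)) F x - h \<bullet> newton_grad 0 F x) \<le> e * norm h" for x h
      proof -
        have "norm (h \<bullet> newton_grad (1 / (real n + 1)) F x - h \<bullet> newton_grad 0 F x)
            \<le> norm h * norm (newton_grad (1 / (real n + 1)) F x - newton_grad 0 F x)"
          unfolding inner_diff_right[symmetric] real_norm_def by (rule Cauchy_Schwarz_ineq2)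
        also have "\<dots> \<le> norm h * e"
          using A(2)[of "1 / (real n + 1)" x] elim by (intro mult_left_mono) auto
        finally show ?thesis by (simp add: mult.commute)
      qed
      then show ?case by blast
    qed
  qed (use newton_smoothing[OF F] in auto)
  then obtain g where g: "\<And>x. (\<lambda>n. newton (1 / (real n + 1)) F x) \<longlonglongrightarrow> g x"
    "\<And>x. (g has_derivative (\<lambda>h. h \<bullet> newton_grad 0 F x)) (at x)" by auto
  have "g = newton 0 F" using LIMSEQ_unique[OF g(1) newton_smoothing[OF F]] by auto
  then show ?thesis using g(2) by (simp add: gderiv_def)
qed

text \<open>Supplies the equicontinuity for Arzela-Ascoli and, on bounded sets, Hoelder continuity
  of every order below 1.\<close>

lemma newton_lipschitz:
  obtains A where "0 \<le> A" "\<And>F B z z'. bounded_density R B F \<Longrightarrow> \<bar>newton 0 F z - newton 0 F z'\<bar> \<le> B * A * norm (z - z')"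
proof -
  obtain A where A: "0 \<le> A" "\<And>F B z. bounded_density R B F \<Longrightarrow> norm (newton_grad 0 F z) \<le> B * A"
    by (rule newton_grad_bound[of R]) blast
  have "\<bar>newton 0 F z - newton 0 F z'\<bar> \<le> B * A * norm (z - z')" if F: "bounded_density R B F" for F B z z'
  proof -
    have "norm (newton 0 F z - newton 0 F z') \<le> B * A * norm (z - z')"
    proof (rule differentiable_bound[where S = UNIV and f' = "\<lambda>x h. h \<bullet> newton_grad 0 F x"])
      show "(newton 0 F has_derivative (\<lambda>h. h \<bullet> newton_grad 0 F x)) (at x within UNIV)" for x
        using GDERIV_newton[OF F, of x] by (simp add: gderiv_def)
      show "onorm (\<lambda>h. h \<bullet> newton_grad 0 F x) \<le> B * A" for x
      proof (rule onorm_le)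
        fix h :: complex
        have "norm (h \<bullet> newton_grad 0 F x) \<le> norm h * norm (newton_grad 0 F x)"
          unfolding real_norm_def by (rule Cauchy_Schwarz_ineq2)
        also have "\<dots> \<le> norm h * (B * A)" using A(2)[OF F] by (intro mult_left_mono) auto
        finally show "norm (h \<bullet> newton_grad 0 F x) \<le> B * A * norm h" by (simp add: mult.commute)
      qed
    qed auto
    then show ?thesis by simp
  qed
  then show thesis using that A(1) by blast
qed

lemma newton_diff:
  assumes F: "bounded_density R B F" and F': "bounded_density R B' F'"
  shows "newton 0 F z - newton 0 F' z = newton 0 (\<lambda>w. F w - F' w) z"
proof -
  show ?thesis
    unfolding newton_def using F F' newton_integrable
    by (subst Bochner_Integration.integral_diff[symmetric]) (auto simp: left_diff_distrib)
qed

text \<open>The densities of the approximate solutions converge only pointwise; the common bound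
  \<open>B\<close> and the integrable kernel give domination.\<close>

lemma newton_tendsto:
  assumes F: "\<And>n. bounded_density R B (F n)" and lim: "\<And>w. (\<lambda>n. F n w) \<longlonglongrightarrow> G w"
  shows "bounded_density R B G" "(\<lambda>n. newton 0 (F n) z) \<longlonglongrightarrow> newton 0 G z"
proof -
  have [measurable]: "F n \<in> borel_measurable borel" for n using F by (simp add: bounded_density_def)
  have [measurable]: "G \<in> borel_measurable borel" by (rule borel_measurable_LIMSEQ_real[OF lim]) auto
  have "\<bar>G w\<bar> \<le> B" for w
    using F by (intro tendsto_upperbound[OF tendsto_rabs[OF lim]]) (auto simp: bounded_density_def)
  moreover have "G w = 0" if "w \<notin> ball 0 R" for w
    using F that LIMSEQ_unique[OF lim[of w]] tendsto_const by (simp add: bounded_density_def)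
  ultimately show G: "bounded_density R B G" by (simp add: bounded_density_def)
  have "bounded_density R 1 (indicator (ball 0 R))"
    by (auto simp: bounded_density_def indicator_def)
  have "integrable lborel (\<lambda>w. indicator (ball 0 R) w * log_kernel 0 (z - w))"
    by (rule newton_integrable) fact
  then have "integrable lborel (\<lambda>w. B * \<bar>indicator (ball 0 R) w * log_kernel 0 (z - w)\<bar>)"
    by (intro integrable_mult_right integrable_abs)
  then show "(\<lambda>n. newton 0 (F n) z) \<longlonglongrightarrow> newton 0 G z"
    unfolding newton_def
  proof (rule integral_dominated_convergence[rotated 2])
    show "AE w in lborel. (\<lambda>n. F n w * log_kernel 0 (z - w)) \<longlonglongrightarrow> G w * log_kernel 0 (z - w)"
      by (intro AE_I2 tendsto_intros lim)
    have "norm (F n w * log_kernel 0 (z - w)) \<le> B * \<bar>indicator (ball 0 R) w * log_kernel 0 (z - w)\<bar>" for n w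
      using F[of n] by (cases "w \<in> ball 0 R") (auto simp: bounded_density_def abs_mult intro!: mult_right_mono)
    then show "AE w in lborel. norm (F n w * log_kernel 0 (z - w)) \<le> B * \<bar>indicator (ball 0 R) w * log_kernel 0 (z - w)\<bar>" for n
      by (intro AE_I2)
  qed measurable
qed

section \<open>Smoothness and Laplacian of the regularised potentials\<close>

definition smooth :: "('a::euclidean_space \<Rightarrow> real) \<Rightarrow> bool" where
  "smooth f \<longleftrightarrow> (\<forall>k. C_k k f)"

text \<open>Each order \<open>k\<close> comes with a gradient of its own; uniqueness of gradients
  identifies them all with the one for order 0.\<close>

lemma smooth_GDERIV:
  fixes f :: "'a::euclidean_space \<Rightarrow> real"
  assumes "smooth f"
  shows "\<exists>g. (\<forall>x. GDERIV f x :> g x) \<and> (\<forall>b\<in>Basis. smooth (\<lambda>x. b \<bullet> g x))"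
proof -
  obtain g where g: "\<And>x. GDERIV f x :> g x"
    using assms C_k_SucE[of 0 f] unfolding smooth_def by metis
  have "C_k k (\<lambda>x. b \<bullet> g x)" if b: "b \<in> Basis" for b k
  proof -
    obtain h where h: "\<And>x. GDERIV f x :> h x" "\<And>b. b \<in> Basis \<Longrightarrow> C_k k (\<lambda>x. b \<bullet> h x)"
      using assms C_k_SucE[of k f] unfolding smooth_def by metis
    have "h = g" using GDERIV_unique[OF h(1) g] by auto
    then show ?thesis using h(2)[OF b] by simp
  qed
  then show ?thesis using g unfolding smooth_def by blast
qed

lemma smooth_grad:
  fixes f :: "'a::euclidean_space \<Rightarrow> real"
  assumes "smooth f" "\<And>x. GDERIV f x :> g x" "b \<in> Basis"
  shows "smooth (\<lambda>x. b \<bullet> g x)"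
proof -
  obtain h where h: "\<And>x. GDERIV f x :> h x" "\<And>b. b \<in> Basis \<Longrightarrow> smooth (\<lambda>x. b \<bullet> h x)"
    using smooth_GDERIV[OF assms(1)] by blast
  have "h = g" using GDERIV_unique[OF h(1) assms(2)] by auto
  then show ?thesis using h(2)[OF assms(3)] by simp
qed

lemma continuous_on_grad:
  fixes g :: "'b::t2_space \<Rightarrow> 'a::euclidean_space"
  assumes "\<And>b. b \<in> Basis \<Longrightarrow> continuous_on S (\<lambda>x. b \<bullet> g x)"
  shows "continuous_on S g"
  using assms unfolding continuous_on_componentwise[of S g] by (simp add: inner_commute)

lemma smooth_continuous: "smooth f \<Longrightarrow> continuous_on UNIV f"
  unfolding smooth_def using C_k_imp_continuous by blast

lemma GDERIV_continuous_on:
  fixes f :: "'a::real_inner \<Rightarrow> real"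
  assumes "\<And>x. GDERIV f x :> g x"
  shows "continuous_on UNIV f"
proof (rule continuous_at_imp_continuous_on, rule ballI)
  show "isCont f x" for x
    using assms[of x] unfolding gderiv_def by (rule has_derivative_continuous)
qed

text \<open>All derivatives fall on the kernel, so the induction runs over arbitrary smooth kernels
  with the density fixed.\<close>

lemma smooth_convolution:
  fixes k :: "complex \<Rightarrow> real"
  assumes F: "bounded_density R B F" and k: "smooth k"
  shows "smooth (\<lambda>z. LINT w|lborel. F w * k (z - w))"
proof -
  have "C_k n (\<lambda>z. LINT w|lborel. F w * k (z - w))" for n
    using k
  proof (induction n arbitrary: k)
    case (0 k)
    obtain g where g: "\<And>x. GDERIV k x :> g x" "\<And>b. b \<in> Basis \<Longrightarrow> smooth (\<lambda>x. b \<bullet> g x)"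
      using smooth_GDERIV[OF 0] by blast
    have "continuous_on UNIV g" by (rule continuous_on_grad, rule smooth_continuous, rule g)
    from GDERIV_continuous_on[OF GDERIV_convolution[OF F g(1) this]] show ?case by simp
  next
    case (Suc n k)
    obtain g where g: "\<And>x. GDERIV k x :> g x" "\<And>b. b \<in> Basis \<Longrightarrow> smooth (\<lambda>x. b \<bullet> g x)"
      using smooth_GDERIV[OF Suc.prems] by blast
    have cg: "continuous_on UNIV g" by (rule continuous_on_grad, rule smooth_continuous, rule g)
    show ?case
    proof (rule C_k_SucI[OF GDERIV_convolution[OF F g(1) cg]])
      fix b :: complex assume b: "b \<in> Basis"
      have "b \<bullet> (LINT w|lborel. F w *\<^sub>R g (z - w)) = (LINT w|lborel. F w * (b \<bullet> g (z - w)))" for z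
        by (subst integral_inner_right[symmetric]) (auto intro: integrable_convolution[OF F cg])
      then show "C_k n (\<lambda>z. b \<bullet> (LINT w|lborel. F w *\<^sub>R g (z - w)))"
        using Suc.IH[OF g(2)[OF b]] by simp
    qed
  qed
  then show ?thesis by (simp add: smooth_def)
qed

lemma smooth_log_kernel:
  assumes "0 < e" shows "smooth (log_kernel e)"
  unfolding smooth_def
proof
  fix k
  have "C_k k (\<lambda>v::complex. (\<Sum>b\<in>Basis. (v \<bullet> b) * (v \<bullet> b)) + e\<^sup>2)"
    by (intro C_k_add C_k_sum C_k_mult C_k_inner C_k_const)
  moreover have "(\<Sum>b\<in>Basis. (v \<bullet> b) * (v \<bullet> b)) = (norm v)\<^sup>2" for v :: complex
    by (simp add: power2_norm_eq_inner) (subst (2) euclidean_inner, simp)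
  ultimately have "C_k k (\<lambda>v::complex. (norm v)\<^sup>2 + e\<^sup>2)" by simp
  then have "C_k k (\<lambda>v::complex. newton_const * ln ((norm v)\<^sup>2 + e\<^sup>2))"
    using assms by (intro C_k_cmult C_k_ln) (auto intro: add_nonneg_pos)
  then show "C_k k (log_kernel e)" by (simp add: log_kernel_def[abs_def])
qed

lemma smooth_newton: "bounded_density R B F \<Longrightarrow> 0 < e \<Longrightarrow> smooth (newton e F)"
  unfolding newton_def[abs_def] by (intro smooth_convolution smooth_log_kernel)

text \<open>The Laplacian of \<open>log_kernel e\<close>.\<close>

definition poisson_profile :: "real \<Rightarrow> complex \<Rightarrow> real" where
  "poisson_profile e v = 4 * newton_const * e\<^sup>2 / ((norm v)\<^sup>2 + e\<^sup>2)\<^sup>2"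

lemma laplacian_newton:
  assumes F: "bounded_density R B F" and e: "0 < e"
  obtains L where "\<And>b z. b \<in> Basis \<Longrightarrow> GDERIV (\<lambda>z. b \<bullet> newton_grad e F z) z :> L b z"
    "\<And>z. (\<Sum>b\<in>Basis. b \<bullet> L b z) = (LINT w|lborel. F w * poisson_profile e (z - w))"
proof -
  have pos: "0 < v \<bullet> v + e\<^sup>2" for v :: complex using e by (simp add: add_nonneg_pos)
  define h where "h b v = (2 * newton_const * inverse (v \<bullet> v + e\<^sup>2)) *\<^sub>R b
    - (4 * newton_const * (b \<bullet> v) * (inverse (v \<bullet> v + e\<^sup>2))\<^sup>2) *\<^sub>R v" for b v :: complex
  have conth: "continuous_on UNIV (h b)" for b
    unfolding h_def using pos by (intro continuous_intros) (auto simp: less_imp_neq[symmetric])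
  have contg: "continuous_on UNIV (log_kernel_grad e)" by (rule continuous_log_kernel_grad[OF e])
  have der: "GDERIV (\<lambda>v. b \<bullet> log_kernel_grad e v) v :> h b v" for b v
  proof -
    have "((\<lambda>v. 2 * newton_const * (b \<bullet> v) * inverse (v \<bullet> v + e\<^sup>2)) has_derivative
      (\<lambda>d. 2 * newton_const * (b \<bullet> v) * (- (inverse (v \<bullet> v + e\<^sup>2) * (d \<bullet> v + v \<bullet> d) * inverse (v \<bullet> v + e\<^sup>2)))
        + 2 * newton_const * (b \<bullet> d) * inverse (v \<bullet> v + e\<^sup>2))) (at v)"
      using pos[of v] by (auto intro!: derivative_eq_intros)
    moreover have "(\<lambda>d. 2 * newton_const * (b \<bullet> v) * (- (inverse (v \<bullet> v + e\<^sup>2) * (d \<bullet> v + v \<bullet> d) * inverse (v \<bullet> v + e\<^sup>2)))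
        + 2 * newton_const * (b \<bullet> d) * inverse (v \<bullet> v + e\<^sup>2)) = (\<lambda>d. d \<bullet> h b v)"
      by (auto simp: h_def inner_diff_right inner_commute power2_eq_square algebra_simps)
    moreover have "(\<lambda>v. b \<bullet> log_kernel_grad e v) = (\<lambda>v. 2 * newton_const * (b \<bullet> v) * inverse (v \<bullet> v + e\<^sup>2))"
      by (auto simp: log_kernel_grad_def power2_norm_eq_inner divide_inverse)
    ultimately show ?thesis by (simp add: gderiv_def)
  qed
  have newt: "b \<bullet> newton_grad e F z = (LINT w|lborel. F w * (b \<bullet> log_kernel_grad e (z - w)))" for b z
    unfolding newton_grad_def
    by (subst integral_inner_right[symmetric]) (auto intro: integrable_convolution[OF F contg])
  show thesis
  proof
    show "GDERIV (\<lambda>z. b \<bullet> newton_grad e F z) z :> (LINT w|lborel. F w *\<^sub>R h b (z - w))" for b z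
      unfolding newt by (rule GDERIV_convolution[OF F der conth])
    fix z
    \<comment> \<open>The diagonal terms contribute \<open>2 * newton_const * i\<close> for each of
      the two basis vectors; writing \<open>i\<close> as
      \<open>i * (i * (v \<bullet> v + e ^ 2))\<close> then cancels everything except the term with
      \<open>e ^ 2\<close>.\<close>
    have trace: "(\<Sum>b\<in>Basis. b \<bullet> h b v) = poisson_profile e v" for v :: complex
    proof -
      define i where "i = inverse (v \<bullet> v + e\<^sup>2)"
      have i: "i * (v \<bullet> v + e\<^sup>2) = 1" using pos[of v] by (simp add: i_def)
      have "(\<Sum>b\<in>Basis. b \<bullet> h b v) = (\<Sum>b\<in>Basis. 2 * newton_const * i - 4 * newton_const * i\<^sup>2 * ((v \<bullet> b) * (v \<bullet> b)))"
        by (rule sum.cong) (auto simp: h_def i_def inner_diff_right inner_commute mult_ac)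
      also have "\<dots> = 4 * newton_const * i - 4 * newton_const * i\<^sup>2 * (\<Sum>b\<in>Basis. (v \<bullet> b) * (v \<bullet> b))"
        by (simp add: sum_subtractf sum_distrib_left)
      also have "(\<Sum>b\<in>Basis. (v \<bullet> b) * (v \<bullet> b)) = v \<bullet> v" by (simp add: euclidean_inner[symmetric])
      also have "4 * newton_const * i = 4 * newton_const * i * (i * (v \<bullet> v + e\<^sup>2))" by (simp add: i)
      also have "\<dots> - 4 * newton_const * i\<^sup>2 * (v \<bullet> v) = 4 * newton_const * e\<^sup>2 * i\<^sup>2"
        by (simp add: algebra_simps power2_eq_square)
      finally show ?thesis
        by (simp add: poisson_profile_def i_def power2_norm_eq_inner divide_inverse power_inverse)
    qed
    have ih: "integrable lborel (\<lambda>w. F w *\<^sub>R h b (z - w))" for b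
      by (rule integrable_convolution[OF F conth])
    have "(\<Sum>b\<in>Basis. b \<bullet> (LINT w|lborel. F w *\<^sub>R h b (z - w))) = (\<Sum>b\<in>Basis. LINT w|lborel. F w * (b \<bullet> h b (z - w)))"
      by (rule sum.cong[OF refl], subst integral_inner_right[symmetric]) (auto intro: ih)
    also have "\<dots> = (LINT w|lborel. (\<Sum>b\<in>Basis. F w * (b \<bullet> h b (z - w))))"
    proof (rule Bochner_Integration.integral_sum[symmetric])
      show "integrable lborel (\<lambda>w. F w * (b \<bullet> h b (z - w)))" for b
        using integrable_inner_right[OF ih[of b], of b] by simp
    qed
    also have "\<dots> = (LINT w|lborel. F w * poisson_profile e (z - w))"
      by (simp add: sum_distrib_left[symmetric] trace)
    finally show "(\<Sum>b\<in>Basis. b \<bullet> (LINT w|lborel. F w *\<^sub>R h b (z - w))) = (LINT w|lborel. F w * poisson_profile e (z - w))" .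
  qed
qed

text \<open>After scaling, \<open>e\<close> occurs only in the argument of \<open>F\<close>. The
  remaining weight is fixed, integrable and of total mass 1 by the choice of
  \<open>newton_const\<close>, which yields both the bound and the limit below.\<close>

lemma poisson_profile_scaled:
  assumes F: "bounded_density R B F" and e: "0 < e"
  shows "(LINT w|lborel. F w * poisson_profile e (z - w))
    = (LINT v|lborel. 4 * newton_const * F (z - e *\<^sub>R v) * (1 / (1 + (norm v)\<^sup>2)\<^sup>2))"
proof -
  have [measurable]: "F \<in> borel_measurable borel" using F by (simp add: bounded_density_def)
  have "(LINT w|lborel. F w * poisson_profile e (z - w)) = (LINT w|lborel. (\<lambda>u. F (z - u) * poisson_profile e u) (z - w))"
    by simp
  also have "\<dots> = (LINT v|lborel. e\<^sup>2 * (F (z - e *\<^sub>R v) * poisson_profile e (e *\<^sub>R v)))"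
    by (rule integral_scale_reflect[OF _ e]) (simp add: poisson_profile_def)
  also have "\<dots> = (LINT v|lborel. 4 * newton_const * F (z - e *\<^sub>R v) * (1 / (1 + (norm v)\<^sup>2)\<^sup>2))"
  proof (rule Bochner_Integration.integral_cong[OF refl])
    fix v :: complex
    have "((norm (e *\<^sub>R v))\<^sup>2 + e\<^sup>2)\<^sup>2 = e\<^sup>2 * e\<^sup>2 * (1 + (norm v)\<^sup>2)\<^sup>2"
      using e by (simp add: power_mult_distrib[symmetric]) (simp add: algebra_simps power2_eq_square)
    then show "e\<^sup>2 * (F (z - e *\<^sub>R v) * poisson_profile e (e *\<^sub>R v)) = 4 * newton_const * F (z - e *\<^sub>R v) * (1 / (1 + (norm v)\<^sup>2)\<^sup>2)"
      using e unfolding poisson_profile_def by (cases "(1 + (norm v)\<^sup>2)\<^sup>2 = 0") (auto simp: field_simps)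
  qed
  finally show ?thesis .
qed

lemma poisson_profile_bound:
  assumes F: "bounded_density R B F" and e: "0 < e"
  shows "\<bar>LINT w|lborel. F w * poisson_profile e (z - w)\<bar> \<le> B"
proof -
  have [measurable]: "F \<in> borel_measurable borel" using F by (simp add: bounded_density_def)
  have "norm (LINT v|lborel. 4 * newton_const * F (z - e *\<^sub>R v) * (1 / (1 + (norm v)\<^sup>2)\<^sup>2))
      \<le> (LINT v|lborel. 4 * newton_const * B * (1 / (1 + (norm (v::complex))\<^sup>2)\<^sup>2))"
  proof (rule integral_le_dominating(2))
    show "(\<lambda>v. 4 * newton_const * F (z - e *\<^sub>R v) * (1 / (1 + (norm v)\<^sup>2)\<^sup>2)) \<in> borel_measurable borel" by measurable
    show "integrable lborel (\<lambda>v::complex. 4 * newton_const * B * (1 / (1 + (norm v)\<^sup>2)\<^sup>2))"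
      by (intro integrable_mult_right integrable_Poisson_profile)
    have "norm (4 * newton_const * F (z - e *\<^sub>R v) * (1 / (1 + (norm v)\<^sup>2)\<^sup>2)) \<le> 4 * newton_const * B * (1 / (1 + (norm v)\<^sup>2)\<^sup>2)" for v
      using F newton_const_pos bounded_density_nonneg[OF F] unfolding norm_mult
      by (intro mult_right_mono mult_mono) (auto simp: bounded_density_def)
    then show "AE v in lborel. norm (4 * newton_const * F (z - e *\<^sub>R v) * (1 / (1 + (norm v)\<^sup>2)\<^sup>2))
        \<le> 4 * newton_const * B * (1 / (1 + (norm v)\<^sup>2)\<^sup>2)" by (intro AE_I2)
  qed
  also have "\<dots> = B"
    using newton_const_pos by (simp only: integral_mult_right_zero) (simp add: newton_const_def)
  finally show ?thesis unfolding poisson_profile_scaled[OF F e] by simp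
qed

text \<open>Stated pointwise because the density, extended by zero, may jump across the boundary of
  the domain.\<close>

lemma poisson_profile_tendsto:
  assumes F: "bounded_density R B F" and cont: "isCont F z"
  shows "(\<lambda>n. LINT w|lborel. F w * poisson_profile (1 / (real n + 1)) (z - w)) \<longlonglongrightarrow> F z"
proof -
  have [measurable]: "F \<in> borel_measurable borel" using F by (simp add: bounded_density_def)
  have "(\<lambda>n. LINT v|lborel. 4 * newton_const * F (z - (1 / (real n + 1)) *\<^sub>R v) * (1 / (1 + (norm v)\<^sup>2)\<^sup>2))
      \<longlonglongrightarrow> (LINT v|lborel. 4 * newton_const * F z * (1 / (1 + (norm (v::complex))\<^sup>2)\<^sup>2))"
  proof (rule integral_dominated_convergence)
    show "integrable lborel (\<lambda>v::complex. 4 * newton_const * B * (1 / (1 + (norm v)\<^sup>2)\<^sup>2))"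
      by (intro integrable_mult_right integrable_Poisson_profile)
    have "norm (4 * newton_const * F (z - (1 / (real n + 1)) *\<^sub>R v) * (1 / (1 + (norm v)\<^sup>2)\<^sup>2)) \<le> 4 * newton_const * B * (1 / (1 + (norm v)\<^sup>2)\<^sup>2)" for v n
      using F newton_const_pos bounded_density_nonneg[OF F] unfolding norm_mult
      by (intro mult_right_mono mult_mono) (auto simp: bounded_density_def)
    then show "AE v in lborel. norm (4 * newton_const * F (z - (1 / (real n + 1)) *\<^sub>R v) * (1 / (1 + (norm v)\<^sup>2)\<^sup>2))
        \<le> 4 * newton_const * B * (1 / (1 + (norm v)\<^sup>2)\<^sup>2)" for n by (intro AE_I2)
    have "(\<lambda>n. F (z - (1 / (real n + 1)) *\<^sub>R v)) \<longlonglongrightarrow> F z" for v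
    proof (rule isCont_tendsto_compose[OF cont])
      have "(\<lambda>n. 1 / (real n + 1)) \<longlonglongrightarrow> 0" by real_asymp
      then have "(\<lambda>n. z - (1 / (real n + 1)) *\<^sub>R v) \<longlonglongrightarrow> z - 0 *\<^sub>R v" by (intro tendsto_intros)
      then show "(\<lambda>n. z - (1 / (real n + 1)) *\<^sub>R v) \<longlonglongrightarrow> z" by simp
    qed
    then show "AE v in lborel. (\<lambda>n. 4 * newton_const * F (z - (1 / (real n + 1)) *\<^sub>R v) * (1 / (1 + (norm v)\<^sup>2)\<^sup>2))
        \<longlonglongrightarrow> 4 * newton_const * F z * (1 / (1 + (norm v)\<^sup>2)\<^sup>2)" by (intro AE_I2 tendsto_intros)
  qed measurable
  also have "(LINT v|lborel. 4 * newton_const * F z * (1 / (1 + (norm (v::complex))\<^sup>2)\<^sup>2)) = F z"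
    using newton_const_pos by (simp only: integral_mult_right_zero) (simp add: newton_const_def)
  finally show ?thesis by (simp add: poisson_profile_scaled[OF F])
qed

section \<open>Existence\<close>

text \<open>An approximate Brouwer theorem on a cube whose dimension is a term, taken directly from Kuhn's
  combinatorial lemma: the library version is tied to a type.\<close>

lemma approximate_fixed_point:
  fixes f :: "(nat \<Rightarrow> real) \<Rightarrow> nat \<Rightarrow> real"
  assumes R: "0 < R" and e: "0 < e"
    and maps: "\<And>x i. (\<And>j. j < n \<Longrightarrow> \<bar>x j\<bar> \<le> R) \<Longrightarrow> i < n \<Longrightarrow> \<bar>f x i\<bar> \<le> R"
    and cont: "\<And>e. 0 < e \<Longrightarrow> \<exists>d>0. \<forall>x y. (\<forall>j<n. \<bar>x j\<bar> \<le> R \<and> \<bar>y j\<bar> \<le> R \<and> \<bar>x j - y j\<bar> < d) \<longrightarrow>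
      (\<forall>i<n. \<bar>f x i - f y i\<bar> < e)"
  obtains x where "\<And>j. j < n \<Longrightarrow> \<bar>x j\<bar> \<le> R" "\<And>i. i < n \<Longrightarrow> \<bar>f x i - x i\<bar> \<le> e"
proof -
  obtain d where d: "0 < d" "\<And>x y i. (\<forall>j<n. \<bar>x j\<bar> \<le> R \<and> \<bar>y j\<bar> \<le> R \<and> \<bar>x j - y j\<bar> < d) \<Longrightarrow> i < n \<Longrightarrow> \<bar>f x i - f y i\<bar> < e / 2"
    using cont[of "e / 2"] e by auto
  obtain p :: nat where p: "2 * R / min d (e / 2) < real p" using reals_Archimedean2 by blast
  have m: "0 < min d (e / 2)" using d e by simp
  have p0: "0 < p"
    using p R m by (metis divide_pos_pos mult_pos_pos of_nat_0_less_iff order.strict_trans zero_less_numeral)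
  have step: "2 * R / real p < min d (e / 2)"
    using p p0 m by (simp only: pos_divide_less_eq of_nat_0_less_iff mult.commute)
  \<comment> \<open>Grid points with mesh \<open>2 * R / p\<close> on the cube of side
    \<open>2 * R\<close>.\<close>
  define X where "X a j = - R + 2 * R * real (a j) / real p" for a :: "nat \<Rightarrow> nat" and j :: nat
  have XR: "\<bar>X a j\<bar> \<le> R" if "a j \<le> p" for a j
  proof -
    have "0 \<le> 2 * R * real (a j) / real p" using R p0 by simp
    moreover have "2 * R * real (a j) / real p \<le> 2 * R"
      using R p0 that by (simp add: pos_divide_le_eq)
    ultimately show ?thesis by (simp add: X_def abs_le_iff)
  qed
  \<comment> \<open>Label 0 marks a coordinate that \<open>f\<close> does not decrease, label 1 one
    that it does not increase. On the faces Kuhn's lemma prescribes the labels; they agree with this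
    meaning because \<open>f\<close> maps the cube into itself.\<close>
  define label where "label a i = (if a i = p then 1 else if a i = 0 then 0 else if X a i \<le> f (X a) i then 0 else (1::nat))" for a i
  have l0: "X a i \<le> f (X a) i" if "label a i = 0" "i < n" "\<And>j. j < n \<Longrightarrow> a j \<le> p" for a i
  proof (cases "a i = 0")
    case True
    then have "X a i = - R" by (simp add: X_def)
    then show ?thesis using maps[of "X a" i] XR that by (simp add: abs_le_iff)
  next
    case False
    then show ?thesis using that(1) by (auto simp: label_def split: if_splits)
  qed
  have l1: "f (X a) i \<le> X a i" if "label a i = 1" "i < n" "\<And>j. j < n \<Longrightarrow> a j \<le> p" for a i
  proof (cases "a i = p")
    case True
    then have "X a i = R" using p0 by (simp add: X_def)
    then show ?thesis using maps[of "X a" i] XR that by (simp add: abs_le_iff)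
  next
    case False
    then show ?thesis using that(1) by (auto simp: label_def split: if_splits)
  qed
  \<comment> \<open>\<open>q\<close> is the lower corner of a cell in which every coordinate
    receives both labels. So \<open>f (X a) i - X a i\<close> takes both signs, possibly zero, at
    vertices of this cell, and by continuity it is small at \<open>q\<close>.\<close>
  obtain q where q: "\<forall>i<n. q i < p"
    and qq: "\<forall>i<n. \<exists>r s. (\<forall>j<n. q j \<le> r j \<and> r j \<le> q j + 1) \<and> (\<forall>j<n. q j \<le> s j \<and> s j \<le> q j + 1) \<and> label r i \<noteq> label s i"
  proof (rule kuhn_lemma[of p n label])
    show "\<forall>x. (\<forall>i<n. x i \<le> p) \<longrightarrow> (\<forall>i<n. label x i = 0 \<or> label x i = 1)" by (auto simp: label_def)
    show "\<forall>x. (\<forall>i<n. x i \<le> p) \<longrightarrow> (\<forall>i<n. x i = 0 \<longrightarrow> label x i = 0)" using p0 by (auto simp: label_def)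
    show "\<forall>x. (\<forall>i<n. x i \<le> p) \<longrightarrow> (\<forall>i<n. x i = p \<longrightarrow> label x i = 1)" by (auto simp: label_def)
  qed (use p0 in auto)
  have near: "\<bar>X a j - X q j\<bar> < min d (e / 2)" if "q j \<le> a j" "a j \<le> q j + 1" for a j
  proof -
    have "X a j - X q j = 2 * R / real p * (real (a j) - real (q j))"
      by (simp add: X_def diff_divide_distrib[symmetric] right_diff_distrib)
    moreover have "0 \<le> real (a j) - real (q j)" "real (a j) - real (q j) \<le> 1" using that by auto
    moreover have "0 \<le> 2 * R / real p" using R p0 by simp
    ultimately have "\<bar>X a j - X q j\<bar> \<le> 2 * R / real p"
      by (simp only: abs_mult abs_of_nonneg mult_left_le)
    then show ?thesis using step by simp
  qed
  have comp: "\<bar>f (X a) i - f (X q) i\<bar> < e / 2 \<and> \<bar>X a i - X q i\<bar> < e / 2"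
    if a: "\<forall>j<n. q j \<le> a j \<and> a j \<le> q j + 1" and i: "i < n" for a i
  proof
    have "\<bar>X a j\<bar> \<le> R \<and> \<bar>X q j\<bar> \<le> R \<and> \<bar>X a j - X q j\<bar> < d" if "j < n" for j
    proof -
      have "a j \<le> p" "q j \<le> p" using a q that by force+
      then show ?thesis using XR near[of j a] a that by auto
    qed
    then show "\<bar>f (X a) i - f (X q) i\<bar> < e / 2" using i by (intro d) auto
    show "\<bar>X a i - X q i\<bar> < e / 2" using near[of i a] a i by auto
  qed
  show thesis
  proof
    show "\<bar>X q j\<bar> \<le> R" if "j < n" for j using XR q that by (simp add: less_imp_le)
    fix i assume i: "i < n"
    obtain r s where r: "\<forall>j<n. q j \<le> r j \<and> r j \<le> q j + 1" and s: "\<forall>j<n. q j \<le> s j \<and> s j \<le> q j + 1"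
      and ne: "label r i \<noteq> label s i" using qq i by blast
    have rp: "r j \<le> p" "s j \<le> p" if "j < n" for j using r s q that by force+
    have "label r i \<in> {0, 1}" "label s i \<in> {0, 1}" by (auto simp: label_def)
    then consider "label r i = 0" "label s i = 1" | "label r i = 1" "label s i = 0" using ne by auto
    then obtain a b where ab: "\<forall>j<n. q j \<le> a j \<and> a j \<le> q j + 1" "\<forall>j<n. q j \<le> b j \<and> b j \<le> q j + 1"
      "X a i \<le> f (X a) i" "f (X b) i \<le> X b i"
    proof cases
      case 1
      show thesis using that[OF r s l0[OF 1(1) i] l1[OF 1(2) i]] rp by blast
    next
      case 2
      show thesis using that[OF s r l0[OF 2(2) i] l1[OF 2(1) i]] rp by blast
    qed
    show "\<bar>f (X q) i - X q i\<bar> \<le> e"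
      using comp[OF ab(1) i] comp[OF ab(2) i] ab(3,4) by linarith
  qed
qed

section \<open>The fixed point argument for the semilinear problem\<close>

text \<open>\<open>u\<close> solves the linear Poisson problem with right-hand side \<open>F\<close>
  and boundary values \<open>\<phi>\<close>. The holomorphic function is bound inside because only
  its real part is determined.\<close>

definition semilinear_approx ::
    "complex set \<Rightarrow> (complex \<Rightarrow> real) \<Rightarrow> (complex \<Rightarrow> real) \<Rightarrow> (complex \<Rightarrow> real) \<Rightarrow> bool" where
  "semilinear_approx D \<phi> F u \<longleftrightarrow> continuous_on (closure D) u \<and> (\<forall>z\<in>frontier D. u z = \<phi> z) \<and>
     (\<exists>H. H holomorphic_on D \<and> (\<forall>z\<in>D. u z = newton 0 F z + Re (H z)))"

lemma continuous_newton:
  assumes "bounded_density R B F"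
  shows "continuous_on S (newton 0 F)"
proof (rule continuous_at_imp_continuous_on, rule ballI)
  show "isCont (newton 0 F) x" for x
    using GDERIV_newton[OF assms, of x] unfolding gderiv_def by (rule has_derivative_continuous)
qed

text \<open>On the frontier the harmonic parts differ by the difference of the particular solutions,
  so the maximum principle bounds them by \<open>c\<close>, and the potentials add another
  \<open>c\<close>. \<open>V\<close> is an arbitrary continuous function because the lemma is also
  applied to a limit of potentials before that limit is known to be a potential.\<close>

lemma semilinear_approx_diff:
  assumes D: "open D" "bounded D"
    and u: "semilinear_approx D \<phi> F u" and F: "bounded_density R B F"
    and v: "continuous_on (closure D) v" "\<And>z. z \<in> frontier D \<Longrightarrow> v z = \<phi> z"
      "H' holomorphic_on D" "\<And>z. z \<in> D \<Longrightarrow> v z = V z + Re (H' z)" and V: "continuous_on (closure D) V"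
    and c: "\<And>z. z \<in> closure D \<Longrightarrow> \<bar>newton 0 F z - V z\<bar> \<le> c" and z: "z \<in> closure D"
  shows "\<bar>u z - v z\<bar> \<le> 2 * c"
proof -
  obtain H where H: "H holomorphic_on D" "\<And>z. z \<in> D \<Longrightarrow> u z = newton 0 F z + Re (H z)"
    and u': "continuous_on (closure D) u" "\<And>z. z \<in> frontier D \<Longrightarrow> u z = \<phi> z"
    using u by (auto simp: semilinear_approx_def)
  have "\<bar>(u z - newton 0 F z) - (v z - V z)\<bar> \<le> c"
  proof (rule Re_holomorphic_max_principle_abs[OF D, where H = "\<lambda>z. H z - H' z"])
    show "(\<lambda>z. H z - H' z) holomorphic_on D" by (intro holomorphic_intros H v)
    show "continuous_on (closure D) (\<lambda>z. (u z - newton 0 F z) - (v z - V z))"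
      by (intro continuous_intros u' v V continuous_newton[OF F])
    show "\<bar>(u z - newton 0 F z) - (v z - V z)\<bar> \<le> c" if "z \<in> frontier D" for z
      using c[of z] u'(2)[OF that] v(2)[OF that] that by (simp add: frontier_def abs_minus_commute)
  qed (use H v z in auto)
  then show ?thesis using c[OF z] by linarith
qed

lemma semilinear_existence:
  fixes f :: "real \<Rightarrow> real" and \<phi> :: "complex \<Rightarrow> real"
  assumes D: "open D" "simply_connected D" "bounded D" "D \<noteq> {}" "D \<subseteq> ball 0 R"
    and sector: "\<And>s. 0 < s \<Longrightarrow> s < 1 \<Longrightarrow> \<exists>r>0. exterior_sector s r D"
    and \<phi>: "continuous_on (frontier D) \<phi>"
    and f: "continuous_on UNIV f" "\<And>t. \<bar>f t\<bar> \<le> \<bar>t\<bar> powr q" and q: "0 < q" "q < 1"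
  obtains U H B where "continuous_on (closure D) U" "\<And>z. z \<in> frontier D \<Longrightarrow> U z = \<phi> z"
    "H holomorphic_on D" "bounded_density R B (\<lambda>w. if w \<in> D then f (U w) else 0)"
    "\<And>z. z \<in> D \<Longrightarrow> U z = newton 0 (\<lambda>w. if w \<in> D then f (U w) else 0) z + Re (H z)"
proof -
  have clD: "compact (closure D)" using D by simp
  have "closed (frontier D)" by simp
  \<comment> \<open>The Dirichlet problem is posed with data on the whole closure, hence the
    extension of \<open>\<phi>\<close>.\<close>
  then obtain \<Phi> where \<Phi>: "continuous_on UNIV \<Phi>" "\<And>z. z \<in> frontier D \<Longrightarrow> \<Phi> z = \<phi> z"
    using Tietze_unbounded[OF \<phi>, of UNIV] by auto
  have "compact (frontier D)" by (rule compact_frontier_bounded[OF D(3)])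
  then obtain M where M: "\<And>z. z \<in> frontier D \<Longrightarrow> \<bar>\<phi> z\<bar> \<le> M"
    using compact_imp_bounded[OF compact_continuous_image[OF \<phi>]] by (force simp: bounded_iff)
  have clR: "norm z \<le> R" if "z \<in> closure D" for z
    using closure_minimal[OF order.trans[OF D(5) ball_subset_cball] closed_cball] that by auto
  have solve: "\<exists>u H. continuous_on (closure D) u \<and> (\<forall>z\<in>frontier D. u z = \<phi> z) \<and> H holomorphic_on D \<and> (\<forall>z\<in>D. u z = V z + Re (H z))"
    if V: "continuous_on (closure D) V" for V
  proof -
    have "continuous_on (closure D) (\<lambda>z. \<Phi> z - V z)"
      by (intro continuous_intros V continuous_on_subset[OF \<Phi>(1)]) auto
    then obtain H where H: "H holomorphic_on D"
      "continuous_on (closure D) (\<lambda>z. if z \<in> D then Re (H z) else \<Phi> z - V z)"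
      using dirichlet_solution[OF D(1-4) sector] by blast
    show ?thesis
    proof (intro exI conjI)
      show "continuous_on (closure D) (\<lambda>z. V z + (if z \<in> D then Re (H z) else \<Phi> z - V z))"
        by (intro continuous_intros V H)
    qed (use H \<Phi> D(1) in \<open>auto simp: frontier_def interior_open\<close>)
  qed
  have ex: "\<exists>u. semilinear_approx D \<phi> F u" if "bounded_density R B F" for F B
    using solve[OF continuous_newton[OF that]] unfolding semilinear_approx_def by blast
  obtain A where A: "0 \<le> A" "\<And>F B z. bounded_density R B F \<Longrightarrow> norm z \<le> R \<Longrightarrow> \<bar>newton 0 F z\<bar> \<le> B * A"
    by (rule newton_bound[of 0 R R]) auto
  obtain L where L: "0 \<le> L" "\<And>F B z z'. bounded_density R B F \<Longrightarrow> \<bar>newton 0 F z - newton 0 F z'\<bar> \<le> B * L * norm (z - z')"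
    by (rule newton_lipschitz[of R]) blast
  \<comment> \<open>The potential is at most \<open>B * A\<close> with
    \<open>B = \<rho> powr q\<close>, and the harmonic part at most \<open>M + B * A\<close>. The
    condition says that solutions for densities bounded by \<open>B\<close> stay below
    \<open>\<rho>\<close>, which in turn keeps \<open>f\<close> of them below \<open>B\<close>;
    large \<open>\<rho>\<close> satisfy it since \<open>q < 1\<close>.\<close>
  obtain \<rho> where \<rho>: "0 < \<rho>" "M + 2 * (\<rho> powr q * A) \<le> \<rho>"
  proof -
    have "((\<lambda>x. M / x + 2 * A * x powr (q - 1)) \<longlongrightarrow> 0) at_top"
      using q by real_asymp
    then have "\<forall>\<^sub>F x in at_top. M / x + 2 * A * x powr (q - 1) < 1" by (rule order_tendstoD) simp
    then have "\<forall>\<^sub>F x in at_top. 0 < x \<and> M / x + 2 * A * x powr (q - 1) < 1"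
      using eventually_gt_at_top[of 0] by eventually_elim auto
    then obtain x where x: "0 < x" "M / x + 2 * A * x powr (q - 1) < 1"
      using eventually_happens'[OF trivial_limit_at_top_linorder] by blast
    then have "(M / x + 2 * A * x powr (q - 1)) * x \<le> 1 * x" by (intro mult_right_mono) auto
    then show thesis using x(1) by (intro that[of x]) (auto simp: algebra_simps powr_diff)
  qed
  define B where "B = \<rho> powr q"
  have B: "0 \<le> B" by (simp add: B_def)
  have fB: "\<bar>f t\<bar> \<le> B" if "\<bar>t\<bar> \<le> \<rho>" for t
    using f(2)[of t] powr_mono2[of q "\<bar>t\<bar>" \<rho>] q that by (simp add: B_def)
  have approx_bound: "\<bar>u z\<bar> \<le> \<rho>" if u: "semilinear_approx D \<phi> F u" and F: "bounded_density R B F" and z: "z \<in> closure D" for F u z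
  proof -
    obtain H where H: "H holomorphic_on D" "\<And>z. z \<in> D \<Longrightarrow> u z = newton 0 F z + Re (H z)"
      and u': "continuous_on (closure D) u" "\<And>z. z \<in> frontier D \<Longrightarrow> u z = \<phi> z"
      using u by (auto simp: semilinear_approx_def)
    have "\<bar>u z - newton 0 F z\<bar> \<le> M + B * A"
    proof (rule Re_holomorphic_max_principle_abs[OF D(1,3) H(1) _ _ _ z])
      show "continuous_on (closure D) (\<lambda>z. u z - newton 0 F z)"
        by (intro continuous_intros u' continuous_newton[OF F])
      show "\<bar>u z - newton 0 F z\<bar> \<le> M + B * A" if "z \<in> frontier D" for z
      proof -
        have "z \<in> closure D" using that by (simp add: frontier_def)
        then show ?thesis using A(2)[OF F clR[of z]] M[OF that] u'(2)[OF that] by linarith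
      qed
    qed (simp add: H)
    then show ?thesis using A(2)[OF F clR[OF z]] \<rho>(2) unfolding B_def by linarith
  qed
  \<comment> \<open>A fixed point up to \<open>\<delta>\<close>: at each \<open>w\<close> the
    density is \<open>f\<close> of a number within \<open>\<delta>\<close> of the value of
    \<open>u\<close> at a point within \<open>\<delta>\<close> of \<open>w\<close>. This is all that
    the limit passage uses of the sampling.\<close>
  have "\<exists>F u. bounded_density R B F \<and> semilinear_approx D \<phi> F u \<and> (\<forall>w. w \<notin> D \<longrightarrow> F w = 0) \<and>
    (\<forall>w\<in>D. \<exists>c\<in>closure D. \<exists>t. dist c w < \<delta> \<and> F w = f t \<and> \<bar>u c - t\<bar> \<le> \<delta>)" if \<delta>: "0 < \<delta>" for \<delta>
  proof -
    have "closure D \<subseteq> (\<Union>c\<in>closure D. ball c \<delta>)" using \<delta> by force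
    then obtain I where I: "I \<subseteq> closure D" "finite I" "closure D \<subseteq> (\<Union>c\<in>I. ball c \<delta>)"
      using compactE_image[OF clD, of "closure D" "\<lambda>c. ball c \<delta>"] by auto
    then obtain cs where cs: "set cs = I" using finite_list by blast
    define m where "m = length cs"
    define c where "c i = cs ! i" for i
    have c: "c i \<in> closure D" if "i < m" for i using that I cs by (auto simp: c_def m_def)
    have cov: "\<exists>i<m. w \<in> ball (c i) \<delta>" if "w \<in> closure D" for w
      using that I cs unfolding c_def m_def by (metis UN_E in_set_conv_nth subsetD)
    \<comment> \<open>Disjoint Borel pieces: \<open>w\<close> is assigned to the first ball of the
      cover that contains it, so the density is constant on each piece.\<close>
    define P where "P i = (D \<inter> ball (c i) \<delta>) - (\<Union>j<i. ball (c j) \<delta>)" for i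
    have PB: "P i \<in> sets borel" for i unfolding P_def using D(1) by auto
    define F where "F x w = (\<Sum>i<m. f (x i) * indicator (P i) w)" for x w
    have Fin: "\<exists>i<m. w \<in> ball (c i) \<delta> \<and> (\<forall>x. F x w = f (x i))" if "w \<in> D" for w
    proof -
      define i where "i = (LEAST i. i < m \<and> w \<in> ball (c i) \<delta>)"
      have "\<exists>i. i < m \<and> w \<in> ball (c i) \<delta>" using cov[of w] that closure_subset[of D] by auto
      then have i: "i < m \<and> w \<in> ball (c i) \<delta>" unfolding i_def by (rule LeastI_ex)
      have least: "\<not> (j < m \<and> w \<in> ball (c j) \<delta>)" if "j < i" for j
        using that unfolding i_def by (rule not_less_Least)
      have "indicator (P j) w = (if j = i then 1 else 0 :: real)" if "j < m" for j
        using i least that \<open>w \<in> D\<close> unfolding P_def by (cases j i rule: linorder_cases) (auto simp: indicator_def)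
      then have "F x w = (\<Sum>j<m. if j = i then f (x i) else 0)" for x
        unfolding F_def by (intro sum.cong) auto
      then show ?thesis using i by auto
    qed
    have Fout: "F x w = 0" if "w \<notin> D" for x w using that by (auto simp: F_def P_def)
    have Fbd: "bounded_density R B (F x)" if x: "\<And>j. j < m \<Longrightarrow> \<bar>x j\<bar> \<le> \<rho>" for x
    proof -
      have "F x \<in> borel_measurable borel" unfolding F_def[abs_def] using PB by measurable
      moreover have "\<bar>F x w\<bar> \<le> B" for w
        using Fin[of w] Fout[of w x] fB x B by (cases "w \<in> D") auto
      ultimately show ?thesis using Fout D(5) unfolding bounded_density_def by blast
    qed
    obtain S where S: "\<And>G. bounded_density R B G \<Longrightarrow> semilinear_approx D \<phi> G (S G)"
      using ex by metis
    \<comment> \<open>The unknowns are the \<open>m\<close> sample values. \<open>S\<close> selects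
      some solution of the linear problem, and its continuity in \<open>x\<close> follows from
      \<open>semilinear_approx_diff\<close>.\<close>
    obtain x where x: "\<And>j. j < m \<Longrightarrow> \<bar>x j\<bar> \<le> \<rho>" "\<And>i. i < m \<Longrightarrow> \<bar>S (F x) (c i) - x i\<bar> \<le> \<delta>"
    proof (rule approximate_fixed_point[OF \<rho>(1) \<delta>, where f = "\<lambda>x i. S (F x) (c i)" and n = m])
      show "\<bar>S (F x) (c i)\<bar> \<le> \<rho>" if "\<And>j. j < m \<Longrightarrow> \<bar>x j\<bar> \<le> \<rho>" "i < m" for x i
        using that by (intro approx_bound[OF S] Fbd c)
      fix e :: real assume e: "0 < e"
      \<comment> \<open>Densities within \<open>e'\<close> give potentials within
        \<open>e' * A\<close> and solutions within \<open>2 * (e' * A)\<close>; \<open>A + 1\<close>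
        avoids division by 0.\<close>
      define e' where "e' = e / (4 * (A + 1))"
      have e': "0 < e'" "2 * (e' * A) < e"
      proof -
        show "0 < e'" using e A(1) by (simp add: e'_def)
        have "e' * (4 * (A + 1)) = e" using A(1) by (simp add: e'_def)
        then have "4 * (e' * A) + 4 * e' = e" by (simp add: algebra_simps)
        moreover have "0 \<le> e' * A" using \<open>0 < e'\<close> A(1) by simp
        ultimately show "2 * (e' * A) < e" using \<open>0 < e'\<close> by linarith
      qed
      have "uniformly_continuous_on {- \<rho>..\<rho>} f"
        by (intro compact_uniformly_continuous continuous_on_subset[OF f(1)]) auto
      then obtain d where d: "0 < d" "\<And>s t. s \<in> {- \<rho>..\<rho>} \<Longrightarrow> t \<in> {- \<rho>..\<rho>} \<Longrightarrow> dist t s < d \<Longrightarrow> dist (f t) (f s) < e'"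
        using e'(1) unfolding uniformly_continuous_on_def by metis
      have "\<bar>S (F x) (c i) - S (F y) (c i)\<bar> < e"
        if xy: "\<And>j. j < m \<Longrightarrow> \<bar>x j\<bar> \<le> \<rho> \<and> \<bar>y j\<bar> \<le> \<rho> \<and> \<bar>x j - y j\<bar> < d" and i: "i < m" for x y i
      proof -
        have Fx: "bounded_density R B (F x)" and Fy: "bounded_density R B (F y)" using xy by (auto intro!: Fbd)
        have "\<bar>F x w - F y w\<bar> \<le> e'" for w
        proof (cases "w \<in> D")
          case True
          then obtain j where j: "j < m" "F x w = f (x j)" "F y w = f (y j)" using Fin by blast
          have "dist (f (x j)) (f (y j)) < e'" using xy[OF j(1)] by (intro d) (auto simp: dist_real_def abs_le_iff)
          then show ?thesis by (simp add: j dist_real_def)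
        qed (use Fout e' in auto)
        then have Fd: "bounded_density R e' (\<lambda>w. F x w - F y w)" by (rule bounded_density_diff[OF Fx Fy])
        obtain H' where H': "H' holomorphic_on D" "\<And>z. z \<in> D \<Longrightarrow> S (F y) z = newton 0 (F y) z + Re (H' z)"
          and Sy: "continuous_on (closure D) (S (F y))" "\<And>z. z \<in> frontier D \<Longrightarrow> S (F y) z = \<phi> z"
          using S[OF Fy] by (auto simp: semilinear_approx_def)
        have "\<bar>S (F x) (c i) - S (F y) (c i)\<bar> \<le> 2 * (e' * A)"
        proof (rule semilinear_approx_diff[OF D(1,3) S[OF Fx] Fx Sy H' continuous_newton[OF Fy] _ c[OF i]])
          show "\<bar>newton 0 (F x) z - newton 0 (F y) z\<bar> \<le> e' * A" if "z \<in> closure D" for z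
            unfolding newton_diff[OF Fx Fy] by (rule A(2)[OF Fd clR[OF that]])
        qed
        then show ?thesis using e'(2) by linarith
      qed
      then show "\<exists>d>0. \<forall>x y. (\<forall>j<m. \<bar>x j\<bar> \<le> \<rho> \<and> \<bar>y j\<bar> \<le> \<rho> \<and> \<bar>x j - y j\<bar> < d) \<longrightarrow>
          (\<forall>i<m. \<bar>S (F x) (c i) - S (F y) (c i)\<bar> < e)"
        using d(1) by blast
    next
      fix x :: "nat \<Rightarrow> real"
      assume "\<And>j. j < m \<Longrightarrow> \<bar>x j\<bar> \<le> \<rho>" "\<And>i. i < m \<Longrightarrow> \<bar>S (F x) (c i) - x i\<bar> \<le> \<delta>"
      then show thesis by (rule that)
    qed
    have Fx: "bounded_density R B (F x)" by (rule Fbd[OF x(1)])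
    show ?thesis
    proof (intro exI conjI ballI allI impI)
      show "bounded_density R B (F x)" "semilinear_approx D \<phi> (F x) (S (F x))" using Fx S by auto
      show "F x w = 0" if "w \<notin> D" for w using that by (rule Fout)
      fix w assume "w \<in> D"
      then obtain i where i: "i < m" "w \<in> ball (c i) \<delta>" "F x w = f (x i)" using Fin by blast
      then show "\<exists>c\<in>closure D. \<exists>t. dist c w < \<delta> \<and> F x w = f t \<and> \<bar>S (F x) c - t\<bar> \<le> \<delta>"
        using c[OF i(1)] x(2)[OF i(1)] by auto
    qed
  qed
  then have "\<forall>n. \<exists>F u. bounded_density R B F \<and> semilinear_approx D \<phi> F u \<and> (\<forall>w. w \<notin> D \<longrightarrow> F w = 0) \<and>
    (\<forall>w\<in>D. \<exists>c\<in>closure D. \<exists>t. dist c w < inverse (real (Suc n)) \<and> F w = f t \<and> \<bar>u c - t\<bar> \<le> inverse (real (Suc n)))"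
    by simp
  then obtain F u where F: "\<And>n. bounded_density R B (F n)" and u: "\<And>n. semilinear_approx D \<phi> (F n) (u n)"
    and Fout: "\<And>n w. w \<notin> D \<Longrightarrow> F n w = 0"
    and Fin: "\<And>n w. w \<in> D \<Longrightarrow> \<exists>c\<in>closure D. \<exists>t. dist c w < inverse (real (Suc n)) \<and> F n w = f t \<and> \<bar>u n c - t\<bar> \<le> inverse (real (Suc n))"
    by metis
  \<comment> \<open>Arzela-Ascoli is applied to the potentials, which are equi-Lipschitz; the
    solutions \<open>u n\<close> follow uniformly by the maximum principle, without a modulus of
    continuity of their own.\<close>
  obtain V k where V: "continuous_on (closure D) V" and k: "strict_mono (k :: nat \<Rightarrow> nat)"
    and Vlim: "\<And>e. 0 < e \<Longrightarrow> \<exists>N. \<forall>n z. n \<ge> N \<and> z \<in> closure D \<longrightarrow> norm (newton 0 (F (k n)) z - V z) < e"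
  proof (rule Arzela_Ascoli[OF clD, where \<F> = "\<lambda>n. newton 0 (F n)" and M = "B * A"])
    show "norm (newton 0 (F n) z) \<le> B * A" if "z \<in> closure D" for n z
      using A(2)[OF F clR[OF that]] by simp
    fix x :: complex and e :: real assume "0 < e"
    have "norm (newton 0 (F n) x - newton 0 (F n) y) < e" if "norm (x - y) < e / (B * L + 1)" for n y
    proof -
      have BL: "0 \<le> B * L" using B L(1) by simp
      have "norm (newton 0 (F n) x - newton 0 (F n) y) \<le> B * L * norm (x - y)" using L(2)[OF F] by simp
      also have "\<dots> \<le> (B * L + 1) * norm (x - y)" by (intro mult_right_mono) auto
      also have "\<dots> < e" using that BL by (simp add: pos_less_divide_eq mult.commute)
      finally show ?thesis .
    qed
    moreover have "0 < e / (B * L + 1)" using \<open>0 < e\<close> B L(1) by (simp add: add_nonneg_pos)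
    ultimately show "\<exists>d>0. \<forall>n y. y \<in> closure D \<and> norm (x - y) < d \<longrightarrow> norm (newton 0 (F n) x - newton 0 (F n) y) < e"
      by blast
  qed auto
  obtain U H where U: "continuous_on (closure D) U" "\<And>z. z \<in> frontier D \<Longrightarrow> U z = \<phi> z"
    and H: "H holomorphic_on D" "\<And>z. z \<in> D \<Longrightarrow> U z = V z + Re (H z)"
    using solve[OF V] by blast
  have ulim: "\<exists>N. \<forall>n\<ge>N. \<forall>z\<in>closure D. \<bar>u (k n) z - U z\<bar> < e" if "0 < e" for e
  proof -
    obtain N where N: "\<And>n z. n \<ge> N \<Longrightarrow> z \<in> closure D \<Longrightarrow> norm (newton 0 (F (k n)) z - V z) < e / 4"
      using Vlim[of "e / 4"] \<open>0 < e\<close> by auto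
    have "\<bar>u (k n) z - U z\<bar> < e" if "n \<ge> N" "z \<in> closure D" for n z
    proof -
      have "\<bar>u (k n) z - U z\<bar> \<le> 2 * (e / 4)"
      proof (rule semilinear_approx_diff[OF D(1,3) u F U H V _ that(2)])
        show "\<bar>newton 0 (F (k n)) z - V z\<bar> \<le> e / 4" if "z \<in> closure D" for z
          using N[OF \<open>n \<ge> N\<close> that] by simp
      qed
      then show ?thesis using \<open>0 < e\<close> by linarith
    qed
    then show ?thesis by blast
  qed
  define G where "G w = (if w \<in> D then f (U w) else 0)" for w
  \<comment> \<open>The density at \<open>w\<close> is \<open>f (t n)\<close>, where
    \<open>t n\<close> is close to \<open>u n (c n)\<close> and \<open>c n\<close> close to
    \<open>w\<close>. Along the subsequence, uniform convergence to the continuous \<open>U\<close>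
    gives \<open>t (k n) \<longlonglongrightarrow> U w\<close>.\<close>
  have Flim: "(\<lambda>n. F (k n) w) \<longlonglongrightarrow> G w" for w
  proof (cases "w \<in> D")
    case True
    obtain c t where c: "\<And>n. c n \<in> closure D" "\<And>n. dist (c n) w < inverse (real (Suc n))"
      and t: "\<And>n. F n w = f (t n)" "\<And>n. \<bar>u n (c n) - t n\<bar> \<le> inverse (real (Suc n))"
      using Fin[OF True] by metis
    have inv: "(\<lambda>n. inverse (real (Suc (k n)))) \<longlonglongrightarrow> 0"
      using LIMSEQ_subseq_LIMSEQ[OF LIMSEQ_inverse_real_of_nat k] by (simp add: o_def)
    have "(\<lambda>n. dist (c (k n)) w) \<longlonglongrightarrow> 0"
    proof (rule Lim_null_comparison[OF always_eventually inv], rule allI)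
      show "norm (dist (c (k n)) w) \<le> inverse (real (Suc (k n)))" for n
        using less_imp_le[OF c(2)[of "k n"]] by simp
    qed
    then have "(\<lambda>n. c (k n)) \<longlonglongrightarrow> w" by (subst tendsto_dist_iff)
    then have Uc: "(\<lambda>n. U (c (k n))) \<longlonglongrightarrow> U w"
      using U(1) c(1) True closure_subset[of D] by (auto intro: continuous_on_tendsto_compose)
    have "(\<lambda>n. u (k n) (c (k n)) - U (c (k n))) \<longlonglongrightarrow> 0"
    proof (rule LIMSEQ_I)
      fix e :: real assume "0 < e"
      then show "\<exists>N. \<forall>n\<ge>N. norm (u (k n) (c (k n)) - U (c (k n)) - 0) < e"
        using ulim[of e] c(1) by auto
    qed
    moreover have "(\<lambda>n. t (k n) - u (k n) (c (k n))) \<longlonglongrightarrow> 0"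
      by (rule Lim_null_comparison[OF _ inv]) (use t(2) in \<open>auto simp: abs_minus_commute\<close>)
    ultimately have "(\<lambda>n. (u (k n) (c (k n)) - U (c (k n))) + (t (k n) - u (k n) (c (k n))) + U (c (k n))) \<longlonglongrightarrow> 0 + 0 + U w"
      by (intro tendsto_intros Uc)
    then have "(\<lambda>n. t (k n)) \<longlonglongrightarrow> U w" by simp
    then have "(\<lambda>n. f (t (k n))) \<longlonglongrightarrow> f (U w)"
      using f(1) by (auto intro: continuous_on_tendsto_compose)
    then show ?thesis using True by (simp add: G_def t(1))
  qed (simp add: G_def Fout)
  have G: "bounded_density R B G" "\<And>z. (\<lambda>n. newton 0 (F (k n)) z) \<longlonglongrightarrow> newton 0 G z"
    using newton_tendsto[OF F Flim] by auto
  have "V z = newton 0 G z" if "z \<in> closure D" for z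
  proof (rule LIMSEQ_unique[OF LIMSEQ_I G(2)])
    fix e :: real assume "0 < e"
    then show "\<exists>N. \<forall>n\<ge>N. norm (newton 0 (F (k n)) z - V z) < e" using Vlim[of e] that by blast
  qed
  then have "U z = newton 0 G z + Re (H z)" if "z \<in> D" for z
    using H(2)[OF that] that closure_subset[of D] by auto
  then show thesis using that[OF U H(1)] G(1) unfolding G_def[abs_def] by blast
qed

section \<open>Weak gradients\<close>

text \<open>By translation invariance all difference quotients of \<open>\<Phi>\<close> have integral zero.\<close>

lemma integral_GDERIV_compact_support:
  fixes \<Phi> :: "'a::euclidean_space \<Rightarrow> real"
  assumes der: "\<And>z. GDERIV \<Phi> z :> g z" and g: "continuous_on UNIV g"
    and K: "compact K" "\<And>z. z \<notin> K \<Longrightarrow> \<Phi> z = 0"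
  shows "(LINT z|lborel. b \<bullet> g z) = 0"
proof -
  obtain r where r: "0 < r" "K \<subseteq> cball 0 r"
  proof -
    obtain r where "0 < r" "\<And>x. x \<in> K \<Longrightarrow> norm x \<le> r"
      using compact_imp_bounded[OF K(1)] unfolding bounded_pos by blast
    then show thesis by (intro that[of r]) auto
  qed
  \<comment> \<open>As the increments \<open>h n\<close> are at most 1, both \<open>z\<close> and
    its translate by \<open>h n *\<^sub>R b\<close> are outside the support once
    \<open>norm z > T\<close>.\<close>
  define T where "T = r + norm b"
  have K0: "\<Phi> z = 0" if "r < norm z" for z using r(2) K(2) that by (meson mem_cball_0 not_le subsetD)
  have "bounded (g ` cball 0 (T + norm b))"
    by (intro compact_imp_bounded compact_continuous_image continuous_on_subset[OF g]) auto
  then obtain M where M: "\<And>z. norm z \<le> T + norm b \<Longrightarrow> norm (g z) \<le> M"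
    by (force simp: bounded_iff)
  have contP: "continuous_on UNIV \<Phi>" by (rule GDERIV_continuous_on[OF der])
  have [measurable]: "\<Phi> \<in> borel_measurable borel" "g \<in> borel_measurable borel"
    using contP g by (auto intro: borel_measurable_continuous_onI)
  have intP: "integrable lborel \<Phi>"
  proof -
    have "integrable lborel (\<lambda>z. indicator (cball 0 r) z *\<^sub>R \<Phi> z)"
      using borel_integrable_compact[of "cball 0 r" \<Phi>] continuous_on_subset[OF contP] by auto
    moreover have "(\<lambda>z. indicator (cball 0 r) z *\<^sub>R \<Phi> z) = \<Phi>"
    proof
      show "indicator (cball 0 r) z *\<^sub>R \<Phi> z = \<Phi> z" for z
        by (cases "norm z \<le> r") (auto simp: K0)
    qed
    ultimately show ?thesis by metis
  qed
  define h where "h n = 1 / (real n + 1)" for n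
  have h: "0 < h n" "h n \<le> 1" for n by (auto simp: h_def)
  have h0: "h \<longlonglongrightarrow> 0" unfolding h_def by real_asymp
  define Q where "Q n z = (\<Phi> (z + h n *\<^sub>R b) - \<Phi> z) / h n" for n z
  have zero: "(LINT z|lborel. Q n z) = 0" for n
  proof -
    have tr: "distr lborel borel ((+) (h n *\<^sub>R b)) = (lborel :: 'a measure)" by (rule lborel_distr_plus)
    have i: "integrable lborel (\<lambda>z. \<Phi> (h n *\<^sub>R b + z))"
      using intP by (subst (asm) tr[symmetric], subst (asm) integrable_distr_eq) auto
    have "(LINT z|lborel. \<Phi> (h n *\<^sub>R b + z)) = (LINT z|distr lborel borel ((+) (h n *\<^sub>R b)). \<Phi> z)"
      by (subst integral_distr) auto
    then have "(LINT z|lborel. \<Phi> (h n *\<^sub>R b + z)) = (LINT z|lborel. \<Phi> z)" by (simp add: tr)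
    then have "(LINT z|lborel. (\<Phi> (h n *\<^sub>R b + z) - \<Phi> z) / h n) = 0"
      using i intP by simp
    then show ?thesis by (simp add: Q_def add.commute)
  qed
  have "(\<lambda>n. LINT z|lborel. Q n z) \<longlonglongrightarrow> (LINT z|lborel. b \<bullet> g z)"
  proof (rule integral_dominated_convergence)
    show "(\<lambda>z. b \<bullet> g z) \<in> borel_measurable lborel" "\<And>n. Q n \<in> borel_measurable lborel"
      unfolding Q_def by measurable
    show "integrable lborel (\<lambda>z. M * norm b * indicator (cball (0::'a) T) z)"
      using emeasure_lborel_cball_finite[of "0::'a" T] by simp
    have "(\<lambda>n. Q n z) \<longlonglongrightarrow> b \<bullet> g z" for z
    proof -
      have "((\<lambda>s. z + s *\<^sub>R b) has_derivative (\<lambda>s. s *\<^sub>R b)) (at 0)"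
        by (auto intro!: derivative_eq_intros)
      moreover have "(\<Phi> has_derivative (\<lambda>d. d \<bullet> g z)) (at (z + 0 *\<^sub>R b))" using der[of z] by (simp add: gderiv_def)
      ultimately have "((\<lambda>s. \<Phi> (z + s *\<^sub>R b)) has_derivative (\<lambda>s. (s *\<^sub>R b) \<bullet> g z)) (at 0)"
        by (rule has_derivative_compose)
      then have "((\<lambda>s. \<Phi> (z + s *\<^sub>R b)) has_real_derivative (b \<bullet> g z)) (at 0)"
        by (simp add: has_field_derivative_def mult_commute_abs)
      then have "((\<lambda>s. (\<Phi> (z + s *\<^sub>R b) - \<Phi> z) / s) \<longlongrightarrow> b \<bullet> g z) (at 0)"
        by (simp add: has_field_derivative_iff)
      moreover have "filterlim h (at 0) sequentially"
        using h0 h by (auto simp: filterlim_at less_imp_neq[symmetric])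
      ultimately show ?thesis unfolding Q_def by (rule filterlim_compose)
    qed
    then show "AE z in lborel. (\<lambda>n. Q n z) \<longlonglongrightarrow> b \<bullet> g z" by (rule AE_I2)
    have "norm (Q n z) \<le> M * norm b * indicator (cball 0 T) z" for n z
    proof (cases "norm z \<le> T")
      case True
      have hb: "norm (h n *\<^sub>R b) \<le> norm b" using h[of n] by (simp add: mult_left_le_one_le)
      have "norm (\<Phi> (z + h n *\<^sub>R b) - \<Phi> z) \<le> M * norm ((z + h n *\<^sub>R b) - z)"
      proof (rule differentiable_bound[where S = "cball 0 (T + norm b)" and f' = "\<lambda>x d. d \<bullet> g x"])
        show "(\<Phi> has_derivative (\<lambda>d. d \<bullet> g x)) (at x within cball 0 (T + norm b))" for x
          using der[of x] by (auto simp: gderiv_def intro: has_derivative_at_withinI)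
        show "onorm (\<lambda>d. d \<bullet> g x) \<le> M" if "x \<in> cball 0 (T + norm b)" for x
        proof (rule onorm_le)
          fix d :: 'a
          have "norm (d \<bullet> g x) \<le> norm d * norm (g x)" unfolding real_norm_def by (rule Cauchy_Schwarz_ineq2)
          also have "\<dots> \<le> norm d * M" using that by (intro mult_left_mono M) auto
          finally show "norm (d \<bullet> g x) \<le> M * norm d" by (simp add: mult.commute)
        qed
        show "z + h n *\<^sub>R b \<in> cball 0 (T + norm b)"
          using True hb norm_triangle_ineq[of z "h n *\<^sub>R b"] by simp
        show "z \<in> cball 0 (T + norm b)" using True by (simp add: add_increasing2)
      qed simp
      then have "\<bar>\<Phi> (z + h n *\<^sub>R b) - \<Phi> z\<bar> / h n \<le> M * (h n * norm b) / h n"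
        using h[of n] by (intro divide_right_mono) auto
      then show ?thesis using True h[of n] by (simp add: Q_def)
    next
      case False
      have hb: "norm (h n *\<^sub>R b) \<le> norm b" using h[of n] by (simp add: mult_left_le_one_le)
      have "norm z \<le> norm (z + h n *\<^sub>R b) + norm (h n *\<^sub>R b)"
        using norm_triangle_ineq4[of "z + h n *\<^sub>R b" "h n *\<^sub>R b"] by simp
      then have "r < norm (z + h n *\<^sub>R b)" "r < norm z"
        using False hb norm_ge_zero[of b] unfolding T_def by linarith+
      then show ?thesis by (simp add: Q_def K0 False)
    qed
    then show "AE z in lborel. norm (Q n z) \<le> M * norm b * indicator (cball 0 T) z" for n by (rule AE_I2)
  qed
  then show ?thesis using zero LIMSEQ_unique[OF _ tendsto_const] by simp
qed

lemma smooth_test_function: "test_function D \<psi> \<Longrightarrow> smooth \<psi>"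
  by (simp add: test_function_def smooth_def)

lemma test_function_support:
  assumes "test_function D \<psi>"
  obtains K where "compact K" "K \<subseteq> D" "\<And>z. z \<notin> K \<Longrightarrow> \<psi> z = 0"
  using assms unfolding test_function_def compact_support_in_def by (metis DiffI)

lemma GDERIV_zero_on_open:
  fixes \<psi> :: "'a::real_inner \<Rightarrow> real"
  assumes "GDERIV \<psi> z :> g" "open S" "z \<in> S" "\<And>x. x \<in> S \<Longrightarrow> \<psi> x = 0"
  shows "h \<bullet> g = 0"
proof -
  have "((\<lambda>x. 0::real) has_derivative (\<lambda>h. h \<bullet> g)) (at z)"
    by (rule has_derivative_transform_within_open[OF assms(1)[unfolded gderiv_def] assms(2,3)]) (simp add: assms(4))
  from has_derivative_unique[OF this has_derivative_const] show ?thesis by meson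
qed

text \<open>By inner regularity it is enough to look at compact subsets of
  \<open>{z. 0 < g z}\<close> and \<open>{z. g z < 0}\<close>: there \<open>g\<close> has one sign
  and integral 0, so they are null.\<close>

lemma AE_eq_zero_of_compact_integrals:
  fixes g :: "'a::euclidean_space \<Rightarrow> real"
  assumes g: "integrable lebesgue g"
    and zero: "\<And>C. compact C \<Longrightarrow> (LINT z|lebesgue. indicator C z * g z) = 0"
  shows "AE z in lebesgue. g z = 0"
proof -
  \<comment> \<open>The factor \<open>s\<close> handles both signs at once; it is taken to be 1 and
    -1 at the end.\<close>
  have null: "{z. 0 < s * g z} \<in> null_sets lebesgue" for s :: real
  proof -
    define N where "N = {z. 0 < s * g z}"
    have meas: "(\<lambda>z. s * g z) \<in> borel_measurable lebesgue" using g by auto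
    have NS: "N \<in> sets lebesgue"
      unfolding N_def using borel_measurable_less[OF borel_measurable_const meas, of 0] by simp
    have compact_null: "C \<in> null_sets lebesgue" if C: "compact C" "C \<subseteq> N" for C
    proof -
      have CS: "C \<in> sets lebesgue" using compact_imp_closed[OF C(1)] by auto
      have "integrable lebesgue (\<lambda>z. indicator C z * (s * g z))"
        using integrable_mult_indicator[OF CS, of "\<lambda>z. s * g z"] g by simp
      moreover have "AE z in lebesgue. 0 \<le> indicator C z * (s * g z)"
        using C(2) by (intro AE_I2) (auto simp: N_def indicator_def less_imp_le)
      moreover have "(LINT z|lebesgue. indicator C z * (s * g z)) = s * (LINT z|lebesgue. indicator C z * g z)"
        by (subst integral_mult_right_zero[symmetric]) (simp add: mult_ac)
      then have "(LINT z|lebesgue. indicator C z * (s * g z)) = 0" using zero[OF C(1)] by simp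
      ultimately have "AE z in lebesgue. indicator C z * (s * g z) = 0"
        using integral_nonneg_eq_0_iff_AE by blast
      then have "AE z in lebesgue. z \<notin> C"
        by eventually_elim (use C(2) in \<open>auto simp: N_def indicator_def\<close>)
      then show ?thesis using AE_iff_null_sets[OF CS] by simp
    qed
    have "emeasure lebesgue N \<le> ennreal e" if "0 < e" for e
    proof -
      obtain T where T: "closed T" "T \<subseteq> N" "emeasure lebesgue (N - T) < ennreal e"
        using sets_lebesgue_inner_closed[OF NS \<open>0 < e\<close>] by metis
      have TS: "T \<in> sets lebesgue" using T(1) by auto
      have "T = (\<Union>n. T \<inter> cball 0 (real n))" using real_arch_simple by auto
      moreover have "T \<inter> cball 0 (real n) \<in> null_sets lebesgue" for n
        using T by (intro compact_null) (auto simp: closed_Int_compact)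
      ultimately have "T \<in> null_sets lebesgue" by (metis null_sets_UN)
      then have "emeasure lebesgue N = emeasure lebesgue (N - T)"
        by (rule emeasure_Diff_null_set[symmetric, OF _ NS])
      then show ?thesis using T(3) by simp
    qed
    then have "emeasure lebesgue N = 0"
      using ennreal_le_epsilon[of 0 "emeasure lebesgue N"] by simp
    then show ?thesis using NS unfolding N_def by auto
  qed
  have "AE z in lebesgue. z \<notin> {z. 0 < 1 * g z}" "AE z in lebesgue. z \<notin> {z. 0 < (-1) * g z}"
    using AE_not_in[OF null[of 1]] AE_not_in[OF null[of "-1"]] by simp_all
  then show ?thesis by eventually_elim auto
qed

text \<open>Integrals of a locally integrable function against indicators of compact sets are limits of
  integrals against cutoffs with shrinking support.\<close>

lemma fundamental_lemma_AE:
  fixes g :: "'a::euclidean_space \<Rightarrow> real"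
  assumes "open S" and g: "L1_loc S g"
    and test: "\<And>\<psi>. test_function S \<psi> \<Longrightarrow> (LINT z:S|lebesgue. g z * \<psi> z) = 0"
  shows "AE z in lebesgue. z \<in> S \<longrightarrow> g z = 0"
proof -
  have compact_zero: "(LINT z:K|lebesgue. g z) = 0" if K: "compact K" "K \<subseteq> S" for K
  proof -
    obtain d where d: "0 < d" "(\<Union>x\<in>K. cball x d) \<subseteq> S"
      using compact_subset_open_imp_cball_epsilon_subset[OF K(1) \<open>open S\<close> K(2)] by blast
    \<comment> \<open>Neighbourhoods shrinking to \<open>K\<close> inside a fixed compact subset of
      \<open>S\<close>, on which \<open>g\<close> is integrable and dominates.\<close>
    define O' where "O' n = (\<Union>x\<in>K. ball x (d / (real n + 1)))" for n
    have O': "open (O' n)" "K \<subseteq> O' n" for n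
      using d(1) by (auto simp: O'_def)
    have ex: "\<exists>\<zeta>. test_function (O' n) \<zeta> \<and> (\<forall>z\<in>K. \<zeta> z = 1) \<and> (\<forall>z. 0 \<le> \<zeta> z \<and> \<zeta> z \<le> 1)" for n
      by (rule smooth_cutoff[OF K(1) O'(1)[of n] O'(2)[of n]]) blast
    then obtain \<zeta> where \<zeta>: "\<And>n. test_function (O' n) (\<zeta> n)" "\<And>n z. z \<in> K \<Longrightarrow> \<zeta> n z = 1"
      "\<And>n z. 0 \<le> \<zeta> n z \<and> \<zeta> n z \<le> 1" by metis
    define K1 where "K1 = (\<Union>x\<in>K. cball x d)"
    have K1: "compact K1" "K1 \<subseteq> S" unfolding K1_def using d(2) by (auto intro: compact_minkowski_sum_cball K)
    have KK1: "K \<subseteq> K1" unfolding K1_def using d(1) by force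
    have O1: "O' n \<subseteq> K1" for n
    proof -
      have "d / (real n + 1) \<le> d" using d(1) by (simp add: field_simps)
      then show ?thesis unfolding O'_def K1_def by force
    qed
    have gK1: "integrable lebesgue (\<lambda>z. indicator K1 z *\<^sub>R g z)"
      using g K1 unfolding L1_loc_def set_integrable_def by blast
    have zero: "(LINT z|lebesgue. indicator K1 z * g z * \<zeta> n z) = 0" for n
    proof -
      have "test_function S (\<zeta> n)"
      proof -
        have "O' n \<subseteq> S" using O1[of n] K1 by blast
        then show ?thesis using \<zeta>(1)[of n] unfolding test_function_def compact_support_in_def
          by (metis (no_types, lifting) DiffE DiffI order_trans subsetD)
      qed
      from test[OF this] have "(LINT z|lebesgue. indicator S z * (g z * \<zeta> n z)) = 0"
        by (simp add: set_lebesgue_integral_def)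
      moreover have "\<zeta> n z = 0" if "z \<notin> K1" for z
        using \<zeta>(1)[of n] O1[of n] that by (auto simp: test_function_def)
      then have "indicator S z * (g z * \<zeta> n z) = indicator K1 z * g z * \<zeta> n z" for z
        using K1 by (auto simp: indicator_def)
      ultimately show ?thesis by simp
    qed
    have "(\<lambda>n. LINT z|lebesgue. indicator K1 z * g z * \<zeta> n z) \<longlonglongrightarrow> (LINT z|lebesgue. indicator K z * g z)"
    proof (rule integral_dominated_convergence)
      have m: "(\<lambda>z. indicator K1 z * g z) \<in> borel_measurable lebesgue" using gK1 by auto
      have "\<zeta> n \<in> borel_measurable lebesgue" for n
        using smooth_continuous[OF smooth_test_function[OF \<zeta>(1)[of n]]]
        by (intro measurable_completion) (simp add: borel_measurable_continuous_onI)
      then show "(\<lambda>z. indicator K1 z * g z * \<zeta> n z) \<in> borel_measurable lebesgue" for n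
        by (intro borel_measurable_times m)
      have "(\<lambda>z. indicator K z * (indicator K1 z * g z)) \<in> borel_measurable lebesgue"
        using K(1) by (intro borel_measurable_times m borel_measurable_indicator) (auto dest: compact_imp_closed)
      moreover have "indicator K z * (indicator K1 z * g z) = indicator K z * g z" for z
        using KK1 by (auto simp: indicator_def)
      ultimately show "(\<lambda>z. indicator K z * g z) \<in> borel_measurable lebesgue" by simp
      show "integrable lebesgue (\<lambda>z. \<bar>indicator K1 z * g z\<bar>)" using gK1 by simp
      have "norm (indicator K1 z * g z * \<zeta> n z) \<le> \<bar>indicator K1 z * g z\<bar>" for n z
        using \<zeta>(3)[of n z] by (simp add: abs_mult mult_left_le)
      then show "AE z in lebesgue. norm (indicator K1 z * g z * \<zeta> n z) \<le> \<bar>indicator K1 z * g z\<bar>" for n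
        by (rule AE_I2)
      have "(\<lambda>n. indicator K1 z * g z * \<zeta> n z) \<longlonglongrightarrow> indicator K z * g z" for z
      proof (cases "z \<in> K")
        case True
        then have "z \<in> K1" using d(1) by (auto simp: K1_def intro!: bexI[of _ z])
        then show ?thesis using True by (simp add: \<zeta>(2))
      next
        case False
        have "\<forall>\<^sub>F n in sequentially. z \<notin> O' n"
        proof -
          have "open (- K)" using K(1) compact_imp_closed by auto
          then obtain \<epsilon> where \<epsilon>: "0 < \<epsilon>" "ball z \<epsilon> \<subseteq> - K" using False by (meson ComplI openE)
          have "(\<lambda>n. d / (real n + 1)) \<longlonglongrightarrow> 0" by real_asymp
          then have "\<forall>\<^sub>F n in sequentially. d / (real n + 1) < \<epsilon>" using \<epsilon>(1) by (rule order_tendstoD(2))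
          then show ?thesis
          proof eventually_elim
            case (elim n)
            show ?case
            proof
              assume "z \<in> O' n"
              then obtain x where "x \<in> K" "dist x z < d / (real n + 1)" by (auto simp: O'_def)
              then have "x \<in> ball z \<epsilon>" using elim by (simp add: dist_commute)
              then show False using \<epsilon>(2) \<open>x \<in> K\<close> by blast
            qed
          qed
        qed
        then have "\<forall>\<^sub>F n in sequentially. indicator K1 z * g z * \<zeta> n z = 0"
          by eventually_elim (use \<zeta>(1) in \<open>auto simp: test_function_def\<close>)
        then show ?thesis using False by (simp add: tendsto_eventually)
      qed
      then show "AE z in lebesgue. (\<lambda>n. indicator K1 z * g z * \<zeta> n z) \<longlonglongrightarrow> indicator K z * g z" by (rule AE_I2)
    qed
    then show ?thesis using zero LIMSEQ_unique[OF _ tendsto_const] by (simp add: set_lebesgue_integral_def)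
  qed
  \<comment> \<open>Cut off to \<open>K\<close>, \<open>g\<close> becomes integrable on the whole
    space, and its integral over a compact \<open>C\<close> is the one over the compact set
    \<open>C \<inter> K\<close>.\<close>
  have null: "AE z in lebesgue. z \<in> K \<longrightarrow> g z = 0" if K: "compact K" "K \<subseteq> S" for K
  proof -
    define g0 where "g0 z = indicator K z * g z" for z
    have gi: "integrable lebesgue g0"
      using g K unfolding L1_loc_def set_integrable_def g0_def[abs_def] by simp
    have "AE z in lebesgue. g0 z = 0"
    proof (rule AE_eq_zero_of_compact_integrals)
      show "integrable lebesgue g0" by (rule gi)
      show "(LINT z|lebesgue. indicator C z * g0 z) = 0" if "compact C" for C
      proof -
        have "(LINT z:(C \<inter> K)|lebesgue. g z) = 0" using that K by (intro compact_zero compact_Int) auto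
        then show ?thesis
          by (simp add: set_lebesgue_integral_def g0_def indicator_inter_arith mult.assoc)
      qed
    qed
    then show ?thesis by eventually_elim (auto simp: g0_def)
  qed
  have "\<exists>C :: nat \<Rightarrow> 'a set. (\<forall>n. compact (C n)) \<and> (\<forall>n. C n \<subseteq> S) \<and> (\<Union>n. C n) = S"
    by (rule open_Union_compact_subsets[OF \<open>open S\<close>]) blast
  then obtain C :: "nat \<Rightarrow> 'a set"
    where C: "\<And>n. compact (C n)" "\<And>n. C n \<subseteq> S" "(\<Union>n. C n) = S" by blast
  have "AE z in lebesgue. \<forall>n::nat. z \<in> C n \<longrightarrow> g z = 0"
    unfolding AE_all_countable using null[OF C(1,2)] by blast
  then show ?thesis by eventually_elim (use C(3) in blast)
qed

section \<open>Zero extensions and classical gradients\<close>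

text \<open>The open sets \<open>D\<close> and \<open>- K\<close> cover the space, and the extension
  is continuous on each.\<close>

lemma zero_extension:
  fixes f :: "'a::euclidean_space \<Rightarrow> 'b::euclidean_space"
  assumes D: "open D" and K: "compact K" "K \<subseteq> D" and f: "continuous_on D f" "\<And>z. z \<in> D \<Longrightarrow> z \<notin> K \<Longrightarrow> f z = 0"
  shows "continuous_on UNIV (\<lambda>z. if z \<in> D then f z else 0)"
    and "integrable lborel (\<lambda>z. if z \<in> D then f z else 0)"
proof -
  have "continuous_on (D \<union> - K) (\<lambda>z. if z \<in> D then f z else 0)"
  proof (rule continuous_on_open_Un[OF D])
    show "open (- K)" using compact_imp_closed[OF K(1)] by (simp add: open_Compl)
    show "continuous_on D (\<lambda>z. if z \<in> D then f z else 0)"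
      using f(1) by (simp cong: continuous_on_cong)
    have "(if z \<in> D then f z else 0) = 0" if "z \<in> - K" for z using f(2) that by auto
    then show "continuous_on (- K) (\<lambda>z. if z \<in> D then f z else 0)"
      by (intro continuous_on_eq[OF continuous_on_const[of _ 0]]) metis
  qed
  moreover have "D \<union> - K = UNIV" using K by auto
  ultimately show cont: "continuous_on UNIV (\<lambda>z. if z \<in> D then f z else 0)" by simp
  have "integrable lborel (\<lambda>z. indicator K z *\<^sub>R (if z \<in> D then f z else 0))"
    by (rule borel_integrable_compact[OF K(1) continuous_on_subset[OF cont]]) simp
  moreover have "(\<lambda>z. indicator K z *\<^sub>R (if z \<in> D then f z else 0)) = (\<lambda>z. if z \<in> D then f z else 0)"
    using f(2) by (auto simp: fun_eq_iff indicator_def)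
  ultimately show "integrable lborel (\<lambda>z. if z \<in> D then f z else 0)" by simp
qed

text \<open>Weak gradients and weak solutions are defined by integrals over \<open>D\<close> with
  respect to \<open>lebesgue\<close>; the computations use Borel functions extended by zero and
  \<open>lborel\<close>.\<close>

lemma set_integral_lebesgue_eq:
  fixes h :: "'a::euclidean_space \<Rightarrow> 'b::euclidean_space"
  assumes "h0 \<in> borel_measurable lborel" "\<And>z. z \<in> D \<Longrightarrow> h0 z = h z" "\<And>z. z \<notin> D \<Longrightarrow> h0 z = 0"
  shows "(LINT z:D|lebesgue. h z) = (LINT z|lborel. h0 z)"
proof -
  have "(LINT z:D|lebesgue. h z) = (LINT z|lebesgue. h0 z)"
    unfolding set_lebesgue_integral_def
    by (rule Bochner_Integration.integral_cong) (auto simp: indicator_def assms)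
  also have "\<dots> = (LINT z|lborel. h0 z)"
    by (rule integral_completion[OF assms(1)])
  finally show ?thesis .
qed

lemma continuous_imp_L1_loc:
  fixes f :: "'a::euclidean_space \<Rightarrow> 'b::euclidean_space"
  assumes "continuous_on D f" shows "L1_loc D f"
  unfolding L1_loc_def set_integrable_def
proof (intro allI impI)
  fix K assume K: "compact K \<and> K \<subseteq> D"
  then have "integrable lborel (\<lambda>z. indicator K z *\<^sub>R f z)"
    using assms by (intro borel_integrable_compact) (auto intro: continuous_on_subset)
  then show "integrable lebesgue (\<lambda>z. indicator K z *\<^sub>R f z)"
    by (subst integrable_completion) (auto intro: borel_measurable_integrable)
qed

lemma continuous_imp_L2_loc:
  fixes f :: "'a::euclidean_space \<Rightarrow> 'b::euclidean_space"
  assumes f: "continuous_on D f" shows "L2_loc D f"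
  unfolding L2_loc_def L2_on_def
proof (intro allI impI conjI)
  fix K assume K: "compact K \<and> K \<subseteq> D"
  show "set_borel_measurable lebesgue K f"
    using continuous_imp_L1_loc[OF f] K unfolding L1_loc_def set_integrable_def set_borel_measurable_def
    by (blast intro: borel_measurable_integrable)
  have "L1_loc D (\<lambda>z. (norm (f z))\<^sup>2)" by (intro continuous_imp_L1_loc continuous_intros f)
  then show "set_integrable lebesgue K (\<lambda>z. (norm (f z))\<^sup>2)" using K by (simp add: L1_loc_def)
qed

lemma test_function_grad:
  fixes \<psi> :: "'a::euclidean_space \<Rightarrow> real"
  assumes \<psi>: "test_function D \<psi>" and g: "\<And>x. GDERIV \<psi> x :> g x" and b: "b \<in> Basis"
  shows "test_function D (\<lambda>x. b \<bullet> g x)"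
proof -
  obtain K where K: "compact K" "K \<subseteq> D" "\<And>z. z \<notin> K \<Longrightarrow> \<psi> z = 0" using test_function_support[OF \<psi>] by blast
  have "b \<bullet> g z = 0" if "z \<notin> K" for z
    by (rule GDERIV_zero_on_open[OF g, of "- K"]) (use K that compact_imp_closed in auto)
  moreover have "smooth (\<lambda>x. b \<bullet> g x)" by (rule smooth_grad[OF smooth_test_function[OF \<psi>] g b])
  ultimately show ?thesis
    unfolding test_function_def compact_support_in_def smooth_def using K(1,2) by (metis DiffD2 subsetD)
qed

text \<open>The product of \<open>u\<close> with a test function, extended by zero, is a
  \<open>C^1\<close> function of compact support, so the integral of its gradient vanishes; the
  product rule then is integration by parts.\<close>

lemma classical_weak_gradient:
  fixes u :: "'a::euclidean_space \<Rightarrow> real"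
  assumes D: "open D" and u: "\<And>z. z \<in> D \<Longrightarrow> GDERIV u z :> G z" and G: "continuous_on D G"
  shows "weak_gradient D u G"
  unfolding weak_gradient_def
proof (intro conjI allI impI ballI)
  have cu: "continuous_on D u"
    using u unfolding gderiv_def by (intro continuous_at_imp_continuous_on ballI) (blast intro: has_derivative_continuous)
  show "L1_loc D u" "L1_loc D G" using cu G by (auto intro: continuous_imp_L1_loc)
  fix \<psi> :: "'a \<Rightarrow> real" and b :: 'a assume \<psi>: "test_function D \<psi>" and b: "b \<in> Basis"
  obtain K where K: "compact K" "K \<subseteq> D" "\<And>z. z \<notin> K \<Longrightarrow> \<psi> z = 0" using test_function_support[OF \<psi>] by blast
  obtain g where g: "\<And>x. GDERIV \<psi> x :> g x" "\<And>b. b \<in> Basis \<Longrightarrow> smooth (\<lambda>x. b \<bullet> g x)"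
    using smooth_GDERIV[OF smooth_test_function[OF \<psi>]] by blast
  have g0: "d \<bullet> g z = 0" if "z \<notin> K" for z d
    by (rule GDERIV_zero_on_open[OF g(1), of "- K"]) (use K that compact_imp_closed in auto)
  have gz: "g z = 0" if "z \<notin> K" for z using g0[OF that, of "g z"] by simp
  have cg: "continuous_on UNIV g" by (rule continuous_on_grad, rule smooth_continuous, rule g)
  have c\<psi>: "continuous_on UNIV \<psi>" by (rule smooth_continuous[OF smooth_test_function[OF \<psi>]])
  define P where "P z = (if z \<in> D then u z * \<psi> z else 0)" for z
  define p where "p z = (if z \<in> D then u z *\<^sub>R g z + \<psi> z *\<^sub>R G z else 0)" for z
  have contp: "continuous_on UNIV p"
    unfolding p_def
    by (rule zero_extension(1)[OF D K(1,2)])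
      (auto intro!: continuous_intros cu G continuous_on_subset[OF cg] continuous_on_subset[OF c\<psi>] simp: K(3) gz)
  have derp: "GDERIV P z :> p z" for z
  proof (cases "z \<in> D")
    case True
    have "GDERIV (\<lambda>z. u z * \<psi> z) z :> u z *\<^sub>R g z + \<psi> z *\<^sub>R G z"
      by (rule GDERIV_mult[OF u[OF True] g(1)])
    then have "GDERIV P z :> u z *\<^sub>R g z + \<psi> z *\<^sub>R G z"
      unfolding gderiv_def
      by (rule has_derivative_transform_within_open[OF _ D True]) (simp add: P_def)
    then show ?thesis using True by (simp add: p_def)
  next
    case False
    then have "z \<in> - K" using K by auto
    have "((\<lambda>z. 0::real) has_derivative (\<lambda>h. 0)) (at z)" by simp
    then have "(P has_derivative (\<lambda>h. 0)) (at z)"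
      by (rule has_derivative_transform_within_open[OF _ _ \<open>z \<in> - K\<close>])
        (use K(1,3) compact_imp_closed in \<open>auto simp: P_def\<close>)
    then show ?thesis using False by (simp add: gderiv_def p_def)
  qed
  have zero: "(LINT z|lborel. b \<bullet> p z) = 0"
    by (rule integral_GDERIV_compact_support[OF derp contp K(1)]) (simp add: P_def K(3))
  define p1 where "p1 z = (if z \<in> D then u z * (b \<bullet> g z) else 0)" for z
  define p2 where "p2 z = (if z \<in> D then (G z \<bullet> b) * \<psi> z else 0)" for z
  have p1: "integrable lborel p1" unfolding p1_def
    by (rule zero_extension(2)[OF D K(1,2)])
      (auto intro!: continuous_intros cu continuous_on_subset[OF cg] simp: g0)
  have p2: "integrable lborel p2" unfolding p2_def
    by (rule zero_extension(2)[OF D K(1,2)])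
      (auto intro!: continuous_intros G continuous_on_subset[OF c\<psi>] simp: K(3))
  have "b \<bullet> p z = p1 z + p2 z" for z
    by (simp add: p_def p1_def p2_def inner_add_right inner_commute mult.commute)
  then have "(LINT z|lborel. p1 z) + (LINT z|lborel. p2 z) = 0"
    using zero p1 p2 by simp
  moreover have "(LINT z:D|lebesgue. u z * frechet_derivative \<psi> (at z) b) = (LINT z|lborel. p1 z)"
    by (rule set_integral_lebesgue_eq[OF borel_measurable_integrable[OF p1]])
      (auto simp: p1_def GDERIV_frechet(2)[OF g(1)])
  moreover have "(LINT z:D|lebesgue. (G z \<bullet> b) * \<psi> z) = (LINT z|lborel. p2 z)"
    by (rule set_integral_lebesgue_eq[OF borel_measurable_integrable[OF p2]]) (auto simp: p2_def)
  ultimately show "(LINT z:D|lebesgue. u z * frechet_derivative \<psi> (at z) b) = - (LINT z:D|lebesgue. (G z \<bullet> b) * \<psi> z)"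
    by simp
qed

lemma GDERIV_Re_holomorphic:
  assumes "h holomorphic_on D" "open D" "z \<in> D"
  shows "GDERIV (\<lambda>z. Re (h z)) z :> cnj (deriv h z)"
proof -
  have "(h has_derivative (\<lambda>d. deriv h z * d)) (at z)"
    using holomorphic_derivI[OF assms] by (simp add: has_field_derivative_def)
  then have "((\<lambda>z. Re (h z)) has_derivative (\<lambda>d. Re (deriv h z * d))) (at z)"
    by (rule has_derivative_Re)
  moreover have "Re (deriv h z * d) = d \<bullet> cnj (deriv h z)" for d by (simp add: inner_complex_def)
  ultimately show ?thesis by (simp add: gderiv_def)
qed

lemma inner_cnj_eq_Re_mult: "b \<bullet> cnj w = Re (b * w)"
  by (simp add: inner_complex_def)

text \<open>A partial derivative is a sum of two functions of the same shape: one with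
  \<open>b * deriv h\<close> in place of \<open>h\<close>, the other with a partial derivative of
  the cutoff. The induction therefore varies \<open>h\<close> and \<open>\<zeta>\<close>
  together.\<close>

lemma smooth_cutoff_Re_holomorphic:
  assumes D: "open D" and h: "h holomorphic_on D" and \<zeta>: "test_function D \<zeta>"
  shows "smooth (\<lambda>z. if z \<in> D then \<zeta> z * Re (h z) else 0)"
proof -
  have "C_k k (\<lambda>z. if z \<in> D then \<zeta> z * Re (h z) else 0)" for k
    using h \<zeta>
  proof (induction k arbitrary: h \<zeta>)
    case (0 h \<zeta>)
    obtain K where K: "compact K" "K \<subseteq> D" "\<And>z. z \<notin> K \<Longrightarrow> \<zeta> z = 0" using test_function_support[OF 0(2)] by blast
    have "continuous_on UNIV (\<lambda>z. if z \<in> D then \<zeta> z * Re (h z) else 0)"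
      by (rule zero_extension(1)[OF D K(1,2)])
        (auto intro!: continuous_intros holomorphic_on_imp_continuous_on[OF 0(1)]
          continuous_on_subset[OF smooth_continuous[OF smooth_test_function[OF 0(2)]]] simp: K(3))
    then show ?case by simp
  next
    case (Suc k h \<zeta>)
    obtain K where K: "compact K" "K \<subseteq> D" "\<And>z. z \<notin> K \<Longrightarrow> \<zeta> z = 0" using test_function_support[OF Suc.prems(2)] by blast
    obtain g where g: "\<And>x. GDERIV \<zeta> x :> g x"
      using smooth_GDERIV[OF smooth_test_function[OF Suc.prems(2)]] by blast
    have g0: "d \<bullet> g z = 0" if "z \<notin> K" for z d
      by (rule GDERIV_zero_on_open[OF g, of "- K"]) (use K that compact_imp_closed in auto)
    define p where "p z = (if z \<in> D then \<zeta> z *\<^sub>R cnj (deriv h z) + Re (h z) *\<^sub>R g z else 0)" for z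
    have "GDERIV (\<lambda>z. if z \<in> D then \<zeta> z * Re (h z) else 0) z :> p z" for z
    proof (cases "z \<in> D")
      case True
      have "GDERIV (\<lambda>z. \<zeta> z * Re (h z)) z :> \<zeta> z *\<^sub>R cnj (deriv h z) + Re (h z) *\<^sub>R g z"
        by (rule GDERIV_mult[OF g GDERIV_Re_holomorphic[OF Suc.prems(1) D True]])
      then have "GDERIV (\<lambda>z. if z \<in> D then \<zeta> z * Re (h z) else 0) z :> \<zeta> z *\<^sub>R cnj (deriv h z) + Re (h z) *\<^sub>R g z"
        unfolding gderiv_def by (rule has_derivative_transform_within_open[OF _ D True]) simp
      then show ?thesis using True by (simp add: p_def)
    next
      case False
      then have "z \<in> - K" using K by auto
      have "((\<lambda>z. 0::real) has_derivative (\<lambda>h. 0)) (at z)" by simp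
      then have "((\<lambda>z. if z \<in> D then \<zeta> z * Re (h z) else 0) has_derivative (\<lambda>h. 0)) (at z)"
        by (rule has_derivative_transform_within_open[OF _ _ \<open>z \<in> - K\<close>])
          (use K(1,3) compact_imp_closed in auto)
      then show ?thesis using False by (simp add: gderiv_def p_def)
    qed
    moreover have "C_k k (\<lambda>z. b \<bullet> p z)" if b: "b \<in> Basis" for b
    proof -
      have "C_k k (\<lambda>z. if z \<in> D then \<zeta> z * Re (b * deriv h z) else 0)"
        by (rule Suc.IH[OF _ Suc.prems(2)]) (intro holomorphic_intros holomorphic_deriv Suc.prems D)
      moreover have "C_k k (\<lambda>z. if z \<in> D then (b \<bullet> g z) * Re (h z) else 0)"
        by (rule Suc.IH[OF Suc.prems(1) test_function_grad[OF Suc.prems(2) g b]])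
      ultimately have "C_k k (\<lambda>z. (if z \<in> D then \<zeta> z * Re (b * deriv h z) else 0) + (if z \<in> D then (b \<bullet> g z) * Re (h z) else 0))"
        by (rule C_k_add)
      moreover have "(if z \<in> D then \<zeta> z * Re (b * deriv h z) else 0) + (if z \<in> D then (b \<bullet> g z) * Re (h z) else 0) = b \<bullet> p z" for z
        by (simp only: p_def inner_cnj_eq_Re_mult inner_add_right inner_scaleR_right split: if_split) simp
      ultimately show ?thesis by simp
    qed
    ultimately show ?case by (rule C_k_SucI)
  qed
  then show ?thesis by (simp add: smooth_def)
qed

text \<open>Test functions supported in \<open>D - K\<close> pair to 0 with \<open>\<eta>\<close>,
  so the fundamental lemma applies to each component of \<open>W\<close> there. This is what permits
  cutoffs in integrals against \<open>W\<close>.\<close>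

lemma weak_gradient_zero_off_support:
  fixes \<eta> :: "'a::euclidean_space \<Rightarrow> real"
  assumes D: "open D" and w: "weak_gradient D \<eta> W" and K: "compact K" "\<And>z. z \<in> D \<Longrightarrow> z \<notin> K \<Longrightarrow> \<eta> z = 0"
  shows "AE z in lebesgue. z \<in> D \<longrightarrow> z \<notin> K \<longrightarrow> W z = 0"
proof -
  define S where "S = D - K"
  have S: "open S" unfolding S_def using D compact_imp_closed[OF K(1)] by (rule open_Diff)
  have "AE z in lebesgue. z \<in> S \<longrightarrow> W z \<bullet> b = 0" if b: "b \<in> Basis" for b
  proof (rule fundamental_lemma_AE[OF S])
    show "L1_loc S (\<lambda>z. W z \<bullet> b)"
      unfolding L1_loc_def set_integrable_def
    proof (intro allI impI)
      fix C assume "compact C \<and> C \<subseteq> S"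
      then have "integrable lebesgue (\<lambda>z. indicator C z *\<^sub>R W z)"
        using w unfolding weak_gradient_def L1_loc_def S_def set_integrable_def by blast
      from integrable_inner_left[OF this, of b]
      show "integrable lebesgue (\<lambda>z. indicator C z *\<^sub>R (W z \<bullet> b))" by simp
    qed
    fix \<psi> assume \<psi>: "test_function S \<psi>"
    obtain C where C: "compact C" "C \<subseteq> S" "\<And>z. z \<notin> C \<Longrightarrow> \<psi> z = 0" using test_function_support[OF \<psi>] by blast
    have \<psi>D: "test_function D \<psi>"
      using \<psi> C unfolding test_function_def compact_support_in_def S_def by blast
    obtain g where g: "\<And>x. GDERIV \<psi> x :> g x"
      using smooth_GDERIV[OF smooth_test_function[OF \<psi>]] by blast
    have g0: "d \<bullet> g z = 0" if "z \<notin> C" for z d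
      by (rule GDERIV_zero_on_open[OF g, of "- C"]) (use C that compact_imp_closed in auto)
    have eq: "indicator D z *\<^sub>R (\<eta> z * frechet_derivative \<psi> (at z) b) = 0" for z
      using GDERIV_frechet(2)[OF g, of z b] g0[of z b] K(2)[of z] C(2) unfolding S_def by (cases "z \<in> D") auto
    have "(LINT z:D|lebesgue. \<eta> z * frechet_derivative \<psi> (at z) b) = 0"
      unfolding set_lebesgue_integral_def eq by simp
    moreover have "(LINT z:D|lebesgue. \<eta> z * frechet_derivative \<psi> (at z) b) = - (LINT z:D|lebesgue. (W z \<bullet> b) * \<psi> z)"
      using w \<psi>D b unfolding weak_gradient_def by blast
    ultimately have "(LINT z:D|lebesgue. (W z \<bullet> b) * \<psi> z) = 0" by linarith
    moreover have eq: "indicator D z *\<^sub>R ((W z \<bullet> b) * \<psi> z) = indicator S z *\<^sub>R ((W z \<bullet> b) * \<psi> z)" for z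
    proof (cases "z \<in> S")
      case True
      then show ?thesis by (simp add: S_def)
    next
      case False
      then have "\<psi> z = 0" using C(2,3) by blast
      then show ?thesis by simp
    qed
    ultimately show "(LINT z:S|lebesgue. (W z \<bullet> b) * \<psi> z) = 0"
      unfolding set_lebesgue_integral_def by (simp only: eq)
  qed
  then have "AE z in lebesgue. \<forall>b\<in>Basis. z \<in> S \<longrightarrow> W z \<bullet> b = 0"
    by (intro AE_finite_allI) auto
  then show ?thesis
    by eventually_elim (auto simp: S_def intro: euclidean_eqI)
qed

lemma integrable_L1_loc_times:
  fixes W :: "'a::euclidean_space \<Rightarrow> 'b::euclidean_space"
  assumes W: "L1_loc D W" and K: "compact K" "K \<subseteq> D" and f: "continuous_on UNIV f" "\<And>z. z \<notin> K \<Longrightarrow> f z = 0"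
  shows "integrable lebesgue (\<lambda>z. indicator D z *\<^sub>R (f z \<bullet> W z))"
proof -
  have i: "integrable lebesgue (\<lambda>z. indicator K z *\<^sub>R W z)"
    using W K by (simp add: L1_loc_def set_integrable_def)
  obtain M where M: "\<And>z. z \<in> K \<Longrightarrow> norm (f z) \<le> M"
    using compact_imp_bounded[OF compact_continuous_image[OF continuous_on_subset[OF f(1)] K(1)]]
    by (force simp: bounded_iff)
  have "f \<in> borel_measurable lebesgue"
    by (intro measurable_completion) (simp add: borel_measurable_continuous_onI f)
  then have m: "(\<lambda>z. f z \<bullet> (indicator K z *\<^sub>R W z)) \<in> borel_measurable lebesgue"
    using i by (intro borel_measurable_inner) auto
  have "integrable lebesgue (\<lambda>z. f z \<bullet> (indicator K z *\<^sub>R W z))"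
  proof (rule Bochner_Integration.integrable_bound[OF _ m])
    show "integrable lebesgue (\<lambda>z. M * norm (indicator K z *\<^sub>R W z))" using i by (intro integrable_mult_right integrable_norm)
    have "norm (f z \<bullet> (indicator K z *\<^sub>R W z)) \<le> norm (M * norm (indicator K z *\<^sub>R W z))" for z
    proof (cases "z \<in> K")
      case True
      have "0 \<le> M" using M[OF True] norm_ge_zero order_trans by blast
      then show ?thesis using True Cauchy_Schwarz_ineq2[of "f z" "W z"] mult_right_mono[OF M[OF True] norm_ge_zero[of "W z"]]
        by (simp add: abs_mult)
    qed simp
    then show "AE z in lebesgue. norm (f z \<bullet> (indicator K z *\<^sub>R W z)) \<le> norm (M * norm (indicator K z *\<^sub>R W z))"
      by (rule AE_I2)
  qed
  moreover have "(\<lambda>z. f z \<bullet> (indicator K z *\<^sub>R W z)) = (\<lambda>z. indicator D z *\<^sub>R (f z \<bullet> W z))"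
    using f(2) K(2) by (auto simp: fun_eq_iff indicator_def)
  ultimately show ?thesis by metis
qed

section \<open>Weak solutions and regularity\<close>

text \<open>\<open>K\<close> may be non-convex or disconnected. Pairs closer than \<open>d\<close>
  are joined within a ball in a larger compact subset of \<open>D\<close> and use the derivative;
  pairs further apart use boundedness.\<close>

lemma holomorphic_holder_on_compact:
  assumes D: "open D" and h: "h holomorphic_on D" and K: "compact K" "K \<subseteq> D" and \<alpha>: "0 < \<alpha>" "\<alpha> < 1"
  shows "\<exists>C. \<forall>x\<in>K. \<forall>y\<in>K. norm (h x - h y) \<le> C * norm (x - y) powr \<alpha>"
proof -
  obtain d where d: "0 < d" "(\<Union>x\<in>K. cball x d) \<subseteq> D"
    using compact_subset_open_imp_cball_epsilon_subset[OF K(1) D K(2)] by blast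
  define K1 where "K1 = (\<Union>x\<in>K. cball x d)"
  have K1: "compact K1" "K1 \<subseteq> D" unfolding K1_def using d(2) by (auto intro: compact_minkowski_sum_cball K)
  have ch: "continuous_on K1 h" "continuous_on K1 (deriv h)"
    using h K1(2) holomorphic_deriv[OF h D]
    by (auto intro: holomorphic_on_imp_continuous_on holomorphic_on_subset)
  obtain S where S: "\<And>x. x \<in> K1 \<Longrightarrow> norm (h x) \<le> S"
    using compact_imp_bounded[OF compact_continuous_image[OF ch(1) K1(1)]] by (force simp: bounded_iff)
  obtain M where M: "\<And>x. x \<in> K1 \<Longrightarrow> norm (deriv h x) \<le> M"
    using compact_imp_bounded[OF compact_continuous_image[OF ch(2) K1(1)]] by (force simp: bounded_iff)
  define C where "C = \<bar>M\<bar> * d powr (1 - \<alpha>) + 2 * \<bar>S\<bar> / d powr \<alpha>"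
  have "norm (h x - h y) \<le> C * norm (x - y) powr \<alpha>" if x: "x \<in> K" and y: "y \<in> K" for x y
  proof (cases "norm (x - y) \<le> d")
    case True
    have sub: "cball x d \<subseteq> K1" using x by (auto simp: K1_def)
    have "norm (h x - h y) \<le> \<bar>M\<bar> * norm (x - y)"
    proof (rule field_differentiable_bound[where S = "cball x d" and f' = "deriv h"])
      show "(h has_field_derivative deriv h z) (at z within cball x d)" if "z \<in> cball x d" for z
        using holomorphic_derivI[OF h D] that sub K1(2) by (blast intro: has_field_derivative_at_within)
      show "norm (deriv h z) \<le> \<bar>M\<bar>" if "z \<in> cball x d" for z
        using M[of z] that sub by force
    qed (use True d in \<open>auto simp: dist_norm\<close>)
    also have "norm (x - y) \<le> d powr (1 - \<alpha>) * norm (x - y) powr \<alpha>"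
    proof (cases "x = y")
      case False
      then have "norm (x - y) = norm (x - y) powr (1 - \<alpha>) * norm (x - y) powr \<alpha>"
        by (simp add: powr_add[symmetric])
      also have "\<dots> \<le> d powr (1 - \<alpha>) * norm (x - y) powr \<alpha>"
        using True \<alpha> by (intro mult_right_mono powr_mono2) auto
      finally show ?thesis .
    qed simp
    then have "\<bar>M\<bar> * norm (x - y) \<le> \<bar>M\<bar> * (d powr (1 - \<alpha>) * norm (x - y) powr \<alpha>)" by (intro mult_left_mono) auto
    also have "\<dots> \<le> C * norm (x - y) powr \<alpha>"
      unfolding C_def mult.assoc[symmetric] by (intro mult_right_mono) auto
    finally show ?thesis .
  next
    case False
    have "x \<in> K1" "y \<in> K1" using x y d(1) by (auto simp: K1_def intro: bexI[of _ x] bexI[of _ y])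
    then have "norm (h x - h y) \<le> 2 * \<bar>S\<bar>" using S[of x] S[of y] norm_triangle_ineq4[of "h x" "h y"] by linarith
    also have "\<dots> = 2 * \<bar>S\<bar> / d powr \<alpha> * d powr \<alpha>" using d(1) by simp
    also have "\<dots> \<le> 2 * \<bar>S\<bar> / d powr \<alpha> * norm (x - y) powr \<alpha>"
      using False d(1) \<alpha> by (intro mult_left_mono powr_mono2) auto
    also have "\<dots> \<le> C * norm (x - y) powr \<alpha>" unfolding C_def by (intro mult_right_mono) auto
    finally show ?thesis .
  qed
  then show ?thesis by blast
qed

lemma holder_on_add:
  fixes f g :: "'a::metric_space \<Rightarrow> 'b::real_normed_vector"
  assumes "holder_on \<alpha> S f" "holder_on \<alpha> S g"
  shows "holder_on \<alpha> S (\<lambda>x. f x + g x)"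
proof -
  obtain A B where A: "\<And>x y. x \<in> S \<Longrightarrow> y \<in> S \<Longrightarrow> dist (f x) (f y) \<le> A * dist x y powr \<alpha>"
    and B: "\<And>x y. x \<in> S \<Longrightarrow> y \<in> S \<Longrightarrow> dist (g x) (g y) \<le> B * dist x y powr \<alpha>"
    using assms unfolding holder_on_def by blast
  have "dist (f x + g x) (f y + g y) \<le> (A + B) * dist x y powr \<alpha>" if "x \<in> S" "y \<in> S" for x y
    using A[OF that] B[OF that] dist_triangle_add[of "f x" "g x" "f y" "g y"] by (simp add: distrib_right)
  then show ?thesis unfolding holder_on_def by blast
qed

lemma holder_on_minus:
  fixes f :: "'a::metric_space \<Rightarrow> 'b::real_normed_vector"
  shows "holder_on \<alpha> S f \<Longrightarrow> holder_on \<alpha> S (\<lambda>x. - f x)"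
  by (simp add: holder_on_def dist_minus)

lemma holder_on_newton:
  assumes F: "bounded_density R B F" and S: "\<And>z. z \<in> S \<Longrightarrow> norm z \<le> T" and \<beta>: "0 < \<beta>" "\<beta> < 1"
  shows "holder_on \<beta> S (newton 0 F)"
proof -
  obtain A where A: "0 \<le> A" "\<And>F B z z'. bounded_density R B F \<Longrightarrow> \<bar>newton 0 F z - newton 0 F z'\<bar> \<le> B * A * norm (z - z')"
    by (rule newton_lipschitz[of R]) blast
  have B: "0 \<le> B" by (rule bounded_density_nonneg[OF F])
  have "dist (newton 0 F x) (newton 0 F y) \<le> B * A * (2 * \<bar>T\<bar>) powr (1 - \<beta>) * dist x y powr \<beta>" if x: "x \<in> S" and y: "y \<in> S" for x y
  proof (cases "x = y")
    case False
    have "norm (x - y) \<le> 2 * \<bar>T\<bar>" using S[OF x] S[OF y] norm_triangle_ineq4[of x y] by linarith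
    then have "norm (x - y) powr (1 - \<beta>) \<le> (2 * \<bar>T\<bar>) powr (1 - \<beta>)" using \<beta> by (intro powr_mono2) auto
    then have "norm (x - y) powr (1 - \<beta>) * norm (x - y) powr \<beta> \<le> (2 * \<bar>T\<bar>) powr (1 - \<beta>) * norm (x - y) powr \<beta>"
      by (intro mult_right_mono) auto
    then have "norm (x - y) \<le> (2 * \<bar>T\<bar>) powr (1 - \<beta>) * norm (x - y) powr \<beta>"
      using False by (simp add: powr_add[symmetric])
    then have "B * A * norm (x - y) \<le> B * A * ((2 * \<bar>T\<bar>) powr (1 - \<beta>) * norm (x - y) powr \<beta>)"
      using A(1) B by (intro mult_left_mono) auto
    then show ?thesis using A(2)[OF F, of x y] by (simp add: dist_norm mult.assoc)
  qed simp
  then show ?thesis unfolding holder_on_def by blast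
qed

section \<open>The weak equation\<close>

text \<open>The identity is first obtained for the smoothed potential and then passed to the limit
  on both sides: the smoothed Laplacians are bounded by \<open>B\<close> and tend to
  \<open>F\<close> on \<open>D\<close>, the gradients converge uniformly, and \<open>W\<close> is
  integrable on compact subsets of \<open>D\<close>.\<close>

lemma weak_solution_of_representation:
  assumes D: "open D" and F: "bounded_density R B F" and H: "H holomorphic_on D"
    and U: "\<And>z. z \<in> D \<Longrightarrow> U z = newton 0 F z + Re (H z)"
    and f: "continuous_on UNIV f" "\<And>z. z \<in> D \<Longrightarrow> F z = f (U z)"
    and G: "\<And>z. G z = newton_grad 0 F z + cnj (deriv H z)"
    and gderiv: "\<And>z. z \<in> D \<Longrightarrow> GDERIV U z :> G z" and contG: "continuous_on D G"
  shows "weak_solution D f U"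
proof -
  have contU: "continuous_on D U"
    using gderiv unfolding gderiv_def by (intro continuous_at_imp_continuous_on ballI) (blast intro: has_derivative_continuous)
  have WG: "W12_loc D U G"
    unfolding W12_loc_def
    using classical_weak_gradient[OF D gderiv contG] continuous_imp_L2_loc[OF contU] continuous_imp_L2_loc[OF contG] by blast
  have contF: "isCont F z" if "z \<in> D" for z
  proof -
    have "continuous_on D (\<lambda>z. f (U z))" by (intro continuous_on_compose2[OF f(1) contU]) auto
    then have "continuous_on D F" using f(2) by (simp cong: continuous_on_cong)
    then show ?thesis using D that by (simp add: continuous_on_eq_continuous_at)
  qed
  have "(LINT z:D|lebesgue. G z \<bullet> W z) + (LINT z:D|lebesgue. f (U z) * \<eta> z) = 0"
    if \<eta>: "continuous_on D \<eta>" and W: "W12 D \<eta> W" and supp: "compact_support_in D \<eta>" for \<eta> W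
  proof -
    obtain K where K: "compact K" "K \<subseteq> D" "\<And>z. z \<in> D \<Longrightarrow> z \<notin> K \<Longrightarrow> \<eta> z = 0"
      using supp unfolding compact_support_in_def by blast
    have wg: "weak_gradient D \<eta> W" using W by (simp add: W12_def)
    then have W1: "L1_loc D W" by (simp add: weak_gradient_def)
    have W0: "AE z in lebesgue. z \<in> D \<longrightarrow> z \<notin> K \<longrightarrow> W z = 0"
      by (rule weak_gradient_zero_off_support[OF D wg K(1,3)])
    \<comment> \<open>Being 1 near \<open>K\<close>, the cutoff leaves the divergence of the field
      unchanged where \<open>\<eta>\<close> can be nonzero.\<close>
    obtain \<zeta> O' where \<zeta>: "test_function D \<zeta>" and O': "open O'" "K \<subseteq> O'" "\<And>z. z \<in> O' \<Longrightarrow> \<zeta> z = 1"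
      by (rule smooth_cutoff[OF K(1) D K(2)]) blast
    obtain K' where K': "compact K'" "K' \<subseteq> D" "\<And>z. z \<notin> K' \<Longrightarrow> \<zeta> z = 0" using test_function_support[OF \<zeta>] by blast
    have c\<zeta>: "continuous_on UNIV \<zeta>" by (rule smooth_continuous[OF smooth_test_function[OF \<zeta>]])
    have cH: "continuous_on D (deriv H)" by (rule holomorphic_on_imp_continuous_on[OF holomorphic_deriv[OF H D]])
    define X where "X e z = newton_grad e F z + cnj (deriv H z)" for e z
    \<comment> \<open>The cut-off smoothed gradient; its components \<open>\<psi> b\<close> serve as
      the test functions.\<close>
    define V where "V e z = (if z \<in> D then \<zeta> z *\<^sub>R X e z else 0)" for e z
    define lap where "lap e z = (LINT w|lborel. F w * poisson_profile e (z - w))" for e z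
    have Wm: "(\<lambda>z. indicator D z *\<^sub>R W z) \<in> borel_measurable lebesgue"
      using W by (simp add: W12_def L2_on_def set_borel_measurable_def)
    have step: "(LINT z|lborel. (if z \<in> D then \<eta> z * lap e z else 0)) = - (LINT z|lebesgue. indicator D z *\<^sub>R (V e z \<bullet> W z))"
      and contV: "continuous_on UNIV (V e)" if e: "0 < e" for e
    proof -
      obtain L where L: "\<And>b z. b \<in> Basis \<Longrightarrow> GDERIV (\<lambda>z. b \<bullet> newton_grad e F z) z :> L b z"
        "\<And>z. (\<Sum>b\<in>Basis. b \<bullet> L b z) = lap e z"
        using laplacian_newton[OF F e] unfolding lap_def by metis
      define \<psi> where "\<psi> b z = \<zeta> z * (b \<bullet> newton_grad e F z) + (if z \<in> D then \<zeta> z * Re (b * deriv H z) else 0)" for b z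
      have \<psi>V: "\<psi> b z = V e z \<bullet> b" for b z
      proof (cases "z \<in> D")
        case True
        then have "V e z \<bullet> b = \<zeta> z * (b \<bullet> newton_grad e F z) + \<zeta> z * (b \<bullet> cnj (deriv H z))"
          by (simp only: V_def X_def if_True inner_scaleR_left inner_add_left distrib_left inner_commute[of b])
        then show ?thesis using True by (simp only: \<psi>_def if_True inner_cnj_eq_Re_mult)
      next
        case False
        then have "\<zeta> z = 0" using K'(2,3) by blast
        then show ?thesis using False by (simp add: \<psi>_def V_def)
      qed
      have smN: "smooth (\<lambda>z. b \<bullet> newton_grad e F z)" if "b \<in> Basis" for b
        by (rule smooth_grad[OF smooth_newton[OF F e] GDERIV_newton_smoothed[OF F e] that])
      have sm: "smooth (\<psi> b)" if b: "b \<in> Basis" for b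
      proof -
        have "(\<lambda>z. b * deriv H z) holomorphic_on D" by (intro holomorphic_intros holomorphic_deriv H D)
        from smooth_cutoff_Re_holomorphic[OF D this \<zeta>] show ?thesis
          using smN[OF b] smooth_test_function[OF \<zeta>] unfolding \<psi>_def smooth_def by (intro allI C_k_add C_k_mult) auto
      qed
      have \<psi>0: "\<psi> b z = 0" if "z \<notin> K'" for b z using K'(3)[OF that] by (simp add: \<psi>_def)
      have test: "test_function D (\<psi> b)" if "b \<in> Basis" for b
        using sm[OF that] \<psi>0 K'(1,2) unfolding test_function_def compact_support_in_def smooth_def by (metis DiffD2 subsetD)
      show contV: "continuous_on UNIV (V e)"
        by (rule continuous_on_grad) (metis (mono_tags, lifting) \<psi>V continuous_on_cong inner_commute sm smooth_continuous)
      have ex: "\<exists>g. \<forall>x. GDERIV (\<psi> b) x :> g x" if "b \<in> Basis" for b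
        using smooth_GDERIV[OF sm[OF that]] by blast
      then obtain g where g: "\<And>b x. b \<in> Basis \<Longrightarrow> GDERIV (\<psi> b) x :> g b x" by metis
      have gK: "b \<bullet> g b z = b \<bullet> L b z + Re (b * b * deriv (deriv H) z)" if z: "z \<in> K" and b: "b \<in> Basis" for z b
      proof -
        have zD: "z \<in> D \<inter> O'" using z K(2) O'(2) by auto
        have h: "(\<lambda>z. b * deriv H z) holomorphic_on D" by (intro holomorphic_intros holomorphic_deriv H D)
        have "deriv (\<lambda>z. b * deriv H z) z = b * deriv (deriv H) z"
          using zD holomorphic_deriv[OF H D] D by (intro deriv_cmult) (auto simp: holomorphic_on_imp_differentiable_at)
        then have "GDERIV (\<lambda>z. b \<bullet> newton_grad e F z + Re (b * deriv H z)) z :> L b z + cnj (b * deriv (deriv H) z)"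
          using GDERIV_add[OF L(1)[OF b] GDERIV_Re_holomorphic[OF h D, of z]] zD by simp
        then have "GDERIV (\<psi> b) z :> L b z + cnj (b * deriv (deriv H) z)"
          unfolding gderiv_def
          by (rule has_derivative_transform_within_open[OF _ open_Int[OF D O'(1)] zD])
            (auto simp: \<psi>_def O'(3))
        then have "g b z = L b z + cnj (b * deriv (deriv H) z)" by (rule GDERIV_unique[OF g[OF b]])
        then show ?thesis by (simp only: inner_add_right inner_cnj_eq_Re_mult mult.assoc)
      qed
      have sumK: "(\<Sum>b\<in>Basis. b \<bullet> g b z) = lap e z" if "z \<in> K" for z
      proof -
        have "(\<Sum>b\<in>Basis. b \<bullet> g b z) = (\<Sum>b\<in>Basis. b \<bullet> L b z) + (\<Sum>b\<in>Basis. Re (b * b * deriv (deriv H) z))"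
          using gK[OF that] by (simp add: sum.distrib)
        \<comment> \<open>The squares of the basis vectors \<open>1\<close> and \<open>\<i>\<close>
          cancel: this is the harmonicity of \<open>Re H\<close>.\<close>
        also have "(\<Sum>b\<in>Basis. Re (b * b * deriv (deriv H) z)) = 0"
          by (simp add: Basis_complex_def)
        finally show ?thesis by (simp add: L(2))
      qed
      define p where "p b z = (if z \<in> D then \<eta> z * (b \<bullet> g b z) else 0)" for b z
      have cg: "continuous_on UNIV (\<lambda>z. b \<bullet> g b z)" if "b \<in> Basis" for b
        by (rule smooth_continuous[OF smooth_grad[OF sm[OF that] g[OF that] that]])
      have ip: "integrable lborel (p b)" if "b \<in> Basis" for b
        unfolding p_def
        by (rule zero_extension(2)[OF D K(1,2)])
          (auto intro!: continuous_intros \<eta> continuous_on_subset[OF cg[OF that]] simp: K(3))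
      \<comment> \<open>The roles are exchanged here: the derivative on the smooth
        \<open>\<psi> b\<close> is moved to \<open>\<eta>\<close> by the definition of its weak
        gradient.\<close>
      have by_parts: "(LINT z|lborel. p b z) = - (LINT z|lebesgue. indicator D z *\<^sub>R ((W z \<bullet> b) * \<psi> b z))" if b: "b \<in> Basis" for b
      proof -
        have "(LINT z:D|lebesgue. \<eta> z * frechet_derivative (\<psi> b) (at z) b) = (LINT z|lborel. p b z)"
          by (rule set_integral_lebesgue_eq[OF borel_measurable_integrable[OF ip[OF b]]])
            (auto simp: p_def GDERIV_frechet(2)[OF g[OF b]])
        moreover have "(LINT z:D|lebesgue. \<eta> z * frechet_derivative (\<psi> b) (at z) b) = - (LINT z:D|lebesgue. (W z \<bullet> b) * \<psi> b z)"
          using wg test[OF b] b unfolding weak_gradient_def by blast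
        ultimately show ?thesis by (simp only: set_lebesgue_integral_def)
      qed
      have "(\<lambda>z. if z \<in> D then \<eta> z * lap e z else 0) = (\<lambda>z. \<Sum>b\<in>Basis. p b z)"
      proof
        show "(if z \<in> D then \<eta> z * lap e z else 0) = (\<Sum>b\<in>Basis. p b z)" for z
          using sumK[of z] K(3)[of z]
          by (cases "z \<in> D"; cases "z \<in> K") (auto simp: p_def sum_distrib_left[symmetric])
      qed
      then have "(LINT z|lborel. (if z \<in> D then \<eta> z * lap e z else 0)) = (\<Sum>b\<in>Basis. LINT z|lborel. p b z)"
        using ip by (simp add: Bochner_Integration.integral_sum)
      also have "\<dots> = - (\<Sum>b\<in>Basis. LINT z|lebesgue. indicator D z *\<^sub>R ((W z \<bullet> b) * \<psi> b z))"
        by (simp add: by_parts sum_negf)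
      also have "(\<Sum>b\<in>Basis. LINT z|lebesgue. indicator D z *\<^sub>R ((W z \<bullet> b) * \<psi> b z))
          = (LINT z|lebesgue. (\<Sum>b\<in>Basis. indicator D z *\<^sub>R ((W z \<bullet> b) * \<psi> b z)))"
      proof (rule Bochner_Integration.integral_sum[symmetric])
        fix b :: complex assume b: "b \<in> Basis"
        have "integrable lebesgue (\<lambda>z. indicator D z *\<^sub>R ((\<psi> b z *\<^sub>R b) \<bullet> W z))"
          by (rule integrable_L1_loc_times[OF W1 K'(1,2)])
            (auto intro!: continuous_intros smooth_continuous sm b simp: \<psi>0)
        then show "integrable lebesgue (\<lambda>z. indicator D z *\<^sub>R ((W z \<bullet> b) * \<psi> b z))"
          by (simp add: inner_commute mult.commute)
      qed
      also have "(\<lambda>z. \<Sum>b\<in>Basis. indicator D z *\<^sub>R ((W z \<bullet> b) * \<psi> b z)) = (\<lambda>z. indicator D z *\<^sub>R (V e z \<bullet> W z))"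
      proof
        fix z
        have "V e z \<bullet> W z = (\<Sum>b\<in>Basis. (V e z \<bullet> b) * (W z \<bullet> b))" by (rule euclidean_inner)
        then show "(\<Sum>b\<in>Basis. indicator D z *\<^sub>R ((W z \<bullet> b) * \<psi> b z)) = indicator D z *\<^sub>R (V e z \<bullet> W z)"
          by (simp add: \<psi>V sum_distrib_left mult.commute)
      qed
      finally show "(LINT z|lborel. (if z \<in> D then \<eta> z * lap e z else 0)) = - (LINT z|lebesgue. indicator D z *\<^sub>R (V e z \<bullet> W z))" .
    qed
    define h where "h n = 1 / (real n + 1)" for n
    have h: "0 < h n" for n by (simp add: h_def)
    have lim1: "(\<lambda>n. LINT z|lborel. (if z \<in> D then \<eta> z * lap (h n) z else 0)) \<longlonglongrightarrow> (LINT z|lborel. (if z \<in> D then \<eta> z * F z else 0))"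
    proof (rule integral_dominated_convergence)
      have i\<eta>: "integrable lborel (\<lambda>z. if z \<in> D then \<eta> z else 0)"
        by (rule zero_extension(2)[OF D K(1,2) \<eta> K(3)])
      then show "integrable lborel (\<lambda>z. B * \<bar>if z \<in> D then \<eta> z else 0\<bar>)" by simp
      have m\<eta>: "(\<lambda>z. if z \<in> D then \<eta> z else 0) \<in> borel_measurable borel" using i\<eta> by auto
      have "F \<in> borel_measurable borel" using F by (simp add: bounded_density_def)
      then have "(\<lambda>z. (if z \<in> D then \<eta> z else 0) * F z) \<in> borel_measurable lborel" using m\<eta> by simp
      moreover have "(\<lambda>z. (if z \<in> D then \<eta> z else 0) * F z) = (\<lambda>z. if z \<in> D then \<eta> z * F z else 0)"
        by auto
      ultimately show "(\<lambda>z. if z \<in> D then \<eta> z * F z else 0) \<in> borel_measurable lborel" by simp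
      have "lap (h n) \<in> borel_measurable borel" for n
      proof -
        obtain L where L: "\<And>b z. b \<in> Basis \<Longrightarrow> GDERIV (\<lambda>z. b \<bullet> newton_grad (h n) F z) z :> L b z"
          "\<And>z. (\<Sum>b\<in>Basis. b \<bullet> L b z) = lap (h n) z"
          using laplacian_newton[OF F h] unfolding lap_def by metis
        have "smooth (\<lambda>z. b \<bullet> L b z)" if "b \<in> Basis" for b
          by (rule smooth_grad[OF smooth_grad[OF smooth_newton[OF F h] GDERIV_newton_smoothed[OF F h] that] L(1)[OF that] that])
        then have "continuous_on UNIV (\<lambda>z. \<Sum>b\<in>Basis. b \<bullet> L b z)" by (intro continuous_on_sum smooth_continuous)
        then show ?thesis by (simp add: L(2) borel_measurable_continuous_onI)
      qed
      then have "(\<lambda>z. (if z \<in> D then \<eta> z else 0) * lap (h n) z) \<in> borel_measurable lborel" for n using m\<eta> by simp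
      moreover have "(\<lambda>z. (if z \<in> D then \<eta> z else 0) * lap (h n) z) = (\<lambda>z. if z \<in> D then \<eta> z * lap (h n) z else 0)" for n
        by auto
      ultimately show "(\<lambda>z. if z \<in> D then \<eta> z * lap (h n) z else 0) \<in> borel_measurable lborel" for n by simp
      have "\<bar>lap (h n) z\<bar> \<le> B" for n z unfolding lap_def by (rule poisson_profile_bound[OF F h])
      then have "norm (if z \<in> D then \<eta> z * lap (h n) z else 0) \<le> B * \<bar>if z \<in> D then \<eta> z else 0\<bar>" for n z
        by (subst mult.commute) (auto simp: abs_mult intro!: mult_left_mono)
      then show "AE z in lborel. norm (if z \<in> D then \<eta> z * lap (h n) z else 0) \<le> B * \<bar>if z \<in> D then \<eta> z else 0\<bar>" for n
        by (rule AE_I2)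
      have "(\<lambda>n. if z \<in> D then \<eta> z * lap (h n) z else 0) \<longlonglongrightarrow> (if z \<in> D then \<eta> z * F z else 0)" for z
      proof (cases "z \<in> D")
        case True
        have "(\<lambda>n. lap (h n) z) \<longlonglongrightarrow> F z"
          unfolding lap_def h_def by (rule poisson_profile_tendsto[OF F contF[OF True]])
        then show ?thesis using True by (simp add: tendsto_mult_left)
      qed simp
      then show "AE z in lborel. (\<lambda>n. if z \<in> D then \<eta> z * lap (h n) z else 0) \<longlonglongrightarrow> (if z \<in> D then \<eta> z * F z else 0)"
        by (rule AE_I2)
    qed
    have lim2: "(\<lambda>n. LINT z|lebesgue. indicator D z *\<^sub>R (V (h n) z \<bullet> W z)) \<longlonglongrightarrow> (LINT z|lebesgue. indicator D z *\<^sub>R (\<zeta> z *\<^sub>R G z \<bullet> W z))"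
    proof -
      obtain A where A: "0 \<le> A" "\<And>e z. norm (newton_grad e F z) \<le> B * A"
        by (rule newton_grad_bound[of R]) (use F in blast)
      obtain A' where A': "0 \<le> A'" "\<And>e z. 0 < e \<Longrightarrow> norm (newton_grad e F z - newton_grad 0 F z) \<le> B * A' * sqrt e"
        by (rule newton_grad_smoothing[of R]) (use F in blast)
      obtain S where S: "\<And>z. z \<in> K' \<Longrightarrow> norm (deriv H z) \<le> S"
        using compact_imp_bounded[OF compact_continuous_image[OF continuous_on_subset[OF cH K'(2)] K'(1)]]
        by (force simp: bounded_iff)
      have iW: "integrable lebesgue (\<lambda>z. indicator K' z *\<^sub>R W z)"
        using W1 K' by (simp add: L1_loc_def set_integrable_def)
      obtain Z where Z: "\<And>z. z \<in> K' \<Longrightarrow> \<bar>\<zeta> z\<bar> \<le> Z"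
        using compact_imp_bounded[OF compact_continuous_image[OF continuous_on_subset[OF c\<zeta>] K'(1)]]
        by (force simp: bounded_iff)
      show ?thesis
      proof (rule integral_dominated_convergence)
        show "integrable lebesgue (\<lambda>z. \<bar>Z\<bar> * (B * A + \<bar>S\<bar>) * norm (indicator K' z *\<^sub>R W z))"
          using iW by (intro integrable_mult_right integrable_norm)
        have XS: "norm (X e z) \<le> B * A + \<bar>S\<bar>" if "z \<in> K'" for e z
          using A(2)[of e z] S[OF that] norm_triangle_ineq[of "newton_grad e F z" "cnj (deriv H z)"]
          by (simp add: X_def)
        have "norm (indicator D z *\<^sub>R (V (h n) z \<bullet> W z)) \<le> \<bar>Z\<bar> * (B * A + \<bar>S\<bar>) * norm (indicator K' z *\<^sub>R W z)" for n z
        proof (cases "z \<in> K'")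
          case True
          have "norm (V (h n) z) \<le> \<bar>Z\<bar> * (B * A + \<bar>S\<bar>)"
            using True K'(2) Z[OF True] XS[OF True, of "h n"] by (auto simp: V_def intro!: mult_mono)
          then have "norm (V (h n) z) * norm (W z) \<le> \<bar>Z\<bar> * (B * A + \<bar>S\<bar>) * norm (W z)" by (rule mult_right_mono) simp
          then show ?thesis using True K'(2) Cauchy_Schwarz_ineq2[of "V (h n) z" "W z"] by (auto simp: subset_iff)
        qed (simp add: V_def K'(3))
        then show "AE z in lebesgue. norm (indicator D z *\<^sub>R (V (h n) z \<bullet> W z)) \<le> \<bar>Z\<bar> * (B * A + \<bar>S\<bar>) * norm (indicator K' z *\<^sub>R W z)" for n
          by (rule AE_I2)
        show meas: "(\<lambda>z. indicator D z *\<^sub>R (V (h n) z \<bullet> W z)) \<in> borel_measurable lebesgue" for n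
          by (rule borel_measurable_integrable, rule integrable_L1_loc_times[OF W1 K'(1,2) contV[OF h]])
            (simp add: V_def K'(3))
        have ptw: "(\<lambda>n. indicator D z *\<^sub>R (V (h n) z \<bullet> W z)) \<longlonglongrightarrow> indicator D z *\<^sub>R (\<zeta> z *\<^sub>R G z \<bullet> W z)" for z
        proof (cases "z \<in> D")
          case True
          have "(\<lambda>n. newton_grad (h n) F z - newton_grad 0 F z) \<longlonglongrightarrow> 0"
          proof (rule Lim_null_comparison)
            show "\<forall>\<^sub>F n in sequentially. norm (newton_grad (h n) F z - newton_grad 0 F z) \<le> B * A' * sqrt (h n)"
              using A'(2)[OF h] by simp
            have "h \<longlonglongrightarrow> 0" unfolding h_def by real_asymp
            then have "(\<lambda>n. B * A' * sqrt (h n)) \<longlonglongrightarrow> B * A' * sqrt 0" by (intro tendsto_intros)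
            then show "(\<lambda>n. B * A' * sqrt (h n)) \<longlonglongrightarrow> 0" by simp
          qed
          then have "(\<lambda>n. newton_grad (h n) F z) \<longlonglongrightarrow> newton_grad 0 F z" by (rule LIM_zero_cancel)
          then have "(\<lambda>n. (\<zeta> z *\<^sub>R (newton_grad (h n) F z + cnj (deriv H z))) \<bullet> W z) \<longlonglongrightarrow> (\<zeta> z *\<^sub>R (newton_grad 0 F z + cnj (deriv H z))) \<bullet> W z"
            by (intro tendsto_intros)
          then show ?thesis using True by (simp add: V_def X_def G)
        qed simp
        then show "AE z in lebesgue. (\<lambda>n. indicator D z *\<^sub>R (V (h n) z \<bullet> W z)) \<longlonglongrightarrow> indicator D z *\<^sub>R (\<zeta> z *\<^sub>R G z \<bullet> W z)"
          by (rule AE_I2)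
        show "(\<lambda>z. indicator D z *\<^sub>R (\<zeta> z *\<^sub>R G z \<bullet> W z)) \<in> borel_measurable lebesgue"
          by (rule borel_measurable_LIMSEQ_real[OF ptw meas])
      qed
    qed
    have "(LINT z|lborel. (if z \<in> D then \<eta> z * F z else 0)) = - (LINT z|lebesgue. indicator D z *\<^sub>R (\<zeta> z *\<^sub>R G z \<bullet> W z))"
      by (rule LIMSEQ_unique[OF lim1]) (unfold step[OF h], rule tendsto_minus[OF lim2])
    moreover have "(LINT z:D|lebesgue. f (U z) * \<eta> z) = (LINT z|lborel. (if z \<in> D then \<eta> z * F z else 0))"
    proof (rule set_integral_lebesgue_eq)
      have "integrable lborel (\<lambda>z. if z \<in> D then f (U z) * \<eta> z else 0)"
        by (rule zero_extension(2)[OF D K(1,2)])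
          (auto intro!: continuous_intros \<eta> continuous_on_compose2[OF f(1) contU] simp: K(3))
      then have "(\<lambda>z. if z \<in> D then f (U z) * \<eta> z else 0) \<in> borel_measurable lborel"
        by (rule borel_measurable_integrable)
      moreover have "(\<lambda>z. if z \<in> D then f (U z) * \<eta> z else 0) = (\<lambda>z. if z \<in> D then \<eta> z * F z else 0)"
        using f(2) by (auto simp: fun_eq_iff)
      ultimately show "(\<lambda>z. if z \<in> D then \<eta> z * F z else 0) \<in> borel_measurable lborel" by simp
    qed (use f(2) in auto)
    moreover have "(LINT z:D|lebesgue. G z \<bullet> W z) = (LINT z|lebesgue. indicator D z *\<^sub>R (\<zeta> z *\<^sub>R G z \<bullet> W z))"
      unfolding set_lebesgue_integral_def
    proof (rule integral_cong_AE)
      have "(\<lambda>z. if z \<in> D then G z else 0) \<in> borel_measurable borel"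
        using contG D by (intro borel_measurable_continuous_on_if) auto
      then have "(\<lambda>z. if z \<in> D then G z else 0) \<in> borel_measurable lebesgue"
        by (intro measurable_completion) simp
      then have "(\<lambda>z. (if z \<in> D then G z else 0) \<bullet> (indicator D z *\<^sub>R W z)) \<in> borel_measurable lebesgue"
        using Wm by (intro borel_measurable_inner)
      moreover have "(\<lambda>z. (if z \<in> D then G z else 0) \<bullet> (indicator D z *\<^sub>R W z)) = (\<lambda>z. indicator D z *\<^sub>R (G z \<bullet> W z))"
        by (auto simp: fun_eq_iff)
      ultimately show mG: "(\<lambda>z. indicator D z *\<^sub>R (G z \<bullet> W z)) \<in> borel_measurable lebesgue" by metis
      have "\<zeta> \<in> borel_measurable lebesgue"
        by (intro measurable_completion) (simp add: borel_measurable_continuous_onI c\<zeta>)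
      then have "(\<lambda>z. \<zeta> z * (indicator D z *\<^sub>R (G z \<bullet> W z))) \<in> borel_measurable lebesgue"
        using mG by (intro borel_measurable_times)
      then show "(\<lambda>z. indicator D z *\<^sub>R (\<zeta> z *\<^sub>R G z \<bullet> W z)) \<in> borel_measurable lebesgue"
        by (simp add: mult_ac)
      show "AE z in lebesgue. indicator D z *\<^sub>R (G z \<bullet> W z) = indicator D z *\<^sub>R (\<zeta> z *\<^sub>R G z \<bullet> W z)"
        using W0
      proof eventually_elim
        case (elim z)
        then show ?case using O'(2,3) by (cases "z \<in> D"; cases "z \<in> K") (auto simp: subset_iff)
      qed
    qed
    ultimately show ?thesis by simp
  qed
  then show ?thesis unfolding weak_solution_def using contU WG by blast
qed

text \<open>The first factor is unbounded near 0 when \<open>q < 1\<close>, but the product has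
  modulus \<open>\<bar>t\<bar> powr q\<close>, which settles continuity at 0.\<close>

lemma continuous_signed_power:
  assumes "0 < q"
  shows "continuous_on UNIV (\<lambda>t::real. \<bar>t\<bar> powr (q - 1) * t)"
proof (rule continuous_at_imp_continuous_on, rule ballI)
  fix t :: real
  show "isCont (\<lambda>t. \<bar>t\<bar> powr (q - 1) * t) t"
  proof (cases "t = 0")
    case True
    have "((\<lambda>t::real. \<bar>t\<bar> powr q) \<longlongrightarrow> \<bar>0\<bar> powr q) (at 0)"
      using assms by (intro tendsto_powr' tendsto_intros) auto
    then have lim: "((\<lambda>t::real. \<bar>t\<bar> powr q) \<longlongrightarrow> 0) (at 0)" by simp
    have "norm (\<bar>s\<bar> powr (q - 1) * s) \<le> \<bar>s\<bar> powr q" for s :: real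
      by (cases "s = 0") (auto simp: abs_mult powr_diff)
    then have "((\<lambda>t::real. \<bar>t\<bar> powr (q - 1) * t) \<longlongrightarrow> 0) (at 0)"
      by (intro Lim_null_comparison[OF always_eventually lim] allI)
    then show ?thesis using True by (simp add: isCont_def)
  next
    case False
    then show ?thesis by (intro continuous_intros) auto
  qed
qed

theorem corollary7:
  fixes D :: "complex set" and \<phi> :: "complex \<Rightarrow> real" and q :: real
  assumes "smooth_jordan_domain D"
    and "continuous_on (frontier D) \<phi>"
    and "0 < q" and "q < 1"
  shows "\<exists>U :: complex \<Rightarrow> real.
      weak_solution D (\<lambda>t. \<bar>t\<bar> powr (q - 1) * t) U \<and>
      continuous_on (closure D) U \<and>
      (\<forall>z\<in>frontier D. U z = \<phi> z) \<and>
      (\<forall>\<alpha>. 0 < \<alpha> \<and> \<alpha> < 1 \<longrightarrow> C1_holder_loc \<alpha> D U) \<and>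
      (\<forall>\<beta>. 0 < \<beta> \<and> \<beta> < 1 \<and> holder_on \<beta> (frontier D) \<phi> \<longrightarrow> holder_on \<beta> (closure D) U)"
proof -
  define f where "f t = \<bar>t\<bar> powr (q - 1) * t" for t :: real
  have contf: "continuous_on UNIV f" unfolding f_def by (rule continuous_signed_power[OF assms(3)])
  have f_bound: "\<bar>f t\<bar> \<le> \<bar>t\<bar> powr q" for t
    by (cases "t = 0") (auto simp: f_def abs_mult powr_diff)
  have D: "open D" "bounded D" "D \<noteq> {}" using assms(1) by (auto simp: smooth_jordan_domain_def)
  have sc: "simply_connected D" by (rule smooth_jordan_domain_simply_connected[OF assms(1)])
  note sector = smooth_jordan_domain_exterior_sector[OF assms(1)]
  obtain R where "\<And>z. z \<in> D \<Longrightarrow> norm z \<le> R" using D(2) by (auto simp: bounded_iff)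
  then have DR: "D \<subseteq> ball 0 (R + 1)" by force
  obtain U H B where U: "continuous_on (closure D) U" "\<And>z. z \<in> frontier D \<Longrightarrow> U z = \<phi> z"
    and H: "H holomorphic_on D" and FB: "bounded_density (R + 1) B (\<lambda>w. if w \<in> D then f (U w) else 0)"
    and rep0: "\<And>z. z \<in> D \<Longrightarrow> U z = newton 0 (\<lambda>w. if w \<in> D then f (U w) else 0) z + Re (H z)"
    by (rule semilinear_existence[OF D(1) sc D(2,3) DR sector assms(2) contf f_bound assms(3,4)]) blast+
  define F where "F w = (if w \<in> D then f (U w) else 0)" for w
  have F: "bounded_density (R + 1) B F" using FB by (simp add: F_def[abs_def])
  have rep: "U z = newton 0 F z + Re (H z)" if "z \<in> D" for z using rep0[OF that] by (simp add: F_def[abs_def])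
  define G where "G z = newton_grad 0 F z + cnj (deriv H z)" for z
  have gderiv: "GDERIV U z :> G z" if z: "z \<in> D" for z
  proof -
    have "GDERIV (\<lambda>z. newton 0 F z + Re (H z)) z :> G z"
      unfolding G_def by (rule GDERIV_add[OF GDERIV_newton[OF F] GDERIV_Re_holomorphic[OF H D(1) z]])
    then show ?thesis
      unfolding gderiv_def by (rule has_derivative_transform_within_open[OF _ D(1) z]) (simp add: rep)
  qed
  have holdN: "holder_on \<alpha> K (newton_grad 0 F)" if "0 < \<alpha>" "\<alpha> < 1" for \<alpha> K
    using newton_grad_holder[OF that F] unfolding holder_on_def dist_norm by blast
  \<comment> \<open>Hoelder continuity with any one exponent, here \<open>1/2\<close>, gives
    continuity of the gradient.\<close>
  have contN: "continuous_on UNIV (newton_grad 0 F)"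
  proof (rule continuous_at_imp_continuous_on, rule ballI)
    fix z :: complex
    obtain C where C: "\<And>z z'. norm (newton_grad 0 F z - newton_grad 0 F z') \<le> C * norm (z - z') powr (1/2)"
      using newton_grad_holder[OF _ _ F, of "1/2"] by auto
    have "((\<lambda>y. C * norm (y - z) powr (1/2)) \<longlongrightarrow> C * norm (z - z) powr (1/2)) (at z)"
      by (intro tendsto_intros tendsto_powr') auto
    then have lim: "((\<lambda>y. C * norm (y - z) powr (1/2)) \<longlongrightarrow> 0) (at z)" by simp
    have "((\<lambda>y. newton_grad 0 F y - newton_grad 0 F z) \<longlongrightarrow> 0) (at z)"
      by (rule Lim_null_comparison[OF always_eventually lim]) (simp add: C)
    then show "isCont (newton_grad 0 F) z" unfolding isCont_def by (rule LIM_zero_cancel)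
  qed
  have contG: "continuous_on D G"
    unfolding G_def
    by (intro continuous_intros continuous_on_subset[OF contN] holomorphic_on_imp_continuous_on holomorphic_deriv H D) auto
  have "weak_solution D f U"
    by (rule weak_solution_of_representation[OF D(1) F H rep contf _ G_def gderiv contG]) (simp_all add: F_def)
  moreover have "C1_holder_loc \<alpha> D U" if \<alpha>: "0 < \<alpha>" "\<alpha> < 1" for \<alpha>
    unfolding C1_holder_loc_def
  proof (intro exI[of _ G] conjI ballI allI impI gderiv)
    fix K assume K: "compact K \<and> K \<subseteq> D"
    have "holder_on \<alpha> K (\<lambda>z. cnj (deriv H z))"
      using holomorphic_holder_on_compact[OF D(1) holomorphic_deriv[OF H D(1)] _ _ \<alpha>, of K] K
      unfolding holder_on_def dist_norm by (simp flip: complex_cnj_diff)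
    then show "holder_on \<alpha> K G" unfolding G_def[abs_def] by (intro holder_on_add holdN \<alpha>)
  qed
  moreover have "holder_on \<beta> (closure D) U" if \<beta>: "0 < \<beta>" "\<beta> < 1" and \<phi>: "holder_on \<beta> (frontier D) \<phi>" for \<beta>
  proof -
    have nR: "norm z \<le> R + 1" if "z \<in> closure D" for z
      using closure_minimal[OF order.trans[OF DR ball_subset_cball] closed_cball] that by auto
    have N: "holder_on \<beta> (closure D) (newton 0 F)" by (rule holder_on_newton[OF F nR \<beta>])
    \<comment> \<open>\<open>U\<close> minus its potential is harmonic, and its boundary values
      \<open>\<phi> - newton 0 F\<close> are still of order \<open>\<beta>\<close>, because the
      potential is Lipschitz. The boundary estimate applies to this difference, and the potential is
      added back.\<close>
    have Nfr: "holder_on \<beta> (frontier D) (\<lambda>z. - newton 0 F z)"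
      by (rule holder_on_minus, rule holder_on_newton[OF F _ \<beta>]) (use nR in \<open>auto simp: frontier_def\<close>)
    have "holder_on \<beta> (frontier D) U" using \<phi> U(2) by (simp add: holder_on_def)
    from holder_on_add[OF this Nfr] have fr: "holder_on \<beta> (frontier D) (\<lambda>z. U z + - newton 0 F z)" .
    have "holder_on \<beta> (closure D) (\<lambda>z. U z + - newton 0 F z)"
    proof (rule dirichlet_holder[OF D sector H _ _ \<beta> fr])
      show "continuous_on (closure D) (\<lambda>z. U z + - newton 0 F z)"
        by (intro continuous_intros U continuous_newton[OF F])
    qed (simp_all add: rep)
    from holder_on_add[OF this N] show ?thesis by simp
  qed
  ultimately show ?thesis using U unfolding f_def[abs_def] by blast
qed

end
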